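(* Let $a\in(0,1]$, let $\theta\in C^1((0,\infty))$ satisfy $\sup_{r>0}|r\theta'(r)|<\infty$, and suppose there is $R>0$ with $\theta'(r)=0$ for all $r\ge R$. Then $$\Gamma_{\theta,a}\ge\frac12+\frac1{4a}.$$
   Context: Curved wedge $\Omega:=\{(r\cos[\varphi+\theta(r)],r\sin[\varphi+\theta(r)]):r>0,\ \varphi\in(0,2\pi a)\}$; $-\Delta_D^\Omega$ is the Dirichlet Laplacian in $L^2(\Omega)$ (form $\|\nabla u\|^2$ on $H_0^1(\Omega)$); $L^2_w(\Omega):=L^2(\Omega,e^{|x|^2/4}dx)$; $\Gamma_{\theta,a}:=\sup\{\gamma:\exists C_\gamma>0\ \forall t\ge0,\ \|e^{t\Delta_D^\Omega}\|_{L^2_w(\Omega)\to L^2(\Omega)}\le C_\gamma(1+t)^{-\gamma}\}$. *)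

theory Defs
  imports "HOL-Analysis.Analysis"
begin

definition curved_wedge :: "(real \<Rightarrow> real) \<Rightarrow> real \<Rightarrow> (real \<times> real) set" where
  "curved_wedge \<theta> a =
     {(r * cos (\<phi> + \<theta> r), r * sin (\<phi> + \<theta> r)) | r \<phi>. 0 < r \<and> 0 < \<phi> \<and> \<phi> < 2 * pi * a}"

definition test_pair ::
  "(real \<times> real) set \<Rightarrow> ((real \<times> real) \<Rightarrow> real) \<Rightarrow> ((real \<times> real) \<Rightarrow> (real \<times> real)) \<Rightarrow> bool" where
  "test_pair \<Omega> \<phi> G \<longleftrightarrow>
     (\<forall>x. (\<phi> has_derivative (\<lambda>h. G x \<bullet> h)) (at x)) \<and> continuous_on UNIV G \<and>
     compact (closure {x. \<phi> x \<noteq> 0}) \<and> closure {x. \<phi> x \<noteq> 0} \<subseteq> \<Omega>"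

definition H01 ::
  "(real \<times> real) set \<Rightarrow> ((real \<times> real) \<Rightarrow> real) \<Rightarrow> ((real \<times> real) \<Rightarrow> (real \<times> real)) \<Rightarrow> bool" where
  "H01 \<Omega> u V \<longleftrightarrow> u \<in> borel_measurable lborel \<and> V \<in> borel_measurable lborel \<and>
     (\<exists>\<phi> G. (\<forall>n. test_pair \<Omega> (\<phi> n) (G n)) \<and>
        (\<lambda>n. \<integral>\<^sup>+x. ennreal ((\<phi> n x - u x)\<^sup>2) \<partial>lborel) \<longlonglongrightarrow> 0 \<and>
        (\<lambda>n. \<integral>\<^sup>+x. ennreal ((norm (G n x - V x))\<^sup>2) \<partial>lborel) \<longlonglongrightarrow> 0)"

definition L2_on :: "(real \<times> real) set \<Rightarrow> ((real \<times> real) \<Rightarrow> real) \<Rightarrow> bool" where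
  "L2_on \<Omega> u \<longleftrightarrow> u \<in> borel_measurable lborel \<and> (\<forall>x. x \<notin> \<Omega> \<longrightarrow> u x = 0) \<and>
     (\<integral>\<^sup>+x. ennreal ((u x)\<^sup>2) \<partial>lborel) < \<infinity>"

text \<open>Weak solution of the heat equation u_t = \<Delta>u with Dirichlet condition on \<Omega>
(u \<in> C([0,\<infinity>);L^2) \<inter> L^2_loc((0,\<infinity>);H_0^1), initial datum u0, weak formulation against
test functions). Such a solution exists and is unique; U t = exp(t \<Delta>_D) u0.\<close>
definition dirichlet_heat_solution ::
  "(real \<times> real) set \<Rightarrow> ((real \<times> real) \<Rightarrow> real) \<Rightarrow> (real \<Rightarrow> (real \<times> real) \<Rightarrow> real)
     \<Rightarrow> (real \<Rightarrow> (real \<times> real) \<Rightarrow> (real \<times> real)) \<Rightarrow> bool" where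
  "dirichlet_heat_solution \<Omega> u0 U W \<longleftrightarrow>
     U 0 = u0 \<and>
     (\<forall>t>0. H01 \<Omega> (U t) (W t)) \<and>
     (\<lambda>(t, x). W t x) \<in> borel_measurable (lborel \<Otimes>\<^sub>M lborel) \<and>
     (\<forall>T>0. (\<integral>\<^sup>+t. indicator {0<..T} t * (\<integral>\<^sup>+x. ennreal ((norm (W t x))\<^sup>2) \<partial>lborel) \<partial>lborel) < \<infinity>) \<and>
     (\<forall>t0\<ge>0. ((\<lambda>t. \<integral>\<^sup>+x. ennreal ((U t x - U t0 x)\<^sup>2) \<partial>lborel) \<longlongrightarrow> 0) (at t0 within {0..})) \<and>
     (\<forall>\<phi> G t. test_pair \<Omega> \<phi> G \<and> 0 < t \<longrightarrow>
        (\<integral>x. U t x * \<phi> x \<partial>lborel) - (\<integral>x. u0 x * \<phi> x \<partial>lborel)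
          = - set_lebesgue_integral lborel {0..t} (\<lambda>s. \<integral>x. W s x \<bullet> G x \<partial>lborel))"

text \<open>\<parallel>exp(t \<Delta>_D)\<parallel>_{L^2_w \<rightarrow> L^2} \<le> C (1+t)^(-\<gamma>) for all t \<ge> 0.\<close>
definition heat_decay_bound :: "(real \<times> real) set \<Rightarrow> real \<Rightarrow> real \<Rightarrow> bool" where
  "heat_decay_bound \<Omega> C \<gamma> \<longleftrightarrow>
     (\<forall>t\<ge>0. \<forall>u0 U W. L2_on \<Omega> u0 \<and> dirichlet_heat_solution \<Omega> u0 U W \<longrightarrow>
        (\<integral>\<^sup>+x. ennreal ((U t x)\<^sup>2) \<partial>lborel)
          \<le> ennreal ((C * (1 + t) powr (-\<gamma>))\<^sup>2) *
             (\<integral>\<^sup>+x. ennreal ((u0 x)\<^sup>2 * exp ((norm x)\<^sup>2 / 4)) \<partial>lborel))"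

definition Gamma_decay :: "(real \<Rightarrow> real) \<Rightarrow> real \<Rightarrow> ereal" where
  "Gamma_decay \<theta> a =
     Sup {ereal \<gamma> | \<gamma>. \<exists>C>0. heat_decay_bound (curved_wedge \<theta> a) C \<gamma>}"

end

theory Submission
  imports Defs
begin

text \<open>
Put \<open>\<nu> = 1/(2a)\<close> and, for \<open>\<epsilon> > 0\<close>, let \<open>k(t,x) = \<epsilon> + (1+t) powr (-1-\<nu>) exp (-|x|^2/(4(1+t)))\<close>,
a positive radial solution of the heat equation in dimension \<open>2 + 2\<nu>\<close>. For a heat solution \<open>u\<close> the energy
\<open>\<integral> u(t)^2 / k(t)\<close> does not increase: complete the square with the field obtained from the gradient of
\<open>log k + \<nu> log r + log (sin (\<nu>\<alpha>))\<close>, \<open>\<alpha>\<close> being the angle in the definition of the wedge, by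
differentiating \<open>\<alpha>\<close> only along circles. Such a field does not see the twist \<open>\<theta>\<close>, so the curved
wedge is no worse than the straight one. Since \<open>1/k(0) \<le> exp (|x|^2/4)\<close> and
\<open>1/k(t) \<ge> 1/(\<epsilon> + (1+t) powr (-1-\<nu>))\<close>, letting \<open>\<epsilon>\<close> tend to \<open>0\<close> yields the decay
rate \<open>(1+\<nu>)/2\<close> with constant \<open>1\<close>.

A weak solution need not be differentiable in time, so the monotonicity is shown for the double
time average \<open>\<integral>\<integral> \<langle>u(\<sigma>), u(\<tau>)\<rangle>\<close> over \<open>[t, t+h]^2\<close>, \<open>\<langle>\<cdot>, \<cdot>\<rangle>\<close> being the \<open>L^2\<close> product
with weight \<open>1/k(t)\<close>. Minus its derivative is the double integral of a kernel that is positive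
semidefinite on finite sets of times, and then \<open>h\<close> tends to \<open>0\<close>.
\<close>

text \<open>The exponent \<nu> is the one for which r powr \<nu> times sin (\<nu>\<alpha>) is the
  positive harmonic function of the straight wedge vanishing on both sides. Multiplying a radial
  function by it turns the planar Laplacian into the radial one in dimension 2 + 2\<nu>, so k times
  it solves the heat equation there, the constant \<epsilon> included. This makes the completed
  square lossless: the zero-order term left over is exactly the time derivative of 1/k. In the
  curved wedge the twist adds only a radial vector to the gradient of \<alpha>. That gradient enters
  solely through the divergence of the rotational part of the field, where it is paired with the
  direction of the circles, so the radial vector drops out. The term \<epsilon> answers to the
  function spaces. Without it 1/k grows like a Gaussian, while a weak solution is only known to be
  square integrable together with its gradient. With \<epsilon> > 0 the weight, its gradient and its
  time derivative are bounded, so multiplication by the weight keeps \<open>H01\<close>, and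
  inequalities proved for test functions pass to the limit.\<close>

section \<open>Time averages of positive semidefinite kernels\<close>

text \<open>For p independent random points with law \<open>M\<close> divided by its mass c, the
  mean of the double sum is p D / c + (p * p - p) A / c^2, with D the integral over the diagonal and
  A the double integral. A bound by \<open>w x * w y\<close> with \<open>w\<close> square integrable
  is what gradients that are only square integrable in time provide; it makes D finite as well as
  A.\<close>

lemma psd_kernel_double_integral:
  fixes K :: "'a \<Rightarrow> 'a \<Rightarrow> real"
  assumes M: "finite_measure M" "0 < measure M (space M)"
    and meas [measurable]: "(\<lambda>(x, y). K x y) \<in> borel_measurable (M \<Otimes>\<^sub>M M)"
    and w: "integrable M (\<lambda>x. (w x)\<^sup>2)" "\<And>x. x \<in> space M \<Longrightarrow> 0 \<le> w x"
    and w_meas [measurable]: "w \<in> borel_measurable M"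
    and bound: "\<And>x y. x \<in> space M \<Longrightarrow> y \<in> space M \<Longrightarrow> \<bar>K x y\<bar> \<le> w x * w y"
    and psd: "\<And>n (x :: nat \<Rightarrow> 'a). (\<And>i. i < n \<Longrightarrow> x i \<in> space M) \<Longrightarrow>
                0 \<le> (\<Sum>i<n. \<Sum>j<n. K (x i) (x j))"
  shows "0 \<le> (\<integral>x. \<integral>y. K x y \<partial>M \<partial>M)"
proof -
  interpret finite_measure M by fact
  interpret P: pair_sigma_finite M M ..
  define c where "c = measure M (space M)"
  have c: "c > 0" using M by (simp add: c_def)
  have w_int: "integrable M w"
  proof (rule Bochner_Integration.integrable_bound)
    show "integrable M (\<lambda>x. 1 + (w x)\<^sup>2)" using w by auto
    have "\<bar>w x\<bar> \<le> \<bar>1 + (w x)\<^sup>2\<bar>" for x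
      using zero_le_power2[of "\<bar>w x\<bar> - 1/2"] by (auto simp: power2_eq_square algebra_simps)
    then show "AE x in M. norm (w x) \<le> norm (1 + (w x)\<^sup>2)" by simp
  qed auto
  have ww: "integrable (M \<Otimes>\<^sub>M M) (\<lambda>(x, y). w x * w y)"
    by (rule P.Fubini_integrable) (use w_int in \<open>auto simp: abs_mult\<close>)
  have K_int: "integrable (M \<Otimes>\<^sub>M M) (\<lambda>(x, y). K x y)"
    by (rule Bochner_Integration.integrable_bound[OF ww])
       (auto simp: space_pair_measure intro!: order_trans[OF bound] AE_I2)
  have K_int1: "integrable M (K x)" if "x \<in> space M" for x
  proof (rule Bochner_Integration.integrable_bound)
    show "integrable M (\<lambda>y. w x * w y)" using w_int by auto
    show "K x \<in> borel_measurable M" using that by measurable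
  qed (use bound that w in \<open>auto intro!: AE_I2 order_trans[OF bound]\<close>)
  have K_int2: "integrable M (\<lambda>y. K y x)" if "x \<in> space M" for x
  proof (rule Bochner_Integration.integrable_bound)
    show "integrable M (\<lambda>y. w y * w x)" using w_int by auto
    show "(\<lambda>y. K y x) \<in> borel_measurable M" using that by measurable
  qed (use bound that w in \<open>auto intro!: AE_I2 order_trans[OF bound]\<close>)
  have K_int3: "integrable M (\<lambda>x. K x x)"
  proof (rule Bochner_Integration.integrable_bound[OF w(1)])
    show "(\<lambda>x. K x x) \<in> borel_measurable M" by measurable
    show "AE x in M. norm (K x x) \<le> norm ((w x)\<^sup>2)"
      using bound by (auto simp: power2_eq_square)
  qed
  \<comment> \<open>Both marginals are added because the kernel of the application, a gradient of u
    against a gradient of the weighted u, is not symmetric as it stands.\<close>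
  define k where "k x = (\<integral>y. K x y \<partial>M) + (\<integral>y. K y x \<partial>M)" for x
  define D where "D = (\<integral>x. K x x \<partial>M)"
  define A where "A = (\<integral>x. \<integral>y. K x y \<partial>M \<partial>M)"
  have k_int: "integrable M k"
    unfolding k_def
    using P.integrable_fst'[OF K_int] P.integrable_snd[OF K_int] by auto
  have k_A: "(\<integral>x. k x \<partial>M) = 2 * A"
    unfolding k_def A_def
    using P.integrable_fst'[OF K_int] P.integrable_snd[OF K_int] P.Fubini_integral[OF K_int] by auto
  \<comment> \<open>the hypothesis for \<open>n + p\<close> points, averaged over \<open>p\<close> of them; letting \<open>p\<close> tend to infinity
    for \<open>n = 0\<close> makes the diagonal contribution \<open>D\<close> negligible\<close>
  have step: "0 \<le> (\<Sum>i<n. \<Sum>j<n. K (x i) (x j)) + real p / c * (\<Sum>i<n. k (x i)) + real p / c * D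
      + (real p * real p - real p) / c\<^sup>2 * A"
    if "\<And>i. i < n \<Longrightarrow> x i \<in> space M" for n p and x :: "nat \<Rightarrow> 'a"
    using that
  proof (induction p arbitrary: n x)
    case 0
    then show ?case using psd[of n x] by simp
  next
    case (Suc p)
    define S where "S = (\<Sum>i<n. \<Sum>j<n. K (x i) (x j))"
    define T where "T = (\<Sum>i<n. k (x i))"
    let ?C = "S + real p / c * T + real p / c * D + (real p * real p - real p) / c\<^sup>2 * A"
    let ?f = "\<lambda>y. ?C + (\<Sum>i<n. K (x i) y) + (\<Sum>i<n. K y (x i)) + K y y + real p / c * k y"
    \<comment> \<open>One of the averaged points is made explicit as point number \<open>n\<close>.
      The induction hypothesis holds for each value y of it, and integrating over y gives the
      formula with \<open>Suc p\<close>, up to the factor c.\<close>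
    have "0 \<le> ?f y" if y: "y \<in> space M" for y
    proof -
      let ?x = "x(n := y)"
      have "0 \<le> (\<Sum>i<Suc n. \<Sum>j<Suc n. K (?x i) (?x j)) + real p / c * (\<Sum>i<Suc n. k (?x i))
          + real p / c * D + (real p * real p - real p) / c\<^sup>2 * A"
        by (rule Suc.IH) (use Suc.prems y in \<open>auto simp: less_Suc_eq\<close>)
      moreover have "(\<Sum>i<Suc n. \<Sum>j<Suc n. K (?x i) (?x j))
          = S + (\<Sum>i<n. K (x i) y) + (\<Sum>i<n. K y (x i)) + K y y"
        by (simp add: S_def sum.distrib)
      moreover have "(\<Sum>i<Suc n. k (?x i)) = T + k y" by (simp add: T_def)
      ultimately show ?thesis by (simp add: algebra_simps)
    qed
    then have "0 \<le> (\<integral>y. ?f y \<partial>M)" by (intro integral_nonneg_AE AE_I2)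
    also have "(\<integral>y. ?f y \<partial>M) = c * ?C + (\<Sum>i<n. \<integral>y. K (x i) y \<partial>M) + (\<Sum>i<n. \<integral>y. K y (x i) \<partial>M)
        + D + real p / c * (2 * A)"
    proof -
      have i: "integrable M (\<lambda>y. \<Sum>i<n. K (x i) y)" "integrable M (\<lambda>y. \<Sum>i<n. K y (x i))"
        using K_int1 K_int2 Suc.prems by auto
      have "(\<integral>y. C + (\<Sum>i<n. K (x i) y) + (\<Sum>i<n. K y (x i)) + K y y + q * k y \<partial>M)
        = c * C + (\<Sum>i<n. \<integral>y. K (x i) y \<partial>M) + (\<Sum>i<n. \<integral>y. K y (x i) \<partial>M) + D + q * (2 * A)" for C q
        using i K_int1 K_int2 K_int3 k_int Suc.prems
        by (simp add: D_def k_A[symmetric]) (simp add: c_def)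
      then show ?thesis .
    qed
    also have "\<dots> = c * ?C + T + D + real p / c * (2 * A)"
      by (simp add: T_def k_def sum.distrib)
    finally have "0 \<le> (c * ?C + T + D + real p / c * (2 * A)) / c" using c by simp
    also have "\<dots> = S + real (Suc p) / c * T + real (Suc p) / c * D
        + (real (Suc p) * real (Suc p) - real (Suc p)) / c\<^sup>2 * A"
      using c by (simp add: field_simps power2_eq_square)
    finally show ?case by (simp add: S_def T_def)
  qed
  have main: "0 \<le> D * c / real p + A - A / real p" if "p > 0" for p :: nat
  proof -
    have "0 \<le> real p / c * D + (real p * real p - real p) / c\<^sup>2 * A"
      using step[of 0 undefined p] by simp
    then have "0 \<le> (real p / c * D + (real p * real p - real p) / c\<^sup>2 * A) * (c\<^sup>2 / (real p)\<^sup>2)"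
      by (rule mult_nonneg_nonneg) simp
    also have "\<dots> = D * c / real p + A - A / real p"
      using c that by (simp add: field_simps power2_eq_square)
    finally show ?thesis .
  qed
  have "(\<lambda>p. D * c * inverse (real p) + A - A * inverse (real p)) \<longlonglongrightarrow> D * c * 0 + A - A * 0"
    by (intro tendsto_intros lim_inverse_n)
  then have "0 \<le> D * c * 0 + A - A * 0"
    by (rule LIMSEQ_le_const) (use main in \<open>auto simp: divide_inverse intro!: exI[of _ 1]\<close>)
  then show ?thesis by (simp add: A_def)
qed

section \<open>Averages over a square moving along the diagonal\<close>

lemma sliding_integral_deriv:
  fixes \<psi> :: "real \<Rightarrow> real"
  assumes c: "continuous_on UNIV \<psi>" and h: "0 < h"
  shows "((\<lambda>x. integral {x..x+h} \<psi>) has_real_derivative (\<psi> (x+h) - \<psi> x)) (at x)"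
proof -
  \<comment> \<open>The base point lies strictly below x, so that \<Psi> is differentiable at x from
    both sides.\<close>
  define \<Psi> where "\<Psi> y = integral {x-1..y} \<psi>" for y
  have ci: "\<psi> integrable_on {a..b}" for a b
    by (rule integrable_continuous_real) (rule continuous_on_subset[OF c], simp)
  have d: "(\<Psi> has_real_derivative \<psi> y) (at y)" if "y > x - 1" for y
  proof -
    have "(\<Psi> has_real_derivative \<psi> y) (at y within {x-1..y+1})"
      unfolding \<Psi>_def by (rule integral_has_real_derivative) (use that in \<open>auto intro: continuous_on_subset[OF c]\<close>)
    then have "(\<Psi> has_real_derivative \<psi> y) (at y within {x-1<..<y+1})"
      by (rule DERIV_subset) auto
    then show ?thesis using that by (subst (asm) at_within_open) auto
  qed
  have "((\<lambda>y. \<Psi> (y + h) - \<Psi> y) has_real_derivative (\<psi> (x+h) - \<psi> x)) (at x)"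
    by (rule DERIV_diff[OF DERIV_shift[THEN iffD1, OF d] d]) (use h in auto)
  then show ?thesis
  proof (rule has_field_derivative_transform_within_open[where S="{x-1<..}"])
    fix y assume "y \<in> {x-1<..}"
    then show "\<Psi> (y + h) - \<Psi> y = integral {y..y+h} \<psi>"
      using Henstock_Kurzweil_Integration.integral_combine[of "x-1" y "y+h" \<psi>] ci h by (auto simp: \<Psi>_def)
  qed (use h in auto)
qed

text \<open>The two sides of the square are given separate parameters (\<open>R\<close> below). The
  derivative along the diagonal is the sum of the two partial derivatives, which coincide there by
  symmetry of \<open>f\<close>; hence the factor 2.\<close>

lemma square_integral_deriv_UNIV:
  fixes f :: "real \<Rightarrow> real \<Rightarrow> real"
  assumes c: "continuous_on UNIV (\<lambda>(x, y). f x y)" and sym: "\<And>x y. f x y = f y x" and h: "0 < h"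
  shows "((\<lambda>t. integral {t..t+h} (\<lambda>x. integral {t..t+h} (f x))) has_real_derivative
      2 * integral {t..t+h} (\<lambda>y. f (t+h) y - f t y)) (at t)"
proof -
  have [continuous_intros]: "continuous_on A (\<lambda>x. f (u x) (v x))"
    if "continuous_on A u" "continuous_on A v" for A :: "'z::topological_space set" and u v
    using continuous_on_compose2[OF c, of A "\<lambda>x. (u x, v x)"] that
    by (auto intro!: continuous_intros)
  define \<phi> where "\<phi> x y = integral {y..y+h} (f x)" for x y
  \<comment> \<open>Shifting to a fixed interval moves the parameter into the integrand, where
    continuity of parameter integrals applies.\<close>
  have \<phi>_alt: "\<phi> x y = integral (cbox 0 h) (\<lambda>\<tau>. f x (y + \<tau>))" for x y
    unfolding \<phi>_def using integral_shift_Icc_real[of 0 h "f x" y] h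
    by (simp add: add_ac o_def)
  have "continuous_on UNIV (\<lambda>p. integral (cbox 0 h) (\<lambda>\<tau>. f (fst p) (snd p + \<tau>)))"
    by (rule integral_continuous_on_param) (auto simp: case_prod_beta intro!: continuous_intros)
  then have \<phi>_c: "continuous_on UNIV (\<lambda>p. \<phi> (fst p) (snd p))"
    by (simp add: \<phi>_alt)
  have [continuous_intros]: "continuous_on A (\<lambda>x. \<phi> (u x) (v x))"
    if "continuous_on A u" "continuous_on A v" for A :: "'z::topological_space set" and u v
    using continuous_on_compose2[OF \<phi>_c, of A "\<lambda>x. (u x, v x)"] that
    by (auto intro!: continuous_intros)
  define R where "R x y = integral {x..x+h} (\<lambda>\<sigma>. \<phi> \<sigma> y)" for x y
  have R_sym: "R x y = R y x" for x y
  proof -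
    have "R x y = integral (cbox x (x+h)) (\<lambda>\<sigma>. integral (cbox y (y+h)) (f \<sigma>))"
      by (simp add: R_def \<phi>_def)
    also have "\<dots> = integral (cbox y (y+h)) (\<lambda>y. integral (cbox x (x+h)) (\<lambda>x. f x y))"
      by (rule integral_swap_continuous) (rule continuous_on_subset[OF c], simp)
    also have "\<dots> = R y x" by (subst sym) (simp add: R_def \<phi>_def)
    finally show ?thesis .
  qed
  have dx: "((\<lambda>x. R x y) has_real_derivative (\<phi> (x+h) y - \<phi> x y)) (at x)" for x y
    unfolding R_def by (rule sliding_integral_deriv) (auto intro!: continuous_intros h)
  have dy: "((\<lambda>y. R x y) has_real_derivative (\<phi> (y+h) x - \<phi> y x)) (at y)" for x y
    using dx[of x y] unfolding R_sym[of x] .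
  have "((\<lambda>(x, y). R x y) has_derivative (\<lambda>(tx, ty). (\<phi> (t+h) t - \<phi> t t) * tx +
      blinfun_mult_right (\<phi> (t+h) t - \<phi> t t) ty)) (at (t, t) within UNIV \<times> UNIV)"
  proof (rule has_derivative_partialsI[where fy="\<lambda>x y. blinfun_mult_right (\<phi> (y+h) x - \<phi> y x)"])
    show "((\<lambda>x. R x t) has_derivative (*) (\<phi> (t+h) t - \<phi> t t)) (at t within UNIV)"
      using dx by (simp add: has_field_derivative_def)
    show "((\<lambda>y. R x y) has_derivative blinfun_apply (blinfun_mult_right (\<phi> (y+h) x - \<phi> y x))) (at y within UNIV)" for x y
      using dy by (simp add: has_field_derivative_def)
    have "continuous_on UNIV (\<lambda>p. blinfun_mult_right (\<phi> (snd p+h) (fst p) - \<phi> (snd p) (fst p)))"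
      by (intro bounded_linear.continuous_on[OF bounded_linear_blinfun_mult_right] continuous_intros)
    then show "continuous (at (t, t) within UNIV \<times> UNIV) (\<lambda>(x, y). blinfun_mult_right (\<phi> (y+h) x - \<phi> y x))"
      by (simp add: continuous_on_eq_continuous_within case_prod_unfold)
  qed auto
  then have "((\<lambda>t. (\<lambda>(x, y). R x y) (t, t)) has_derivative (\<lambda>s. (\<lambda>(tx, ty). (\<phi> (t+h) t - \<phi> t t) * tx +
      blinfun_mult_right (\<phi> (t+h) t - \<phi> t t) ty) (s, s))) (at t)"
    by (intro has_derivative_compose[where f="\<lambda>t. (t, t)" and g="\<lambda>(x, y). R x y"])
       (auto intro!: derivative_eq_intros)
  then have "((\<lambda>t. R t t) has_derivative (\<lambda>s. (\<phi> (t+h) t - \<phi> t t) * s + (\<phi> (t+h) t - \<phi> t t) * s)) (at t)"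
    by (simp only: case_prod_conv blinfun_mult_right.rep_eq)
  moreover have "(\<lambda>s. (\<phi> (t+h) t - \<phi> t t) * s + (\<phi> (t+h) t - \<phi> t t) * s) = (*) (2 * (\<phi> (t+h) t - \<phi> t t))"
    by auto
  ultimately have "((\<lambda>t. R t t) has_real_derivative (2 * (\<phi> (t+h) t - \<phi> t t))) (at t)"
    unfolding has_field_derivative_def by simp
  moreover have "\<phi> (t+h) t - \<phi> t t = integral {t..t+h} (\<lambda>y. f (t+h) y - f t y)"
    unfolding \<phi>_def
    by (rule Henstock_Kurzweil_Integration.integral_diff[symmetric])
       (auto intro!: integrable_continuous_real continuous_intros)
  ultimately show ?thesis by (simp only: R_def \<phi>_def)
qed

text \<open>Differentiation is local: freezing both times below t/2 extends \<open>f\<close>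
  continuously to the whole plane and leaves it unchanged on all squares starting near t.\<close>

lemma square_integral_deriv:
  fixes f :: "real \<Rightarrow> real \<Rightarrow> real"
  assumes c: "continuous_on ({0<..} \<times> {0<..}) (\<lambda>(x, y). f x y)"
    and sym: "\<And>x y. f x y = f y x" and h: "0 < h" and t: "0 < t"
  shows "((\<lambda>t. integral {t..t+h} (\<lambda>x. integral {t..t+h} (f x))) has_real_derivative
      2 * integral {t..t+h} (\<lambda>y. f (t+h) y - f t y)) (at t)"
proof -
  define g where "g x y = f (max (t/2) x) (max (t/2) y)" for x y
  have g_eq: "g x y = f x y" if "t/2 < x" "t/2 < y" for x y
    using that by (simp add: g_def max_def)
  have "continuous_on UNIV (\<lambda>p. (\<lambda>(x, y). f x y) (max (t/2) (fst p), max (t/2) (snd p)))"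
    by (rule continuous_on_compose2[OF c]) (use t in \<open>auto intro!: continuous_intros simp: less_max_iff_disj\<close>)
  then have gc: "continuous_on UNIV (\<lambda>(x, y). g x y)"
    by (simp add: g_def case_prod_beta)
  have d: "((\<lambda>t. integral {t..t+h} (\<lambda>x. integral {t..t+h} (g x))) has_real_derivative
      2 * integral {t..t+h} (\<lambda>y. g (t+h) y - g t y)) (at t)"
    by (rule square_integral_deriv_UNIV[OF gc]) (auto simp: g_def sym h)
  have e: "integral {t..t+h} (\<lambda>y. g (t+h) y - g t y) = integral {t..t+h} (\<lambda>y. f (t+h) y - f t y)"
    by (rule Henstock_Kurzweil_Integration.integral_cong) (use t h in \<open>simp add: g_eq\<close>)
  show ?thesis
    using d unfolding e
  proof (rule has_field_derivative_transform_within_open[where S="{t/2<..}"])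
    fix s assume "s \<in> {t/2<..}"
    then show "integral {s..s+h} (\<lambda>x. integral {s..s+h} (g x)) = integral {s..s+h} (\<lambda>x. integral {s..s+h} (f x))"
      by (intro Henstock_Kurzweil_Integration.integral_cong) (simp add: g_eq)
  qed (use t in auto)
qed

text \<open>In the application \<open>f s x y\<close> is the product of u at times x and y with the
  weight frozen at time s, \<open>g\<close> is its derivative in s, and \<open>B s x y\<close> pairs
  the gradient of u(x) with the gradient of the weighted u(y). Keeping the three times apart is what
  accommodates a solution without time derivative: the weight time is expanded by
  \<open>taylor\<close>, and the solution times matter only at the ends of the averaging interval,
  where \<open>weak\<close> applies. The averaged energy then has derivative minus the double
  integral of \<open>2 * B - g\<close>.\<close>

lemma energy_monotone:
  fixes f g B :: "real \<Rightarrow> real \<Rightarrow> real \<Rightarrow> real" and w N :: "real \<Rightarrow> real"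
  assumes cf: "\<And>s. 0 < s \<Longrightarrow> continuous_on ({0<..} \<times> {0<..}) (\<lambda>(x, y). f s x y)"
    and cg: "\<And>s. 0 < s \<Longrightarrow> continuous_on ({0<..} \<times> {0<..}) (\<lambda>(x, y). g s x y)"
    and sf: "\<And>s x y. f s x y = f s y x" and sg: "\<And>s x y. g s x y = g s y x"
    and cN: "continuous_on {0<..} N"
    and taylor: "\<And>s s' x y. 0 < s \<Longrightarrow> 0 < s' \<Longrightarrow> 0 < x \<Longrightarrow> 0 < y \<Longrightarrow>
      \<bar>f s' x y - f s x y - (s' - s) * g s x y\<bar> \<le> (s' - s)\<^sup>2 * (N x * N y)"
    and weak: "\<And>s a b y. 0 < s \<Longrightarrow> 0 < a \<Longrightarrow> a \<le> b \<Longrightarrow> 0 < y \<Longrightarrow>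
      f s b y - f s a y = - (LBINT x:{a..b}. B s x y)"
    and Bm: "\<And>s. 0 < s \<Longrightarrow> (\<lambda>(x, y). B s x y) \<in> borel_measurable (lborel \<Otimes>\<^sub>M lborel)"
    and Bb: "\<And>s x y. 0 < s \<Longrightarrow> 0 < x \<Longrightarrow> 0 < y \<Longrightarrow> \<bar>B s x y\<bar> \<le> C * (w x * w y)"
    and gb: "\<And>s x y. 0 < s \<Longrightarrow> 0 < x \<Longrightarrow> 0 < y \<Longrightarrow> \<bar>g s x y\<bar> \<le> C * (w x * w y)"
    and C: "0 \<le> C"
    and wm [measurable]: "w \<in> borel_measurable borel" and w0: "\<And>x. 0 \<le> w x"
    and wi: "\<And>a b. 0 < a \<Longrightarrow> set_integrable lborel {a..b} (\<lambda>x. (w x)\<^sup>2)"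
    and psd: "\<And>s n (x :: nat \<Rightarrow> real). 0 < s \<Longrightarrow> (\<And>i. i < n \<Longrightarrow> 0 < x i) \<Longrightarrow>
      0 \<le> (\<Sum>i<n. \<Sum>j<n. 2 * B s (x i) (x j) - g s (x i) (x j))"
    and st: "0 < s" "s \<le> t"
  shows "f t t t \<le> f s s s"
proof -
  define G where "G h t = integral {t..t+h} (\<lambda>x. integral {t..t+h} (f t x))" for h t
  have cont_slice: "continuous_on {a..b} (F x)"
    if "continuous_on ({0<..} \<times> {0<..}) (\<lambda>(x, y). F x y)" "0 < a" "0 < x" for F :: "real \<Rightarrow> real \<Rightarrow> real" and a b x
    using continuous_on_compose2[OF that(1), of "{a..b}" "\<lambda>y. (x, y)"] that(2,3)
    by (fastforce intro!: continuous_intros)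
  have cont_int: "continuous_on {a..b} (\<lambda>x. integral {a..b} (F x))"
    if F: "continuous_on ({0<..} \<times> {0<..}) (\<lambda>(x, y). F x y)" "0 < a" for F :: "real \<Rightarrow> real \<Rightarrow> real" and a b
  proof -
    have "continuous_on {a..b} (\<lambda>x. integral (cbox a b) (F x))"
      by (rule integral_continuous_on_param) (rule continuous_on_subset[OF F(1)], use that in auto)
    then show ?thesis by simp
  qed
  have deriv: "\<exists>D\<le>0. (G h has_real_derivative D) (at t)" if h: "0 < h" and t: "0 < t" for h t
  proof -
    \<comment> \<open>\<open>P\<close> moves the square with the weight frozen at time t,
      \<open>J\<close> is the first-order effect of moving the weight, and the remainder
      \<open>e\<close> will be quadratic in r - t.\<close>
    define P where "P r = integral {r..r+h} (\<lambda>x. integral {r..r+h} (f t x))" for r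
    define J where "J r = integral {r..r+h} (\<lambda>x. integral {r..r+h} (g t x))" for r
    define e where "e r = G h r - P r - (r - t) * J r" for r
    define dP where "dP = 2 * integral {t..t+h} (\<lambda>y. f t (t+h) y - f t t y)"
    have P': "(P has_real_derivative dP) (at t)"
      unfolding P_def dP_def by (rule square_integral_deriv[OF cf sf h t]) (rule t)
    obtain dJ where J': "(J has_real_derivative dJ) (at t)"
      using square_integral_deriv[OF cg sg h t] t unfolding J_def by blast
    \<comment> \<open>This interval contains {r..r+h} for every r between t/2 and 2 * t, the range
      in which the remainder is estimated.\<close>
    obtain Nm where Nm: "\<And>x. x \<in> {t/2..2*t+h} \<Longrightarrow> \<bar>N x\<bar> \<le> Nm"
    proof -
      have "compact (N ` {t/2..2*t+h})"
        by (rule compact_continuous_image) (rule continuous_on_subset[OF cN], use t in auto)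
      then have "bounded (N ` {t/2..2*t+h})" by (rule compact_imp_bounded)
      then obtain c where "\<And>x. x \<in> {t/2..2*t+h} \<Longrightarrow> \<bar>N x\<bar> \<le> c"
        unfolding bounded_iff real_norm_def by blast
      then show thesis by (rule that)
    qed
    have e_bound: "\<bar>e r\<bar> \<le> (r - t)\<^sup>2 * (Nm * h)\<^sup>2" if r: "t/2 < r" "r < 2*t" for r
    proof -
      have r0: "0 < r" using r t by auto
      let ?d = "\<lambda>x y. f r x y - f t x y - (r - t) * g t x y"
      have sl: "f t x integrable_on {r..r+h}" "f r x integrable_on {r..r+h}" "g t x integrable_on {r..r+h}"
        if "x \<in> {r..r+h}" for x
        by (rule integrable_continuous_real cont_slice cf cg t r0 | use that r0 in force)+
      have c1: "continuous_on ({0<..} \<times> {0<..}) (\<lambda>(x, y). ?d x y)"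
        using cf[OF t] cf[OF r0] cg[OF t] unfolding case_prod_beta by (intro continuous_intros)
      have in1: "integral {r..r+h} (?d x) = integral {r..r+h} (f r x) - integral {r..r+h} (f t x) - (r - t) * integral {r..r+h} (g t x)"
        if "x \<in> {r..r+h}" for x
        by (intro integral_unique has_integral_diff has_integral_mult_right integrable_integral sl[OF that])
      have "e r = integral {r..r+h} (\<lambda>x. integral {r..r+h} (?d x))"
      proof -
        have "integral {r..r+h} (\<lambda>x. integral {r..r+h} (?d x)) = 
          integral {r..r+h} (\<lambda>x. integral {r..r+h} (f r x) - integral {r..r+h} (f t x) - (r - t) * integral {r..r+h} (g t x))"
          by (rule Henstock_Kurzweil_Integration.integral_cong) (use in1 in auto)
        also have "\<dots> = e r"
          unfolding e_def G_def P_def J_def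
          by (intro integral_unique has_integral_diff has_integral_mult_right integrable_integral
              integrable_continuous_real cont_int cf cg t r0)
        finally show ?thesis by simp
      qed
      also have "\<bar>\<dots>\<bar> \<le> ((r - t)\<^sup>2 * (Nm * Nm) * h) * h"
      proof -
        have "norm (integral {r..r+h} (\<lambda>x. integral {r..r+h} (?d x))) \<le> ((r - t)\<^sup>2 * (Nm * Nm) * h) * (r + h - r)"
        proof (rule integral_bound)
          fix x assume x: "x \<in> {r..r+h}"
          have "norm (integral {r..r+h} (?d x)) \<le> ((r - t)\<^sup>2 * (Nm * Nm)) * (r + h - r)"
          proof (rule integral_bound)
            show "continuous_on {r..r+h} (?d x)" by (rule cont_slice[OF c1 r0]) (use x r0 in auto)
            fix y assume y: "y \<in> {r..r+h}"
            have "\<bar>?d x y\<bar> \<le> (r - t)\<^sup>2 * (N x * N y)" using taylor[OF t r0] x y r0 by auto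
            also have "N x * N y \<le> \<bar>N x\<bar> * \<bar>N y\<bar>" by (simp flip: abs_mult)
            also have "\<dots> \<le> Nm * Nm" 
              using Nm[of x] Nm[of y] x y r by (intro mult_mono) auto
            finally show "norm (?d x y) \<le> (r - t)\<^sup>2 * (Nm * Nm)" by (simp add: mult_left_mono)
          qed (use h in auto)
          then show "norm (integral {r..r+h} (?d x)) \<le> (r - t)\<^sup>2 * (Nm * Nm) * h" by simp
        qed (use h cont_int[OF c1 r0] in auto)
        then show ?thesis by simp
      qed
      finally show ?thesis by (simp add: power2_eq_square mult_ac)
    qed
    have e': "(e has_real_derivative 0) (at t)"
      unfolding DERIV_def
    proof (rule Lim_null_comparison)
      show "\<forall>\<^sub>F d in at 0. norm ((e (t + d) - e t) / d) \<le> \<bar>d\<bar> * (Nm * h)\<^sup>2"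
        unfolding eventually_at
      proof (intro exI[of _ "t/2"] conjI ballI impI)
        fix d :: real assume d: "d \<noteq> 0 \<and> dist d 0 < t/2"
        have "e t = 0" by (simp add: e_def G_def P_def)
        then have "norm ((e (t + d) - e t) / d) \<le> (d\<^sup>2 * (Nm * h)\<^sup>2) / \<bar>d\<bar>"
          using e_bound[of "t+d"] d by (auto simp: divide_right_mono abs_le_iff dist_real_def)
        also have "\<dots> = \<bar>d\<bar> * (Nm * h)\<^sup>2"
        proof -
          have eq: "d\<^sup>2 = \<bar>d\<bar> * \<bar>d\<bar>" by (simp add: power2_eq_square)
          show ?thesis unfolding eq using d by (simp del: abs_mult_self_eq)
        qed
        finally show "norm ((e (t + d) - e t) / d) \<le> \<bar>d\<bar> * (Nm * h)\<^sup>2" .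
      qed (use t in auto)
      show "((\<lambda>d. \<bar>d\<bar> * (Nm * h)\<^sup>2) \<longlongrightarrow> 0) (at 0)"
        by (auto intro!: tendsto_eq_intros)
    qed
    \<comment> \<open>The derivative of (r - t) * J r at r = t is \<open>J t\<close>; the value
      \<open>dJ\<close> is multiplied by zero there.\<close>
    have "((\<lambda>r. e r + P r + (r - t) * J r) has_real_derivative (dP + J t)) (at t)"
      by (auto intro!: derivative_eq_intros e' P' J')
    then have G': "(G h has_real_derivative (dP + J t)) (at t)"
      by (simp add: e_def)
    define M where "M = restrict_space lborel {t..t+h}"
    have finM: "finite_measure M"
      unfolding M_def by (rule finite_measureI) (simp add: emeasure_restrict_space space_restrict_space h order_less_imp_le)
    have sM: "space M = {t..t+h}" by (simp add: M_def space_restrict_space)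
    have MM: "measure M (space M) > 0"
      using h by (simp add: M_def measure_restrict_space space_restrict_space)
    have idM [measurable]: "(\<lambda>x. x) \<in> measurable M lborel"
      unfolding M_def by (rule measurable_restrict_space1) simp
    have int_M: "(\<integral>x. F x \<partial>M) = integral {t..t+h} F" "integrable M F" if "continuous_on {t..t+h} F" for F :: "real \<Rightarrow> real"
      using set_borel_integral_eq_integral(2)[OF borel_integrable_atLeastAtMost'[OF that]]
        borel_integrable_atLeastAtMost'[OF that]
      unfolding M_def by (simp_all add: integral_restrict_space integrable_restrict_space set_integrable_def set_lebesgue_integral_def)
    have int_M': "(\<integral>x. F x \<partial>M) = (LBINT x:{t..t+h}. F x)" for F :: "real \<Rightarrow> real"
      by (simp add: M_def integral_restrict_space set_lebesgue_integral_def)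
    have Bm' [measurable]: "(\<lambda>(x, y). B t x y) \<in> borel_measurable (M \<Otimes>\<^sub>M M)"
    proof -
      have "(\<lambda>p. (\<lambda>(x, y). B t x y) (fst p, snd p)) \<in> borel_measurable (M \<Otimes>\<^sub>M M)"
        by (rule measurable_compose[OF _ Bm[OF t]]) measurable
      then show ?thesis by (simp add: case_prod_beta)
    qed
    have gm' [measurable]: "(\<lambda>(x, y). g t x y) \<in> borel_measurable (M \<Otimes>\<^sub>M M)"
    proof -
      define q where "q x y = g t (max t x) (max t y)" for x y
      \<comment> \<open>Freezing the times below t gives a function continuous everywhere, hence
        Borel, which agrees with \<open>g t\<close> on the square.\<close>
      have "continuous_on UNIV (\<lambda>p. (\<lambda>(x, y). g t x y) (max t (fst p), max t (snd p)))"
        by (rule continuous_on_compose2[OF cg[OF t]]) (use t in \<open>auto intro!: continuous_intros\<close>)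
      then have "(\<lambda>p. g t (max t (fst p)) (max t (snd p))) \<in> borel_measurable borel"
        by (simp add: borel_measurable_continuous_onI)
      then have [measurable]: "(\<lambda>p. g t (max t (fst p)) (max t (snd p))) \<in> borel_measurable (lborel \<Otimes>\<^sub>M lborel)"
        by (simp add: lborel_prod)
      have "(\<lambda>p. (\<lambda>p. g t (max t (fst p)) (max t (snd p))) (fst p, snd p)) \<in> borel_measurable (M \<Otimes>\<^sub>M M)"
        by measurable
      then show ?thesis
        by (rule measurable_cong[THEN iffD1, rotated]) (auto simp: space_pair_measure sM max_def)
    qed
    have w'm [measurable]: "(\<lambda>x. w x) \<in> borel_measurable M"
      by (rule measurable_compose[OF idM]) simp
    have wM: "integrable M (\<lambda>x. (w x)\<^sup>2)"
      using wi[OF t, of "t+h"] by (simp add: M_def integrable_restrict_space set_integrable_def)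
    interpret finite_measure M by fact
    have wM1: "integrable M w"
    proof (rule Bochner_Integration.integrable_bound)
      show "integrable M (\<lambda>x. 1 + (w x)\<^sup>2)" using wM by auto
      have "\<bar>w x\<bar> \<le> \<bar>1 + (w x)\<^sup>2\<bar>" for x
        using zero_le_power2[of "\<bar>w x\<bar> - 1/2"] by (auto simp: power2_eq_square algebra_simps)
      then show "AE x in M. norm (w x) \<le> norm (1 + (w x)\<^sup>2)" by simp
    qed auto
    have BiM: "integrable M (\<lambda>x. B t x y)" if y: "y \<in> {t..t+h}" for y
    proof (rule Bochner_Integration.integrable_bound)
      show "integrable M (\<lambda>x. C * (w x * w y))" using wM1 by auto
      have [measurable]: "(\<lambda>x. y) \<in> measurable M M" using y by (simp add: sM)
      have "(\<lambda>x. (\<lambda>(x, y). B t x y) (x, y)) \<in> borel_measurable M"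
        by measurable
      then show "(\<lambda>x. B t x y) \<in> borel_measurable M" by simp
      show "AE x in M. norm (B t x y) \<le> norm (C * (w x * w y))"
        using Bb[OF t] t y C w0 by (auto simp: sM)
    qed
    have intB: "(\<integral>x. B t x y \<partial>M) = f t t y - f t (t+h) y" if y: "y \<in> {t..t+h}" for y
      using weak[OF t t, of "t+h" y] y h t by (simp add: int_M')
    have "0 \<le> (\<integral>y. \<integral>x. 2 * B t x y - g t x y \<partial>M \<partial>M)"
    \<comment> \<open>The kernel is used with its arguments exchanged, so that the inner integration
      runs over the first argument of \<open>B\<close>, the one that \<open>weak\<close> evaluates.
      The factor \<open>3 * C\<close> bounds twice \<open>B\<close> plus \<open>g\<close>; its
      square root goes to each variable.\<close>
    proof (rule psd_kernel_double_integral[OF finM MM, where w="\<lambda>x. sqrt (3*C) * w x"])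
      show "(\<lambda>(x, y). 2 * B t y x - g t y x) \<in> borel_measurable (M \<Otimes>\<^sub>M M)" by measurable
      show "integrable M (\<lambda>x. (sqrt (3*C) * w x)\<^sup>2)" using wM by (simp add: power_mult_distrib)
      show "\<bar>2 * B t y x - g t y x\<bar> \<le> sqrt (3*C) * w x * (sqrt (3*C) * w y)" if "x \<in> space M" "y \<in> space M" for x y
      proof -
        have "\<bar>2 * B t y x - g t y x\<bar> \<le> 3 * (C * (w y * w x))"
          using Bb[OF t, of y x] gb[OF t, of y x] that t by (auto simp: sM)
        also have "\<dots> = (sqrt (3*C) * sqrt (3*C)) * (w x * w y)" using C by simp
        finally show ?thesis by (simp only: mult_ac)
      qed
      show "0 \<le> (\<Sum>i<n. \<Sum>j<n. 2 * B t (x j) (x i) - g t (x j) (x i))"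
        if "\<And>i. i < n \<Longrightarrow> x i \<in> space M" for n :: nat and x
      proof -
        have "0 < x i" if "i < n" for i using \<open>\<And>i. i < n \<Longrightarrow> x i \<in> space M\<close>[OF that] t by (simp add: sM)
        from psd[OF t, of n x, OF this] show ?thesis by (subst sum.swap)
      qed
    qed (use w0 C in auto)
    also have "(\<integral>y. \<integral>x. 2 * B t x y - g t x y \<partial>M \<partial>M)
        = (\<integral>y. 2 * (f t t y - f t (t+h) y) - integral {t..t+h} (g t y) \<partial>M)"
    proof (rule Bochner_Integration.integral_cong[OF refl])
      fix y assume y: "y \<in> space M"
      then have y': "y \<in> {t..t+h}" "0 < y" using t by (auto simp: sM)
      have "(\<lambda>x. g t x y) = g t y" using sg by auto
      then show "(\<integral>x. 2 * B t x y - g t x y \<partial>M) = 2 * (f t t y - f t (t+h) y) - integral {t..t+h} (g t y)"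
        using BiM[OF y'(1)] intB[OF y'(1)] int_M[OF cont_slice[OF cg[OF t] t y'(2)]] by simp
    qed
    also have "\<dots> = 2 * integral {t..t+h} (\<lambda>y. f t t y - f t (t+h) y) - J t"
    proof -
      have c: "continuous_on {t..t+h} (\<lambda>y. f t t y - f t (t+h) y)"
        by (intro continuous_intros cont_slice[OF cf[OF t] t]) (use t h in auto)
      show ?thesis
        using int_M[OF c] int_M[OF cont_int[OF cg[OF t] t]]
        by (simp add: J_def del: right_diff_distrib_numeral)
    qed
    also have "\<dots> = - dP - J t"
    proof -
      have "(\<lambda>y. f t t y - f t (t+h) y) = (\<lambda>y. - (f t (t+h) y - f t t y))" by auto
      then show ?thesis by (simp only: Henstock_Kurzweil_Integration.integral_neg dP_def)
    qed
    finally have "dP + J t \<le> 0" by simp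
    with G' show ?thesis by blast
  qed
  have mono: "G h t \<le> G h s" if "0 < h" for h
    by (rule DERIV_nonpos_imp_nonincreasing[OF st(2)]) (meson deriv[OF that] st(1) less_le_trans)
  have near: "\<exists>d>0. \<forall>x\<in>{r..r+d}. \<forall>y\<in>{r..r+d}. \<bar>f r x y - f r r r\<bar> < \<epsilon>" if r: "0 < r" and \<epsilon>: "0 < \<epsilon>" for r \<epsilon>
  proof -
    obtain d where d: "d > 0" "\<And>p. p \<in> {0<..} \<times> {0<..} \<Longrightarrow> dist p (r, r) < d \<Longrightarrow> dist ((\<lambda>(x, y). f r x y) p) (f r r r) < \<epsilon>"
      using cf[OF r] r \<epsilon> unfolding continuous_on_iff by fastforce
    have "\<bar>f r x y - f r r r\<bar> < \<epsilon>" if "x \<in> {r..r+d/4}" "y \<in> {r..r+d/4}" for x y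
    proof -
      have "dist (x, y) (r, r) \<le> dist x r + dist y r"
        unfolding dist_prod_def by (simp add: sqrt_sum_squares_le_sum)
      also have "\<dots> < d" using that d(1) by (auto simp: dist_real_def)
      finally show ?thesis using d(2)[of "(x, y)"] that r by (auto simp: dist_real_def)
    qed
    then show ?thesis using d(1) by (intro exI[of _ "d/4"]) auto
  qed
  show ?thesis
  proof (rule ccontr)
    assume "\<not> ?thesis"
    then have lt: "f s s s < f t t t" by simp
    \<comment> \<open>A third of the supposed gap: the average over a small square differs from the
      diagonal value by at most \<epsilon> at each of the two times, so the gap could not exceed two
      thirds of itself.\<close>
    define \<epsilon> where "\<epsilon> = (f t t t - f s s s) / 3"
    have \<epsilon>: "\<epsilon> > 0" using lt by (simp add: \<epsilon>_def)
    have t: "0 < t" using st by simp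
    obtain d1 where d1: "d1 > 0" "\<forall>x\<in>{s..s+d1}. \<forall>y\<in>{s..s+d1}. \<bar>f s x y - f s s s\<bar> < \<epsilon>"
      using near[OF st(1) \<epsilon>] by blast
    obtain d2 where d2: "d2 > 0" "\<forall>x\<in>{t..t+d2}. \<forall>y\<in>{t..t+d2}. \<bar>f t x y - f t t t\<bar> < \<epsilon>"
      using near[OF t \<epsilon>] by blast
    define h where "h = min d1 d2"
    have h: "h > 0" "h \<le> d1" "h \<le> d2" using d1 d2 by (auto simp: h_def)
    have G_close: "\<bar>G h r - c * h\<^sup>2\<bar> \<le> \<epsilon> * h\<^sup>2"
      if r: "0 < r" and *: "\<And>x y. x \<in> {r..r+h} \<Longrightarrow> y \<in> {r..r+h} \<Longrightarrow> \<bar>f r x y - c\<bar> \<le> \<epsilon>" for r c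
    proof -
      have i1: "(f r x) integrable_on {r..r+h}" if "x \<in> {r..r+h}" for x
        by (rule integrable_continuous_real, rule cont_slice[OF cf[OF r] r]) (use that r in auto)
      have i2: "(\<lambda>x. integral {r..r+h} (f r x)) integrable_on {r..r+h}"
        by (rule integrable_continuous_real, rule cont_int[OF cf[OF r] r])
      have b: "integral {r..r+h} (f r x) \<le> (c + \<epsilon>) * h \<and> (c - \<epsilon>) * h \<le> integral {r..r+h} (f r x)" if x: "x \<in> {r..r+h}" for x
      proof -
        have "integral {r..r+h} (f r x) \<le> integral {r..r+h} (\<lambda>_. c + \<epsilon>)"
          by (rule integral_le[OF i1[OF x]]) (use *[OF x] in \<open>auto simp: abs_le_iff\<close>, smt (verit))
        moreover have "integral {r..r+h} (\<lambda>_. c - \<epsilon>) \<le> integral {r..r+h} (f r x)"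
          by (rule integral_le[OF _ i1[OF x]]) (use *[OF x] in \<open>auto simp: abs_le_iff\<close>, smt (verit))
        ultimately show ?thesis using h by (simp add: mult.commute)
      qed
      have "G h r \<le> integral {r..r+h} (\<lambda>_. (c + \<epsilon>) * h)"
        unfolding G_def by (rule integral_le[OF i2]) (use b in auto)
      moreover have "integral {r..r+h} (\<lambda>_. (c - \<epsilon>) * h) \<le> G h r"
        unfolding G_def by (rule integral_le[OF _ i2]) (use b in auto)
      ultimately show ?thesis using h by (simp add: power2_eq_square abs_le_iff algebra_simps)
    qed
    have 1: "\<bar>G h s - f s s s * h\<^sup>2\<bar> \<le> \<epsilon> * h\<^sup>2"
      by (rule G_close[OF st(1)]) (use d1 h in \<open>force intro: less_imp_le\<close>)
    have 2: "\<bar>G h t - f t t t * h\<^sup>2\<bar> \<le> \<epsilon> * h\<^sup>2"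
      by (rule G_close[OF t]) (use d2 h in \<open>force intro: less_imp_le\<close>)
    have "(f t t t - \<epsilon>) * h\<^sup>2 \<le> (f s s s + \<epsilon>) * h\<^sup>2"
      using 1 2 mono[OF h(1)] by (simp add: algebra_simps)
    then have "f t t t - \<epsilon> \<le> f s s s + \<epsilon>"
      using h(1) by simp
    then show False using \<epsilon> by (simp add: \<epsilon>_def field_simps)
  qed
qed

section \<open>Square integrable functions\<close>

text \<open>Functions are not identified modulo null sets, and integrability is a separate predicate
  because \<open>L2norm\<close> and \<open>L2inner\<close> take the default value 0 of the integral
  when the integrand is not integrable.\<close>

definition square_int :: "'a measure \<Rightarrow> ('a \<Rightarrow> 'b::euclidean_space) \<Rightarrow> bool" where
  "square_int M f \<longleftrightarrow> f \<in> borel_measurable M \<and> integrable M (\<lambda>x. (norm (f x))\<^sup>2)"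

definition L2norm :: "'a measure \<Rightarrow> ('a \<Rightarrow> 'b::euclidean_space) \<Rightarrow> real" where
  "L2norm M f = sqrt (\<integral>x. (norm (f x))\<^sup>2 \<partial>M)"

definition L2inner :: "'a measure \<Rightarrow> ('a \<Rightarrow> 'b::euclidean_space) \<Rightarrow> ('a \<Rightarrow> 'b) \<Rightarrow> real" where
  "L2inner M f g = (\<integral>x. f x \<bullet> g x \<partial>M)"

lemma square_int_measurable [measurable_dest]: "square_int M f \<Longrightarrow> f \<in> borel_measurable M"
  by (simp add: square_int_def)

lemma L2norm_nonneg [simp]: "0 \<le> L2norm M f"
  by (simp add: L2norm_def)

lemma L2norm_square: "(L2norm M f)\<^sup>2 = (\<integral>x. (norm (f x))\<^sup>2 \<partial>M)"
  by (simp add: L2norm_def)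

lemma L2norm_eq_inner: "(L2norm M f)\<^sup>2 = L2inner M f f"
  by (simp add: L2norm_square L2inner_def power2_norm_eq_inner)

lemma square_int_dominated:
  fixes f :: "'a \<Rightarrow> 'b::euclidean_space" and g :: "'a \<Rightarrow> 'c::euclidean_space"
  assumes "square_int M g" "f \<in> borel_measurable M" "\<And>x. norm (f x) \<le> C * norm (g x)"
  shows "square_int M f"
  unfolding square_int_def
proof
  show "integrable M (\<lambda>x. (norm (f x))\<^sup>2)"
  proof (rule Bochner_Integration.integrable_bound)
    show "integrable M (\<lambda>x. C\<^sup>2 * (norm (g x))\<^sup>2)" using assms by (simp add: square_int_def)
    show "(\<lambda>x. (norm (f x))\<^sup>2) \<in> borel_measurable M" using assms by measurable
    show "AE x in M. norm ((norm (f x))\<^sup>2) \<le> norm (C\<^sup>2 * (norm (g x))\<^sup>2)"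
      using assms(3) by (auto simp flip: power_mult_distrib intro!: power_mono)
  qed
qed (use assms in auto)

lemma L2norm_dominated:
  fixes f :: "'a \<Rightarrow> 'b::euclidean_space" and g :: "'a \<Rightarrow> 'c::euclidean_space"
  assumes "square_int M g" "f \<in> borel_measurable M" "\<And>x. norm (f x) \<le> C * norm (g x)" "0 \<le> C"
  shows "L2norm M f \<le> C * L2norm M g"
proof -
  have "(\<integral>x. (norm (f x))\<^sup>2 \<partial>M) \<le> (\<integral>x. C\<^sup>2 * (norm (g x))\<^sup>2 \<partial>M)"
  proof (rule integral_mono)
    show "(norm (f x))\<^sup>2 \<le> C\<^sup>2 * (norm (g x))\<^sup>2" for x
      using assms(3) by (auto simp flip: power_mult_distrib intro!: power_mono)
  qed (use square_int_dominated[OF assms(1-3)] assms(1) in \<open>auto simp: square_int_def\<close>)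
  then have "L2norm M f \<le> sqrt (C\<^sup>2 * (\<integral>x. (norm (g x))\<^sup>2 \<partial>M))"
    unfolding L2norm_def by simp
  then show ?thesis using assms(4) by (simp add: real_sqrt_mult L2norm_def)
qed

lemma square_int_inner:
  assumes "square_int M f" "square_int M g"
  shows "integrable M (\<lambda>x. f x \<bullet> g x)"
proof (rule Bochner_Integration.integrable_bound)
  show "integrable M (\<lambda>x. (norm (f x))\<^sup>2 + (norm (g x))\<^sup>2)"
    using assms by (auto simp: square_int_def)
  show "(\<lambda>x. f x \<bullet> g x) \<in> borel_measurable M" using assms by measurable
  have "\<bar>f x \<bullet> g x\<bar> \<le> (norm (f x))\<^sup>2 + (norm (g x))\<^sup>2" for x
  proof -
    have "\<bar>f x \<bullet> g x\<bar> \<le> norm (f x) * norm (g x)" by (rule Cauchy_Schwarz_ineq2)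
    also have "\<dots> \<le> 2 * norm (f x) * norm (g x)" by (simp add: mult_nonneg_nonneg)
    also have "\<dots> \<le> (norm (f x))\<^sup>2 + (norm (g x))\<^sup>2" by (rule sum_squares_bound)
    finally show ?thesis .
  qed
  then show "AE x in M. norm (f x \<bullet> g x) \<le> norm ((norm (f x))\<^sup>2 + (norm (g x))\<^sup>2)" by simp
qed

lemma square_int_mult_integrable:
  fixes f g :: "'a \<Rightarrow> real"
  assumes "square_int M f" "square_int M g"
  shows "integrable M (\<lambda>x. f x * g x)"
  using square_int_inner[OF assms] by simp

lemma square_int_scale: "square_int M f \<Longrightarrow> square_int M (\<lambda>x. c *\<^sub>R f x)"
  by (rule square_int_dominated[where C="\<bar>c\<bar>"]) (auto dest: square_int_measurable)

lemma square_int_add: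
  assumes "square_int M f" "square_int M g"
  shows "square_int M (\<lambda>x. f x + g x)"
proof -
  have "(norm (f x + g x))\<^sup>2 = (norm (f x))\<^sup>2 + 2 * (f x \<bullet> g x) + (norm (g x))\<^sup>2" for x
    by (simp add: power2_norm_eq_inner inner_add inner_commute algebra_simps)
  then show ?thesis
    using assms square_int_inner[OF assms] by (auto simp: square_int_def)
qed

lemma square_int_diff:
  assumes "square_int M f" "square_int M g"
  shows "square_int M (\<lambda>x. f x - g x)"
  using square_int_add[OF assms(1) square_int_scale[OF assms(2), of "-1"]] by simp

lemma L2inner_commute: "L2inner M f g = L2inner M g f"
  by (simp add: L2inner_def inner_commute)

lemma L2inner_add_left:
  assumes "square_int M f" "square_int M g" "square_int M h"
  shows "L2inner M (\<lambda>x. f x + g x) h = L2inner M f h + L2inner M g h"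
  using assms by (simp add: L2inner_def inner_add_left square_int_inner)

lemma L2inner_diff_left:
  assumes "square_int M f" "square_int M g" "square_int M h"
  shows "L2inner M (\<lambda>x. f x - g x) h = L2inner M f h - L2inner M g h"
  using assms by (simp add: L2inner_def inner_diff_left square_int_inner)

lemma L2inner_add_right:
  assumes "square_int M f" "square_int M g" "square_int M h"
  shows "L2inner M h (\<lambda>x. f x + g x) = L2inner M h f + L2inner M h g"
  using L2inner_add_left[OF assms] by (simp add: L2inner_commute)

lemma L2inner_diff_right:
  assumes "square_int M f" "square_int M g" "square_int M h"
  shows "L2inner M h (\<lambda>x. f x - g x) = L2inner M h f - L2inner M h g"
  using L2inner_diff_left[OF assms] by (simp add: L2inner_commute)

lemma L2inner_scale_left: "L2inner M (\<lambda>x. c *\<^sub>R f x) g = c * L2inner M f g"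
  by (simp add: L2inner_def)

lemma L2inner_sum_sum:
  assumes "\<And>i. i \<in> I \<Longrightarrow> square_int M (f i)" "\<And>j. j \<in> J \<Longrightarrow> square_int M (g j)"
  shows "L2inner M (\<lambda>x. \<Sum>i\<in>I. f i x) (\<lambda>x. \<Sum>j\<in>J. g j x) = (\<Sum>i\<in>I. \<Sum>j\<in>J. L2inner M (f i) (g j))"
proof -
  have "L2inner M (\<lambda>x. \<Sum>i\<in>I. f i x) (\<lambda>x. \<Sum>j\<in>J. g j x) = (\<integral>x. (\<Sum>i\<in>I. \<Sum>j\<in>J. f i x \<bullet> g j x) \<partial>M)"
    unfolding L2inner_def inner_sum_left unfolding inner_sum_right ..
  also have "\<dots> = (\<Sum>i\<in>I. \<integral>x. (\<Sum>j\<in>J. f i x \<bullet> g j x) \<partial>M)"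
    by (intro Bochner_Integration.integral_sum Bochner_Integration.integrable_sum square_int_inner assms)
  also have "\<dots> = (\<Sum>i\<in>I. \<Sum>j\<in>J. L2inner M (f i) (g j))"
    unfolding L2inner_def by (intro sum.cong refl Bochner_Integration.integral_sum square_int_inner assms)
  finally show ?thesis .
qed

lemma L2_Cauchy_Schwarz:
  assumes "square_int M f" "square_int M g"
  shows "\<bar>L2inner M f g\<bar> \<le> L2norm M f * L2norm M g"
proof -
  define a b c where "a = (L2norm M f)\<^sup>2" and "b = L2inner M f g" and "c = (L2norm M g)\<^sup>2"
  have q: "0 \<le> s\<^sup>2 * a + 2 * s * t * b + t\<^sup>2 * c" for s t
  proof -
    have sq: "square_int M (\<lambda>x. s *\<^sub>R f x)" "square_int M (\<lambda>x. t *\<^sub>R g x)"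
      using assms by (auto intro: square_int_scale)
    have "0 \<le> (L2norm M (\<lambda>x. s *\<^sub>R f x + t *\<^sub>R g x))\<^sup>2" by simp
    also have "\<dots> = s\<^sup>2 * a + 2 * s * t * b + t\<^sup>2 * c"
    proof -
      let ?v = "\<lambda>x. s *\<^sub>R f x + t *\<^sub>R g x"
      have v: "L2inner M ?v h = s * L2inner M f h + t * L2inner M g h" if "square_int M h" for h
        using L2inner_add_left[OF sq that] by (simp add: L2inner_scale_left)
      have "L2inner M ?v ?v = s * L2inner M ?v f + t * L2inner M ?v g"
        using v[OF square_int_add[OF sq]] L2inner_commute[of M f ?v] L2inner_commute[of M g ?v] by simp
      then show ?thesis
        using v[OF assms(1)] v[OF assms(2)] L2inner_commute[of M g f]
        unfolding a_def b_def c_def L2norm_eq_inner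
        by (simp add: power2_eq_square algebra_simps)
    qed
    finally show ?thesis .
  qed
  have "b\<^sup>2 \<le> a * c"
  proof (cases "c = 0")
    case True
    have "b = 0"
    proof (rule ccontr)
      assume "b \<noteq> 0"
      \<comment> \<open>With c = 0 the quadratic form is affine in t; this t makes its value
        -1.\<close>
      have "0 \<le> a + 2 * (-(a+1)/(2*b)) * b" using q[of 1 "-(a+1)/(2*b)"] True by simp
      then show False using \<open>b \<noteq> 0\<close> by (simp add: field_simps)
    qed
    then show ?thesis by (simp add: True)
  next
    case False
    then have "c > 0" by (simp add: c_def)
    \<comment> \<open>The minimising ratio t / s = - b / c, scaled by c to avoid the
      division.\<close>
    have "0 \<le> c\<^sup>2 * a + 2 * c * (-b) * b + (-b)\<^sup>2 * c" by (rule q)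
    also have "\<dots> = c * (a * c - b\<^sup>2)" by (simp add: power2_eq_square algebra_simps)
    finally show ?thesis using \<open>c > 0\<close> by (simp add: zero_le_mult_iff)
  qed
  then have "b\<^sup>2 \<le> (L2norm M f * L2norm M g)\<^sup>2" by (simp add: a_def c_def power_mult_distrib)
  then show ?thesis unfolding b_def by (simp add: abs_le_square_iff[symmetric])
qed

lemma L2norm_triangle:
  assumes "square_int M f" "square_int M g"
  shows "L2norm M (\<lambda>x. f x + g x) \<le> L2norm M f + L2norm M g"
proof (rule power2_le_imp_le)
  have "(L2norm M (\<lambda>x. f x + g x))\<^sup>2 = (L2norm M f)\<^sup>2 + 2 * L2inner M f g + (L2norm M g)\<^sup>2"
    unfolding L2norm_eq_inner using assms
    by (simp add: L2inner_add_left L2inner_add_right square_int_add L2inner_commute[of M g f])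
  also have "\<dots> \<le> (L2norm M f)\<^sup>2 + 2 * (L2norm M f * L2norm M g) + (L2norm M g)\<^sup>2"
    using L2_Cauchy_Schwarz[OF assms] by auto
  finally show "(L2norm M (\<lambda>x. f x + g x))\<^sup>2 \<le> (L2norm M f + L2norm M g)\<^sup>2"
    by (simp add: power2_sum)
qed simp

lemma L2norm_triangle_diff:
  assumes "square_int M f" "square_int M g"
  shows "\<bar>L2norm M f - L2norm M g\<bar> \<le> L2norm M (\<lambda>x. f x - g x)"
proof -
  have "L2norm M (\<lambda>x. g x - f x) = L2norm M (\<lambda>x. f x - g x)"
    by (simp add: L2norm_def norm_minus_commute)
  then show ?thesis
    using L2norm_triangle[OF square_int_diff[OF assms] assms(2)]
      L2norm_triangle[OF square_int_diff[OF assms(2,1)] assms(1)] by simp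
qed

lemma L2inner_tendsto:
  assumes f: "eventually (\<lambda>n. square_int M (f n)) F" "square_int M f'" 
    and g: "eventually (\<lambda>n. square_int M (g n)) F" "square_int M g'"
    and lim: "((\<lambda>n. L2norm M (\<lambda>x. f n x - f' x)) \<longlongrightarrow> 0) F" "((\<lambda>n. L2norm M (\<lambda>x. g n x - g' x)) \<longlongrightarrow> 0) F"
  shows "((\<lambda>n. L2inner M (f n) (g n)) \<longlongrightarrow> L2inner M f' g') F"
proof -
  have "((\<lambda>n. L2inner M (f n) (g n) - L2inner M f' g') \<longlongrightarrow> 0) F"
  proof (rule Lim_null_comparison)
    show "\<forall>\<^sub>F n in F. norm (L2inner M (f n) (g n) - L2inner M f' g') \<le>
        L2norm M (\<lambda>x. f n x - f' x) * (L2norm M (\<lambda>x. g n x - g' x) + L2norm M g') + L2norm M f' * L2norm M (\<lambda>x. g n x - g' x)"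
      using f(1) g(1)
    proof eventually_elim
      case (elim n)
      note d = square_int_diff[OF elim(1) f(2)] square_int_diff[OF elim(2) g(2)]
      have "L2inner M (f n) (g n) - L2inner M f' g' = L2inner M (\<lambda>x. f n x - f' x) (g n) + L2inner M f' (\<lambda>x. g n x - g' x)"
        using elim f g by (simp add: L2inner_diff_left L2inner_diff_right)
      also have "\<bar>\<dots>\<bar> \<le> L2norm M (\<lambda>x. f n x - f' x) * L2norm M (g n) + L2norm M f' * L2norm M (\<lambda>x. g n x - g' x)"
        using L2_Cauchy_Schwarz[OF d(1) elim(2)] L2_Cauchy_Schwarz[OF f(2) d(2)] by linarith
      also have "L2norm M (g n) \<le> L2norm M (\<lambda>x. g n x - g' x) + L2norm M g'"
        using L2norm_triangle_diff[OF elim(2) g(2)] by linarith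
      finally show ?case by (simp add: mult_left_mono)
    qed
    have "((\<lambda>n. L2norm M (\<lambda>x. f n x - f' x) * (L2norm M (\<lambda>x. g n x - g' x) + L2norm M g') + L2norm M f' * L2norm M (\<lambda>x. g n x - g' x))
       \<longlongrightarrow> 0 * (0 + L2norm M g') + L2norm M f' * 0) F"
      by (intro tendsto_intros lim)
    then show "((\<lambda>n. L2norm M (\<lambda>x. f n x - f' x) * (L2norm M (\<lambda>x. g n x - g' x) + L2norm M g') + L2norm M f' * L2norm M (\<lambda>x. g n x - g' x))
       \<longlongrightarrow> 0) F" by simp
  qed
  then show ?thesis by (rule LIM_zero_cancel)
qed

lemma square_int_iff_nn_integral:
  assumes "f \<in> borel_measurable M"
  shows "square_int M f \<longleftrightarrow> (\<integral>\<^sup>+x. ennreal ((norm (f x))\<^sup>2) \<partial>M) < \<infinity>"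
  using assms unfolding square_int_def by (simp add: integrable_iff_bounded)

lemma nn_integral_eq_L2norm:
  assumes "square_int M f"
  shows "(\<integral>\<^sup>+x. ennreal ((norm (f x))\<^sup>2) \<partial>M) = ennreal ((L2norm M f)\<^sup>2)"
  using assms by (subst nn_integral_eq_integral) (auto simp: square_int_def L2norm_square)

text \<open>Bridges the extended integrals of the definitions and real norms: integrals tending to 0
  are eventually below 1, so the functions are eventually square integrable and the real norm is not
  a default value.\<close>

lemma L2norm_tendsto_0I:
  assumes "((\<lambda>n. \<integral>\<^sup>+x. ennreal ((norm (f n x))\<^sup>2) \<partial>M) \<longlongrightarrow> 0) F" "\<forall>\<^sub>F n in F. f n \<in> borel_measurable M"
  shows "eventually (\<lambda>n. square_int M (f n)) F" "((\<lambda>n. L2norm M (f n)) \<longlongrightarrow> 0) F"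
proof -
  have "\<forall>\<^sub>F n in F. (\<integral>\<^sup>+x. ennreal ((norm (f n x))\<^sup>2) \<partial>M) < 1"
    using order_tendstoD(2)[OF assms(1), of 1] by simp
  then show ev: "eventually (\<lambda>n. square_int M (f n)) F"
    using assms(2)
    by eventually_elim (simp add: square_int_iff_nn_integral order.strict_trans[OF _ ennreal_one_less_top])
  have "((\<lambda>n. ennreal ((L2norm M (f n))\<^sup>2)) \<longlongrightarrow> ennreal 0) F"
    using assms(1) by (subst tendsto_cong[OF eventually_mono[OF ev]]) (auto simp: nn_integral_eq_L2norm[symmetric])
  then have "((\<lambda>n. (L2norm M (f n))\<^sup>2) \<longlongrightarrow> 0) F"
    by (rule tendsto_ennrealD) auto
  then have "((\<lambda>n. sqrt ((L2norm M (f n))\<^sup>2)) \<longlongrightarrow> sqrt 0) F"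
    by (rule tendsto_real_sqrt)
  then show "((\<lambda>n. L2norm M (f n)) \<longlongrightarrow> 0) F" by simp
qed

section \<open>Test functions and the weighted form\<close>

lemma integrable_compact_support:
  fixes f :: "'a::euclidean_space \<Rightarrow> 'b::euclidean_space"
  assumes "compact S" "continuous_on S f" "\<And>x. x \<notin> S \<Longrightarrow> f x = 0"
  shows "integrable lborel f"
proof -
  have "integrable lborel (\<lambda>x. indicator S x *\<^sub>R f x)"
    by (rule borel_integrable_compact[OF assms(1,2)])
  also have "(\<lambda>x. indicator S x *\<^sub>R f x) = f"
    using assms(3) by (auto simp: fun_eq_iff indicator_def)
  finally show ?thesis .
qed

lemma has_derivative_zero_nhd:
  assumes "open S" "x \<in> S" "\<And>y. y \<in> S \<Longrightarrow> f y = 0"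
  shows "(f has_derivative (\<lambda>h. 0)) (at x)"
  by (rule has_derivative_transform_within_open[OF has_derivative_const[of 0] assms(1,2)])
     (use assms(3) in simp)

lemma test_pair_continuous:
  assumes "test_pair \<Omega> \<phi> G"
  shows "continuous_on A \<phi>" "continuous_on A G"
proof -
  have "isCont \<phi> x" for x
    using assms unfolding test_pair_def by (blast intro: has_derivative_continuous)
  then show "continuous_on A \<phi>" by (simp add: continuous_at_imp_continuous_on)
  show "continuous_on A G"
    using assms continuous_on_subset[of UNIV G A] unfolding test_pair_def by simp
qed

text \<open>Off the closed support \<phi> vanishes on a neighbourhood, so uniqueness of the
  derivative forces the gradient to vanish as well.\<close>

lemma test_pair_zero:
  assumes "test_pair \<Omega> \<phi> G" "x \<notin> closure {x. \<phi> x \<noteq> 0}"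
  shows "\<phi> x = 0" "G x = 0"
proof -
  let ?S = "closure {x. \<phi> x \<noteq> 0}"
  have 0: "\<phi> y = 0" if "y \<in> - ?S" for y
    using that closure_subset[of "{x. \<phi> x \<noteq> 0}"] by auto
  from 0[of x] assms(2) show "\<phi> x = 0" by blast
  have "(\<phi> has_derivative (\<lambda>h. 0)) (at x)"
    by (rule has_derivative_zero_nhd[where S="- ?S"]) (use assms(2) 0 in \<open>blast+\<close>)
  moreover have "(\<phi> has_derivative (\<lambda>h. G x \<bullet> h)) (at x)"
    using assms(1) unfolding test_pair_def by blast
  ultimately have "(\<lambda>h. G x \<bullet> h) = (\<lambda>h. 0)" by (rule has_derivative_unique[symmetric])
  then have "G x \<bullet> G x = 0" by meson
  then show "G x = 0" by simp
qed

lemma test_pair_integrable: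
  fixes f :: "real \<times> real \<Rightarrow> 'b::euclidean_space"
  assumes "test_pair \<Omega> \<phi> G" "continuous_on (closure {x. \<phi> x \<noteq> 0}) f" "\<And>x. \<phi> x = 0 \<Longrightarrow> G x = 0 \<Longrightarrow> f x = 0"
  shows "integrable lborel f"
  using assms(2)
proof (rule integrable_compact_support[rotated])
  show "compact (closure {x. \<phi> x \<noteq> 0})" using assms(1) by (simp add: test_pair_def)
qed (use assms(3) test_pair_zero[OF assms(1)] in blast)

lemma test_pair_square_int:
  assumes "test_pair \<Omega> \<phi> G"
  shows "square_int lborel \<phi>" "square_int lborel G"
proof -
  have "\<phi> \<in> borel_measurable borel" "G \<in> borel_measurable borel"
    using test_pair_continuous[OF assms] by (auto intro: borel_measurable_continuous_onI)
  moreover have "integrable lborel (\<lambda>x. (norm (\<phi> x))\<^sup>2)" "integrable lborel (\<lambda>x. (norm (G x))\<^sup>2)"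
    by (rule test_pair_integrable[OF assms]; auto intro!: continuous_intros test_pair_continuous[OF assms])+
  ultimately show "square_int lborel \<phi>" "square_int lborel G"
    by (simp_all add: square_int_def)
qed

lemma compact_closure_subset: "compact K \<Longrightarrow> closure A \<subseteq> K \<Longrightarrow> compact (closure A)"
  using compact_Int_closed[of K "closure A"] by (simp add: inf.absorb2)

lemma closure_support_Un:
  fixes f g h :: "'a::topological_space \<Rightarrow> real"
  assumes "\<And>x. h x \<noteq> 0 \<Longrightarrow> f x \<noteq> 0 \<or> g x \<noteq> 0"
  shows "closure {x. h x \<noteq> 0} \<subseteq> closure {x. f x \<noteq> 0} \<union> closure {x. g x \<noteq> 0}"
  by (subst closure_Un[symmetric]) (rule closure_mono, use assms in auto)

lemma test_pair_add:
  assumes "test_pair \<Omega> \<phi> G" "test_pair \<Omega> \<psi> H"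
  shows "test_pair \<Omega> (\<lambda>x. \<phi> x + \<psi> x) (\<lambda>x. G x + H x)"
proof -
  have s: "closure {x. \<phi> x + \<psi> x \<noteq> 0} \<subseteq> closure {x. \<phi> x \<noteq> 0} \<union> closure {x. \<psi> x \<noteq> 0}"
    by (rule closure_support_Un) auto
  then have "compact (closure {x. \<phi> x + \<psi> x \<noteq> 0})"
    by (rule compact_closure_subset[rotated]) (use assms in \<open>auto simp: test_pair_def\<close>)
  then show ?thesis
    using assms s unfolding test_pair_def
    by (auto intro!: continuous_intros derivative_eq_intros simp: inner_add_left)
qed

lemma test_pair_mult:
  assumes "test_pair \<Omega> \<phi> G"
    and m: "\<And>x. (m has_derivative (\<lambda>h. dm x \<bullet> h)) (at x)" "continuous_on UNIV dm"
  shows "test_pair \<Omega> (\<lambda>x. m x * \<phi> x) (\<lambda>x. m x *\<^sub>R G x + \<phi> x *\<^sub>R dm x)"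
proof -
  have s: "closure {x. m x * \<phi> x \<noteq> 0} \<subseteq> closure {x. \<phi> x \<noteq> 0}"
    by (rule closure_mono) auto
  then have "compact (closure {x. m x * \<phi> x \<noteq> 0})"
    by (rule compact_closure_subset[rotated]) (use assms in \<open>auto simp: test_pair_def\<close>)
  moreover have "continuous_on UNIV m"
    using m(1) by (auto intro!: has_derivative_continuous continuous_at_imp_continuous_on)
  ultimately show ?thesis
    using assms s test_pair_continuous[OF assms(1)] unfolding test_pair_def
    by (auto intro!: continuous_intros derivative_eq_intros simp: inner_add_left)
qed

section \<open>Integration by parts and completion of the square for test functions\<close>

lemma integral_deriv_compact_support_eq_0:
  fixes g g' :: "real \<Rightarrow> real"
  assumes "\<And>x. (g has_real_derivative g' x) (at x)" "bounded {x. g x \<noteq> 0}"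
  shows "(\<integral>x. g' x \<partial>lborel) = 0"
\<comment> \<open>A derivative that is not integrable has integral 0 by the default value. Thus the
  one-dimensional slices in the plane can be treated without checking their integrability one by
  one.\<close>
proof (cases "integrable lborel g'")
  case True
  obtain b where b: "\<And>x. g x \<noteq> 0 \<Longrightarrow> \<bar>x\<bar> \<le> b" "b \<ge> 0"
  proof -
    obtain c where "\<And>x. x \<in> {x. g x \<noteq> 0} \<Longrightarrow> \<bar>x\<bar> \<le> c"
      using assms(2) unfolding bounded_iff real_norm_def by blast
    then show thesis using that[of "max c 0"] by fastforce
  qed
  have "(g' has_integral (g (b+1) - g (-b-1))) {-b-1..b+1}"
    by (rule fundamental_theorem_of_calculus)
       (use b assms(1) in \<open>auto simp: has_real_derivative_iff_has_vector_derivative[symmetric] intro: has_field_derivative_at_within\<close>)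
  moreover have "g (b+1) = 0" "g (-b-1) = 0" using b(1)[of "b+1"] b(1)[of "-b-1"] b(2) by auto
  ultimately have "(g' has_integral 0) {-b-1..b+1}" by simp
  then have "(g' has_integral 0) UNIV"
  proof (rule has_integral_on_superset)
    fix x assume x: "x \<notin> {-b-1..b+1}"
    have "(g has_real_derivative 0) (at x)"
    proof (rule has_field_derivative_transform_within_open[OF DERIV_const[of 0]])
      show "open (- {-b-1..b+1})" by auto
      fix y assume "y \<in> - {-b-1..b+1}"
      then have "b < \<bar>y\<bar>" using b(2) by auto
      then show "0 = g y" using b(1)[of y] by fastforce
    qed (use x in auto)
    then show "g' x = 0" using assms(1) DERIV_unique by blast
  qed auto
  then show ?thesis using has_integral_integral_lborel[OF True] has_integral_unique by blast
qed (rule not_integrable_integral_eq)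

lemma integral_partial_derivs_eq_0:
  fixes g :: "real \<times> real \<Rightarrow> real" and D :: "real \<times> real \<Rightarrow> real \<times> real"
  assumes d: "\<And>x. (g has_derivative (\<lambda>h. D x \<bullet> h)) (at x)" and D: "integrable lborel D"
    and b: "bounded {x. g x \<noteq> 0}"
  shows "(\<integral>x. fst (D x) \<partial>lborel) = 0" "(\<integral>x. snd (D x) \<partial>lborel) = 0"
proof -
  have i: "integrable (lborel \<Otimes>\<^sub>M lborel) (\<lambda>x. fst (D x))" "integrable (lborel \<Otimes>\<^sub>M lborel) (\<lambda>x. snd (D x))"
    using D by (simp_all add: lborel_prod)
  have 1: "(\<integral>x. fst (D (x, y)) \<partial>lborel) = 0" for y
  proof (rule integral_deriv_compact_support_eq_0)
    show "((\<lambda>x. g (x, y)) has_real_derivative fst (D (x, y))) (at x)" for x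
      unfolding has_field_derivative_def
      by (rule has_derivative_eq_rhs[OF has_derivative_compose[OF _ d, of "\<lambda>x. (x, y)"]])
         (auto intro!: derivative_eq_intros simp: inner_prod_def)
    show "bounded {x. g (x, y) \<noteq> 0}"
      by (rule bounded_subset[OF bounded_fst[OF b]]) force
  qed
  have 2: "(\<integral>y. snd (D (x, y)) \<partial>lborel) = 0" for x
  proof (rule integral_deriv_compact_support_eq_0)
    show "((\<lambda>y. g (x, y)) has_real_derivative snd (D (x, y))) (at y)" for y
      unfolding has_field_derivative_def
      by (rule has_derivative_eq_rhs[OF has_derivative_compose[OF _ d, of "\<lambda>y. (x, y)"]])
         (auto intro!: derivative_eq_intros simp: inner_prod_def)
    show "bounded {y. g (x, y) \<noteq> 0}"
      by (rule bounded_subset[OF bounded_snd[OF b]]) force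
  qed
  have "(\<integral>x. fst (D x) \<partial>lborel) = (\<integral>x. (\<lambda>(x, y). fst (D (x, y))) x \<partial>(lborel \<Otimes>\<^sub>M lborel))"
    by (simp add: lborel_prod case_prod_beta)
  also have "\<dots> = (\<integral>y. \<integral>x. fst (D (x, y)) \<partial>lborel \<partial>lborel)"
    by (rule lborel_pair.integral_snd[symmetric]) (use i in \<open>simp add: case_prod_unfold\<close>)
  finally show "(\<integral>x. fst (D x) \<partial>lborel) = 0" by (simp add: 1)
  have "(\<integral>x. snd (D x) \<partial>lborel) = (\<integral>x. (\<lambda>(x, y). snd (D (x, y))) x \<partial>(lborel \<Otimes>\<^sub>M lborel))"
    by (simp add: lborel_prod case_prod_beta)
  also have "\<dots> = (\<integral>x. \<integral>y. snd (D (x, y)) \<partial>lborel \<partial>lborel)"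
    by (rule lborel_pair.integral_fst[symmetric]) (use i in \<open>simp add: case_prod_unfold\<close>)
  finally show "(\<integral>x. snd (D x) \<partial>lborel) = 0" by (simp add: 2)
qed

text \<open>\<open>I\<close> is the divergence of \<phi> squared times the field (\<open>YX\<close>,
  \<open>YY\<close>). The field is controlled only inside \<Omega> and may blow up at its boundary;
  since the support of \<phi> is a compact subset of \<Omega>, the product is differentiable on the
  whole plane with value 0 off the support.\<close>

lemma test_pair_divergence:
  fixes YX YY :: "real \<times> real \<Rightarrow> real" and AX AY :: "real \<times> real \<Rightarrow> real \<times> real"
  assumes tp: "test_pair \<Omega> \<phi> G"
    and YX: "\<And>x. x \<in> \<Omega> \<Longrightarrow> (YX has_derivative (\<lambda>h. AX x \<bullet> h)) (at x)"
    and YY: "\<And>x. x \<in> \<Omega> \<Longrightarrow> (YY has_derivative (\<lambda>h. AY x \<bullet> h)) (at x)"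
    and A: "continuous_on \<Omega> AX" "continuous_on \<Omega> AY"
  defines "I \<equiv> \<lambda>x. 2 * \<phi> x * (G x \<bullet> (YX x, YY x)) + (\<phi> x)\<^sup>2 * (fst (AX x) + snd (AY x))"
  shows "integrable lborel I" "(\<integral>x. I x \<partial>lborel) = 0"
proof -
  let ?S = "closure {x. \<phi> x \<noteq> 0}"
  define D where "D Y A x = (2 * \<phi> x * Y x) *\<^sub>R G x + (\<phi> x)\<^sup>2 *\<^sub>R A x" for Y and A :: "real \<times> real \<Rightarrow> real \<times> real" and x
  have S: "compact ?S" "?S \<subseteq> \<Omega>" "\<And>x. (\<phi> has_derivative (\<lambda>h. G x \<bullet> h)) (at x)" using tp by (auto simp: test_pair_def)
  have deriv: "((\<lambda>x. (\<phi> x)\<^sup>2 * Y x) has_derivative (\<lambda>h. D Y A x \<bullet> h)) (at x)"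
    if "\<And>x. x \<in> \<Omega> \<Longrightarrow> (Y has_derivative (\<lambda>h. A x \<bullet> h)) (at x)" for Y A x
  proof (cases "x \<in> ?S")
    case True
    then have "x \<in> \<Omega>" using S by auto
    have "((\<lambda>x. (\<phi> x)\<^sup>2 * Y x) has_derivative (\<lambda>h. (\<phi> x)\<^sup>2 * (A x \<bullet> h) + (of_nat 2 * (G x \<bullet> h) * (\<phi> x) ^ (2 - 1)) * Y x)) (at x)"
      by (rule has_derivative_mult[OF has_derivative_power[OF S(3)] that[OF \<open>x \<in> \<Omega>\<close>]])
    then show ?thesis
      by (rule has_derivative_eq_rhs) (simp add: D_def inner_add_left fun_eq_iff)
  next
    case False
    have "((\<lambda>x. (\<phi> x)\<^sup>2 * Y x) has_derivative (\<lambda>h. 0)) (at x)"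
    proof (rule has_derivative_zero_nhd[where S="- ?S"])
      show "(\<phi> y)\<^sup>2 * Y y = 0" if "y \<in> - ?S" for y
        using test_pair_zero(1)[OF tp, of y] that by simp
    qed (use False in \<open>auto simp: open_Compl\<close>)
    then show ?thesis using test_pair_zero[OF tp False] by (simp add: D_def)
  qed
  have int: "integrable lborel (D Y A)"
    if "\<And>x. x \<in> \<Omega> \<Longrightarrow> (Y has_derivative (\<lambda>h. A x \<bullet> h)) (at x)" "continuous_on \<Omega> A" for Y A
  proof (rule test_pair_integrable[OF tp])
    have "continuous_on \<Omega> Y"
      by (intro continuous_at_imp_continuous_on ballI has_derivative_continuous[OF that(1)])
    then have "continuous_on ?S Y" "continuous_on ?S A"
      using that(2) by (auto intro: continuous_on_subset[OF _ S(2)])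
    then show "continuous_on ?S (D Y A)"
      unfolding D_def by (intro continuous_intros test_pair_continuous[OF tp])
  qed (auto simp: D_def)
  have bdd: "bounded {x. (\<phi> x)\<^sup>2 * Y x \<noteq> 0}" for Y
    by (rule bounded_subset[OF compact_imp_bounded[OF S(1)]]) (use closure_subset[of "{x. \<phi> x \<noteq> 0}"] in auto)
  have I: "I = (\<lambda>x. fst (D YX AX x) + snd (D YY AY x))"
    by (auto simp: I_def D_def fun_eq_iff inner_prod_def algebra_simps)
  have 1: "(\<integral>x. fst (D YX AX x) \<partial>lborel) = 0"
    by (rule integral_partial_derivs_eq_0(1)[where g="\<lambda>x. (\<phi> x)\<^sup>2 * YX x"])
       (rule deriv[OF YX] int[OF YX A(1)] bdd | assumption)+
  have 2: "(\<integral>x. snd (D YY AY x) \<partial>lborel) = 0"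
    by (rule integral_partial_derivs_eq_0(2)[where g="\<lambda>x. (\<phi> x)\<^sup>2 * YY x"])
       (rule deriv[OF YY] int[OF YY A(2)] bdd | assumption)+
  have i: "integrable lborel (\<lambda>x. fst (D YX AX x))" "integrable lborel (\<lambda>x. snd (D YY AY x))"
    using int[OF YX A(1)] int[OF YY A(2)] by auto
  show "integrable lborel I" unfolding I using i by auto
  show "(\<integral>x. I x \<partial>lborel) = 0" unfolding I using i by (simp add: 1 2)
qed

text \<open>Adding the divergence of \<phi> squared times \<open>Y\<close>, which integrates to 0,
  does not change the integral. The choice \<open>Y = 2 m F - dm\<close> cancels the cross term with
  \<open>dm\<close> and replaces it by the one needed for the square of \<open>G + \<phi> F\<close>;
  what remains is \<phi> squared times the difference of the two sides of
  \<open>div\<close>.\<close>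

lemma test_pair_weighted_form_nonneg:
  fixes Y F dm :: "real \<times> real \<Rightarrow> real \<times> real"
  assumes tp: "test_pair \<Omega> \<phi> G"
    and YX: "\<And>x. x \<in> \<Omega> \<Longrightarrow> ((\<lambda>x. fst (Y x)) has_derivative (\<lambda>h. AX x \<bullet> h)) (at x)"
    and YY: "\<And>x. x \<in> \<Omega> \<Longrightarrow> ((\<lambda>x. snd (Y x)) has_derivative (\<lambda>h. AY x \<bullet> h)) (at x)"
    and A: "continuous_on \<Omega> AX" "continuous_on \<Omega> AY"
    and Y: "\<And>x. x \<in> \<Omega> \<Longrightarrow> Y x = (2 * m x) *\<^sub>R F x - dm x"
    and div: "\<And>x. x \<in> \<Omega> \<Longrightarrow> fst (AX x) + snd (AY x) \<ge> 2 * m x * (norm (F x))\<^sup>2 + mt x"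
    and m: "\<And>x. 0 \<le> m x" "continuous_on UNIV m" "continuous_on UNIV dm" "continuous_on UNIV mt"
  shows "0 \<le> (\<integral>x. 2 * (G x \<bullet> (m x *\<^sub>R G x + \<phi> x *\<^sub>R dm x)) - mt x * (\<phi> x)\<^sup>2 \<partial>lborel)"
proof -
  define I where "I x = 2 * \<phi> x * (G x \<bullet> (fst (Y x), snd (Y x))) + (\<phi> x)\<^sup>2 * (fst (AX x) + snd (AY x))" for x
  let ?L = "\<lambda>x. 2 * (G x \<bullet> (m x *\<^sub>R G x + \<phi> x *\<^sub>R dm x)) - mt x * (\<phi> x)\<^sup>2"
  have I: "integrable lborel I" "(\<integral>x. I x \<partial>lborel) = 0"
    unfolding I_def by (rule test_pair_divergence[OF tp YX YY A]; assumption)+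
  have L: "integrable lborel ?L"
    by (rule test_pair_integrable[OF tp])
       (auto intro!: continuous_intros test_pair_continuous[OF tp] continuous_on_subset[OF m(2)]
         continuous_on_subset[OF m(3)] continuous_on_subset[OF m(4)])
  have "0 \<le> ?L x + I x" for x
  proof (cases "x \<in> closure {x. \<phi> x \<noteq> 0}")
    case True
    then have x: "x \<in> \<Omega>" using tp by (auto simp: test_pair_def)
    have "?L x + I x = 2 * m x * (norm (G x + \<phi> x *\<^sub>R F x))\<^sup>2
        + (\<phi> x)\<^sup>2 * (fst (AX x) + snd (AY x) - 2 * m x * (norm (F x))\<^sup>2 - mt x)"
      unfolding I_def prod.collapse Y[OF x] power2_norm_eq_inner
      by (simp add: inner_add_left inner_add_right inner_diff_right inner_commute power2_eq_square algebra_simps)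
    also have "\<dots> \<ge> 0" using div[OF x] m(1)[of x] by simp
    finally show ?thesis .
  next
    case False
    then show ?thesis using test_pair_zero[OF tp False] by (simp add: I_def)
  qed
  then have "0 \<le> (\<integral>x. ?L x + I x \<partial>lborel)" by simp
  then show ?thesis using L I by simp
qed

section \<open>The angle function of the curved wedge\<close>

text \<open>The polar angle with values in (0, 2 * pi) on the plane slit along the nonnegative
  half-axis: the quotient is the cotangent of half the angle. Unlike a formula with arctan (y / x),
  it is one smooth expression on the whole slit plane, as a wedge with opening up to 2 * pi
  requires.\<close>

definition slit_angle :: "real \<times> real \<Rightarrow> real" where
  "slit_angle z = pi - 2 * arctan (snd z / (norm z - fst z))"

lemma slit_angle_polar:
  assumes "0 < r" "0 < t" "t < 2 * pi"
  shows "norm (r * cos t, r * sin t) = r" "r * cos t < r" "slit_angle (r * cos t, r * sin t) = t"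
proof -
  have "(r * cos t)\<^sup>2 + (r * sin t)\<^sup>2 = r\<^sup>2 * ((cos t)\<^sup>2 + (sin t)\<^sup>2)"
    by (simp only: power_mult_distrib distrib_left)
  then show n: "norm (r * cos t, r * sin t) = r"
    using assms(1) by (simp add: norm_Pair)
  have s: "sin (t/2) > 0" by (rule sin_gt_zero) (use assms in auto)
  have c: "cos t = 1 - 2 * (sin (t/2))\<^sup>2" using cos_double_sin[of "t/2"] by simp
  have si: "sin t = 2 * sin (t/2) * cos (t/2)" using sin_double[of "t/2"] by simp
  show "r * cos t < r" using s assms(1) by (simp add: c)
  have "(r * sin t) / (r - r * cos t) = cos (t/2) / sin (t/2)"
    using s assms(1) by (simp add: c si power2_eq_square field_simps)
  also have "\<dots> = tan (pi/2 - t/2)" by (simp add: tan_def cos_diff sin_diff)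
  finally have "arctan ((r * sin t) / (r - r * cos t)) = pi/2 - t/2"
    using assms by (simp add: arctan_tan)
  then show "slit_angle (r * cos t, r * sin t) = t" by (simp add: slit_angle_def n)
qed

lemma has_derivative_slit_angle:
  assumes "fst z < norm z"
  shows "(slit_angle has_derivative (\<lambda>h. (fst z * snd h - snd z * fst h) / (norm z)\<^sup>2)) (at z)"
proof -
  define n where "n = norm z"
  have z: "z \<noteq> 0" using assms by auto
  then have n: "n > 0" by (simp add: n_def)
  have nn: "n\<^sup>2 = (fst z)\<^sup>2 + (snd z)\<^sup>2" by (simp add: n_def norm_prod_def)
  have d: "n - fst z > 0" using assms by (simp add: n_def)
  have dn: "(norm has_derivative (\<lambda>h. (fst z * fst h + snd z * snd h) / n)) (at z)"
    by (rule has_derivative_eq_rhs[OF has_derivative_norm[OF z]])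
       (simp add: fun_eq_iff sgn_div_norm inner_prod_def n_def divide_inverse algebra_simps)
  note [derivative_intros] = dn[unfolded n_def]
  \<comment> \<open>Both sides equal the inverse square of the sine of the half angle.\<close>
  have e: "1 + (snd z / (n - fst z))\<^sup>2 = 2 * n / (n - fst z)"
  proof -
    have "1 + (snd z / (n - fst z))\<^sup>2 = ((n - fst z)\<^sup>2 + (snd z)\<^sup>2) / (n - fst z)\<^sup>2"
      using d by (simp add: power_divide add_divide_distrib)
    also have "(n - fst z)\<^sup>2 + (snd z)\<^sup>2 = 2 * n * (n - fst z)"
      using nn by (simp add: power2_eq_square algebra_simps)
    finally show ?thesis using d by (simp add: power2_eq_square)
  qed
  define q' where "q' h = (snd h * (n - fst z) - snd z * ((fst z * fst h + snd z * snd h) / n - fst h)) / ((n - fst z) * (n - fst z))" for h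
  have dq: "((\<lambda>z. snd z / (norm z - fst z)) has_derivative q') (at z)"
    unfolding q'_def n_def
    by (rule has_derivative_divide'[where f=snd and g="\<lambda>z. norm z - fst z"]) 
       (use d in \<open>auto intro!: derivative_eq_intros has_derivative_snd[OF has_derivative_ident] has_derivative_fst[OF has_derivative_ident] simp: n_def\<close>)
  have "((\<lambda>z. pi - 2 * arctan (snd z / (norm z - fst z))) has_derivative
      (\<lambda>h. - (2 * (q' h * inverse (1 + (snd z / (n - fst z))\<^sup>2))))) (at z)"
  proof -
    have a: "(arctan has_derivative (*) (inverse (1 + (snd z / (n - fst z))\<^sup>2))) (at (snd z / (norm z - fst z)))"
      using DERIV_arctan[of "snd z / (norm z - fst z)"] by (simp add: has_field_derivative_def n_def)
    have b: "((\<lambda>z. arctan (snd z / (norm z - fst z))) has_derivative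
       (\<lambda>h. inverse (1 + (snd z / (n - fst z))\<^sup>2) * q' h)) (at z)"
      by (rule has_derivative_compose[OF dq a])
    show ?thesis
      by (rule has_derivative_eq_rhs[OF has_derivative_diff[OF has_derivative_const has_derivative_mult_right[OF b]]])
         (simp add: fun_eq_iff mult_ac)
  qed
  then have "(slit_angle has_derivative (\<lambda>h. - (2 * (q' h * inverse (1 + (snd z / (n - fst z))\<^sup>2))))) (at z)"
    by (simp add: slit_angle_def[abs_def])
  moreover have "- (2 * (q' h * inverse (1 + (snd z / (n - fst z))\<^sup>2))) = (fst z * snd h - snd z * fst h) / (norm z)\<^sup>2" for h
  proof -
    have "- (2 * (q' h * inverse (1 + (snd z / (n - fst z))\<^sup>2))) = - ((n - fst z) / n * q' h)"
      unfolding e using d n by (simp add: field_simps)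
    also have "\<dots> = - ((snd h * (n - fst z) * n - snd z * (fst z * fst h + snd z * snd h - fst h * n)) / (n * n * (n - fst z)))"
      using d n unfolding q'_def by (simp add: divide_simps)
    also have "snd h * (n - fst z) * n - snd z * (fst z * fst h + snd z * snd h - fst h * n)
       = - ((fst z * snd h - snd z * fst h) * (n - fst z))"
    proof -
      have *: "n * n = fst z * fst z + snd z * snd z" using nn by (simp add: power2_eq_square)
      have "snd h * (n - fst z) * n - snd z * (fst z * fst h + snd z * snd h - fst h * n)
        = snd h * (n * n) - snd h * fst z * n - snd z * (fst z * fst h + snd z * snd h - fst h * n)"
        by (simp add: algebra_simps)
      also have "\<dots> = - ((fst z * snd h - snd z * fst h) * (n - fst z))"
        unfolding * by (simp add: algebra_simps)
      finally show ?thesis .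
    qed
    also have "- (- ((fst z * snd h - snd z * fst h) * (n - fst z)) / (n * n * (n - fst z))) = (fst z * snd h - snd z * fst h) / (norm z)\<^sup>2"
      using d n by (simp add: n_def[symmetric] power2_eq_square)
    finally show ?thesis .
  qed
  ultimately show ?thesis by simp
qed

text \<open>The point is rotated back by \<theta> of its distance to the origin, which straightens
  the wedge; the slit angle then recovers the parameter \<phi> of
  \<open>curved_wedge\<close>.\<close>

definition wedge_angle :: "(real \<Rightarrow> real) \<Rightarrow> real \<times> real \<Rightarrow> real" where
  "wedge_angle \<theta> x = slit_angle
     (fst x * cos (\<theta> (norm x)) + snd x * sin (\<theta> (norm x)), snd x * cos (\<theta> (norm x)) - fst x * sin (\<theta> (norm x)))"

text \<open>The first summand is the gradient of the ordinary angle, tangent to circles; the second,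
  caused by the twist, is radial.\<close>

definition wedge_angle_grad :: "(real \<Rightarrow> real) \<Rightarrow> real \<times> real \<Rightarrow> real \<times> real" where
  "wedge_angle_grad \<theta>' x = (1 / (norm x)\<^sup>2) *\<^sub>R (- snd x, fst x) - (\<theta>' (norm x) / norm x) *\<^sub>R x"

text \<open>As a is at most 1, the parameter \<phi> stays below 2 * pi and the rotated point misses
  the slit. The last conclusion expresses this in the form required for differentiating
  \<open>slit_angle\<close>.\<close>

lemma curved_wedge_angle:
  assumes "a \<le> 1" "x \<in> curved_wedge \<theta> a"
  shows "0 < norm x" "0 < wedge_angle \<theta> x" "wedge_angle \<theta> x < 2 * pi * a"
    "fst x * cos (\<theta> (norm x)) + snd x * sin (\<theta> (norm x)) < norm x"
proof -
  obtain r \<phi> where x: "x = (r * cos (\<phi> + \<theta> r), r * sin (\<phi> + \<theta> r))" and r: "0 < r" "0 < \<phi>" "\<phi> < 2 * pi * a"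
    using assms(2) unfolding curved_wedge_def by blast
  have "2 * pi * a \<le> 2 * pi * 1" using assms(1) by (intro mult_left_mono) auto
  with r(3) have \<phi>: "\<phi> < 2 * pi" by linarith
  have "(r * cos (\<phi> + \<theta> r))\<^sup>2 + (r * sin (\<phi> + \<theta> r))\<^sup>2 = r\<^sup>2 * ((cos (\<phi> + \<theta> r))\<^sup>2 + (sin (\<phi> + \<theta> r))\<^sup>2)"
    by (simp only: power_mult_distrib distrib_left)
  then have n: "norm x = r" using r by (simp add: x norm_Pair)
  have 1: "fst x * cos (\<theta> r) + snd x * sin (\<theta> r) = r * cos \<phi>"
    using cos_diff[of "\<phi> + \<theta> r" "\<theta> r"] by (simp add: x algebra_simps del: cos_add sin_add)
  have 2: "snd x * cos (\<theta> r) - fst x * sin (\<theta> r) = r * sin \<phi>"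
  proof -
    have *: "sin \<phi> = sin (\<phi> + \<theta> r) * cos (\<theta> r) - cos (\<phi> + \<theta> r) * sin (\<theta> r)"
      using sin_diff[of "\<phi> + \<theta> r" "\<theta> r"] by simp
    show ?thesis unfolding * by (simp add: x algebra_simps)
  qed
  have "wedge_angle \<theta> x = \<phi>"
    unfolding wedge_angle_def n 1 2 using slit_angle_polar[OF r(1,2) \<phi>] by simp
  then show "0 < norm x" "0 < wedge_angle \<theta> x" "wedge_angle \<theta> x < 2 * pi * a"
    "fst x * cos (\<theta> (norm x)) + snd x * sin (\<theta> (norm x)) < norm x"
    using r slit_angle_polar[OF r(1,2) \<phi>] by (simp_all add: n 1)
qed

lemma has_derivative_wedge_angle:
  assumes \<theta>: "\<And>r. 0 < r \<Longrightarrow> (\<theta> has_real_derivative \<theta>' r) (at r)" and "a \<le> 1" "x \<in> curved_wedge \<theta> a"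
  shows "(wedge_angle \<theta> has_derivative (\<lambda>h. wedge_angle_grad \<theta>' x \<bullet> h)) (at x)"
proof -
  define r where "r = norm x"
  define c s where "c = cos (\<theta> r)" and "s = sin (\<theta> r)"
  define z where "z x = (fst x * cos (\<theta> (norm x)) + snd x * sin (\<theta> (norm x)), snd x * cos (\<theta> (norm x)) - fst x * sin (\<theta> (norm x)))" for x :: "real \<times> real"
  have r: "r > 0" and x: "x \<noteq> 0" and zlt: "fst (z x) < r"
    using curved_wedge_angle[OF assms(2,3)] by (auto simp: r_def z_def)
  have cs: "c * c + s * s = 1" using sin_cos_squared_add[of "\<theta> r"] by (simp add: c_def s_def power2_eq_square)
  have rr: "r * r = fst x * fst x + snd x * snd x" by (simp add: r_def norm_prod_def power2_eq_square)
  have zx: "z x = (fst x * c + snd x * s, snd x * c - fst x * s)" by (simp add: z_def c_def s_def r_def)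
  have nz: "norm (z x) = r"
  proof -
    have "(fst x * c + snd x * s)\<^sup>2 + (snd x * c - fst x * s)\<^sup>2 = (fst x * fst x + snd x * snd x) * (c * c + s * s)"
      by (simp add: power2_eq_square algebra_simps)
    then show ?thesis using r by (simp add: zx norm_Pair cs rr[symmetric])
  qed
  have dn: "(norm has_derivative (\<lambda>h. (x \<bullet> h) / r)) (at x)"
    by (rule has_derivative_eq_rhs[OF has_derivative_norm[OF x]])
       (simp add: fun_eq_iff sgn_div_norm r_def divide_inverse inner_commute)
  define \<rho> where "\<rho> h = \<theta>' r * ((x \<bullet> h) / r)" for h
  have d\<theta>: "((\<lambda>x. \<theta> (norm x)) has_derivative \<rho>) (at x)"
    unfolding \<rho>_def
    by (rule has_derivative_compose[OF dn]) (use \<theta>[OF r] in \<open>simp add: has_field_derivative_def r_def\<close>)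
  have dc: "((\<lambda>x. cos (\<theta> (norm x))) has_derivative (\<lambda>h. - s * \<rho> h)) (at x)"
    by (rule has_derivative_eq_rhs[OF has_derivative_compose[OF d\<theta> DERIV_cos[unfolded has_field_derivative_def]]])
       (simp add: s_def r_def)
  have ds: "((\<lambda>x. sin (\<theta> (norm x))) has_derivative (\<lambda>h. c * \<rho> h)) (at x)"
    by (rule has_derivative_eq_rhs[OF has_derivative_compose[OF d\<theta> DERIV_sin[unfolded has_field_derivative_def]]])
       (simp add: c_def r_def)
  define z' where "z' h = (fst h * c + snd h * s + (snd x * c - fst x * s) * \<rho> h,
      snd h * c - fst h * s - (fst x * c + snd x * s) * \<rho> h)" for h
  note f = has_derivative_fst[OF has_derivative_ident, of "at x"] has_derivative_snd[OF has_derivative_ident, of "at x"]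
  have "(z has_derivative (\<lambda>h. (fst x * (- s * \<rho> h) + fst h * cos (\<theta> (norm x)) + (snd x * (c * \<rho> h) + snd h * sin (\<theta> (norm x))),
      snd x * (- s * \<rho> h) + snd h * cos (\<theta> (norm x)) - (fst x * (c * \<rho> h) + fst h * sin (\<theta> (norm x)))))) (at x)"
    unfolding z_def[abs_def]
    by (intro has_derivative_Pair has_derivative_add has_derivative_diff has_derivative_mult dc ds f)
  then have dz: "(z has_derivative z') (at x)"
    by (rule has_derivative_eq_rhs) (simp add: fun_eq_iff z'_def c_def[symmetric] s_def[symmetric] r_def[symmetric] algebra_simps)
  have "(slit_angle has_derivative (\<lambda>h. (fst (z x) * snd h - snd (z x) * fst h) / (norm (z x))\<^sup>2)) (at (z x))"
    by (rule has_derivative_slit_angle) (use zlt nz in simp)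
  from has_derivative_compose[OF dz this]
  have "((\<lambda>x. slit_angle (z x)) has_derivative (\<lambda>h. (fst (z x) * snd (z' h) - snd (z x) * fst (z' h)) / r\<^sup>2)) (at x)"
    by (simp add: nz)
  moreover have "(\<lambda>h. (fst (z x) * snd (z' h) - snd (z x) * fst (z' h)) / r\<^sup>2) = (\<lambda>h. wedge_angle_grad \<theta>' x \<bullet> h)"
  proof
    fix h
    \<comment> \<open>The back rotation contributes only the factor c * c + s * s = 1, and its
      variation \<open>\<rho> h\<close> only the radial term.\<close>
    have "fst (z x) * snd (z' h) - snd (z x) * fst (z' h)
        = (c * c + s * s) * (fst x * snd h - snd x * fst h) - (c * c + s * s) * (fst x * fst x + snd x * snd x) * \<rho> h"
      unfolding zx z'_def by (simp add: algebra_simps)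
    also have "\<dots> = (fst x * snd h - snd x * fst h) - r * r * \<rho> h" by (simp add: cs rr)
    finally have eq: "fst (z x) * snd (z' h) - snd (z x) * fst (z' h) = (fst x * snd h - snd x * fst h) - r * r * \<rho> h" .
    show "(fst (z x) * snd (z' h) - snd (z x) * fst (z' h)) / r\<^sup>2 = wedge_angle_grad \<theta>' x \<bullet> h"
      unfolding eq using r
      by (simp add: wedge_angle_grad_def r_def[symmetric] \<rho>_def inner_prod_def power2_eq_square field_simps)
  qed
  ultimately show ?thesis by (simp add: wedge_angle_def[abs_def] z_def)
qed

section \<open>The Gaussian weight\<close>

text \<open>These are the two components of a(q) x + b(q) C x', where q is the squared norm and x'
  is x turned by a right angle. Taking the coefficients as functions of q avoids differentiating the
  norm itself.\<close>

lemma radial_rotational_field_deriv: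
  fixes C :: "real \<times> real \<Rightarrow> real"
  assumes a: "(a has_real_derivative a') (at ((norm x)\<^sup>2))" and b: "(b has_real_derivative b') (at ((norm x)\<^sup>2))"
    and C: "(C has_derivative (\<lambda>h. c \<bullet> h)) (at x)"
  defines "q \<equiv> (norm x)\<^sup>2"
  shows "((\<lambda>x. a ((norm x)\<^sup>2) * fst x - b ((norm x)\<^sup>2) * C x * snd x) has_derivative
      (\<lambda>h. ((2 * a' * fst x - 2 * b' * C x * snd x) *\<^sub>R x - (b q * snd x) *\<^sub>R c + (a q, - b q * C x)) \<bullet> h)) (at x)"
    and "((\<lambda>x. a ((norm x)\<^sup>2) * snd x + b ((norm x)\<^sup>2) * C x * fst x) has_derivative
      (\<lambda>h. ((2 * a' * snd x + 2 * b' * C x * fst x) *\<^sub>R x + (b q * fst x) *\<^sub>R c + (b q * C x, a q)) \<bullet> h)) (at x)"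
proof -
  have dq: "((\<lambda>x :: real \<times> real. (norm x)\<^sup>2) has_derivative (\<lambda>h. 2 * (x \<bullet> h))) (at x)"
    unfolding power2_norm_eq_inner
    by (rule has_derivative_eq_rhs[OF has_derivative_inner[OF has_derivative_ident has_derivative_ident]])
       (simp add: fun_eq_iff inner_commute)
  have da: "((\<lambda>x. a ((norm x)\<^sup>2)) has_derivative (\<lambda>h. a' * (2 * (x \<bullet> h)))) (at x)"
    by (rule has_derivative_compose[OF dq]) (use a in \<open>simp add: has_field_derivative_def\<close>)
  have db: "((\<lambda>x. b ((norm x)\<^sup>2)) has_derivative (\<lambda>h. b' * (2 * (x \<bullet> h)))) (at x)"
    by (rule has_derivative_compose[OF dq]) (use b in \<open>simp add: has_field_derivative_def\<close>)
  note f = has_derivative_fst[OF has_derivative_ident, of "at x"] has_derivative_snd[OF has_derivative_ident, of "at x"]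
  note dbC = has_derivative_mult[OF db C]
  show "((\<lambda>x. a ((norm x)\<^sup>2) * fst x - b ((norm x)\<^sup>2) * C x * snd x) has_derivative
      (\<lambda>h. ((2 * a' * fst x - 2 * b' * C x * snd x) *\<^sub>R x - (b q * snd x) *\<^sub>R c + (a q, - b q * C x)) \<bullet> h)) (at x)"
    by (rule has_derivative_eq_rhs[OF has_derivative_diff[OF has_derivative_mult[OF da f(1)] has_derivative_mult[OF dbC f(2)]]])
       (simp add: fun_eq_iff q_def inner_add_left inner_diff_left inner_Pair algebra_simps)
  show "((\<lambda>x. a ((norm x)\<^sup>2) * snd x + b ((norm x)\<^sup>2) * C x * fst x) has_derivative
      (\<lambda>h. ((2 * a' * snd x + 2 * b' * C x * fst x) *\<^sub>R x + (b q * fst x) *\<^sub>R c + (b q * C x, a q)) \<bullet> h)) (at x)"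
    by (rule has_derivative_eq_rhs[OF has_derivative_add[OF has_derivative_mult[OF da f(2)] has_derivative_mult[OF dbC f(1)]]])
       (simp add: fun_eq_iff q_def inner_add_left inner_diff_left inner_Pair algebra_simps)
qed

text \<open>The argument q stands for the squared distance to the origin, and the time T is meant to
  be 1 + t. The normalising constant is left out so that the value at T = 1, q = 0 is 1.\<close>

definition gauss_kernel :: "real \<Rightarrow> real \<Rightarrow> real \<Rightarrow> real" where
  "gauss_kernel \<nu> T q = T powr (- 1 - \<nu>) * exp (- (q / (4 * T)))"

definition weight :: "real \<Rightarrow> real \<Rightarrow> real \<Rightarrow> real \<times> real \<Rightarrow> real" where
  "weight \<nu> \<epsilon> T x = 1 / (\<epsilon> + gauss_kernel \<nu> T ((norm x)\<^sup>2))"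

definition weight_grad :: "real \<Rightarrow> real \<Rightarrow> real \<Rightarrow> real \<times> real \<Rightarrow> real \<times> real" where
  "weight_grad \<nu> \<epsilon> T x =
     (gauss_kernel \<nu> T ((norm x)\<^sup>2) / (2 * T) / (\<epsilon> + gauss_kernel \<nu> T ((norm x)\<^sup>2))\<^sup>2) *\<^sub>R x"

definition weight_dt :: "real \<Rightarrow> real \<Rightarrow> real \<Rightarrow> real \<times> real \<Rightarrow> real" where
  "weight_dt \<nu> \<epsilon> T x = gauss_kernel \<nu> T ((norm x)\<^sup>2) * ((1 + \<nu>) / T - (norm x)\<^sup>2 / (4 * T\<^sup>2))
     / (\<epsilon> + gauss_kernel \<nu> T ((norm x)\<^sup>2))\<^sup>2"

text \<open>The left side is the divergence of the field \<open>Y\<close> built below, the right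
  side is \<open>2 m |F|^2\<close> plus the time derivative of the weight m = 1/k, with q the
  squared radius and c, s the cosine and sine of \<nu>\<alpha>. Equality, not just an estimate,
  reflects that k times r powr \<nu> times sin (\<nu>\<alpha>) solves the heat equation on the
  straight wedge. The singular terms in s cancel through c^2 = 1 - s^2.\<close>

lemma weight_divergence_identity:
  fixes q p k \<nu> T s c :: real
  assumes "k > 0" "q > 0" "T > 0" "s \<noteq> 0" "c\<^sup>2 + s\<^sup>2 = 1"
  shows "2 * (p / k\<^sup>2 - 2 * \<nu> / (k * q)) +
      2 * q * (- p / (4 * T * k\<^sup>2) + p\<^sup>2 / k ^ 3 - \<nu> * p / (k\<^sup>2 * q) + 2 * \<nu> / (k * q\<^sup>2)) + 2 * \<nu>\<^sup>2 / (k * q * s\<^sup>2)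
    = 2 * (1 / k) * ((p / k - \<nu> / q)\<^sup>2 * q + (\<nu> / q * (c / s))\<^sup>2 * q) + 2 * p * ((1 + \<nu>) - q / (4 * T)) / k\<^sup>2"
proof -
  have c: "c\<^sup>2 = 1 - s\<^sup>2" using assms(5) by simp
  show ?thesis
    using assms(1-4)
    by (simp add: power_divide power_mult_distrib c power2_diff)
       (simp add: divide_simps power2_eq_square power3_eq_cube, simp add: algebra_simps power4_eq_xxxx)
qed

lemma wedge_weighted_form_nonneg:
  assumes a: "0 < a" "a \<le> 1" and \<theta>: "\<And>r. 0 < r \<Longrightarrow> (\<theta> has_real_derivative \<theta>' r) (at r)"
    and \<theta>'_cont: "continuous_on {0<..} \<theta>'" and \<epsilon>: "0 < \<epsilon>" and T: "0 < T"
    and tp: "test_pair (curved_wedge \<theta> a) \<phi> G"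
  defines "\<nu> \<equiv> 1 / (2 * a)"
  shows "0 \<le> (\<integral>x. 2 * (G x \<bullet> (weight \<nu> \<epsilon> T x *\<^sub>R G x + \<phi> x *\<^sub>R weight_grad \<nu> \<epsilon> T x)) - weight_dt \<nu> \<epsilon> T x * (\<phi> x)\<^sup>2 \<partial>lborel)"
proof -
  let ?W = "curved_wedge \<theta> a"
  define K where "K = gauss_kernel \<nu> T"
  define k where "k q = \<epsilon> + K q" for q
  define p where "p q = K q / (2 * T)" for q
  have K: "K q > 0" for q using T by (simp add: K_def gauss_kernel_def)
  have k: "k q > 0" for q using K[of q] \<epsilon> by (simp add: k_def)
  have K': "(K has_real_derivative (- p q / 2)) (at q)" for q
    unfolding K_def gauss_kernel_def p_def using T
    by (auto intro!: derivative_eq_intros simp: field_simps)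
  have Kc [continuous_intros]: "continuous_on A (\<lambda>x. K (f x))" if "continuous_on A f" for A :: "'z::topological_space set" and f
    unfolding K_def gauss_kernel_def using that T by (auto intro!: continuous_intros)
  \<comment> \<open>\<open>u\<close> and \<open>v\<close> are the coefficients of
    \<open>2 m F - dm\<close> along x and along the cotangent times x turned by a right angle;
    \<open>p q\<close> times x is minus the gradient of k.\<close>
  define u where "u q = p q / (k q)\<^sup>2 - 2 * \<nu> / (k q * q)" for q
  define u' where "u' q = - p q / (4 * T * (k q)\<^sup>2) + (p q)\<^sup>2 / (k q) ^ 3 - \<nu> * p q / ((k q)\<^sup>2 * q) + 2 * \<nu> / (k q * q\<^sup>2)" for q
  define v where "v q = - (2 * \<nu> / (k q * q))" for q
  define v' where "v' q = 2 * \<nu> * (k q - p q * q / 2) / (k q * q)\<^sup>2" for q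
  note K'[derivative_intros]
  have k': "(k has_real_derivative (- p q / 2)) (at q)" for q
    unfolding k_def by (auto intro!: derivative_eq_intros K')
  have p': "(p has_real_derivative (- p q / (4 * T))) (at q)" for q
    unfolding p_def using T by (auto intro!: derivative_eq_intros K' simp: p_def)
  have du: "(u has_real_derivative u' q) (at q)" if "q > 0" for q
    unfolding u_def u'_def using that k[of q] T
    by (auto intro!: derivative_eq_intros k' p')
       (simp add: divide_simps power2_eq_square power3_eq_cube, simp add: algebra_simps power4_eq_xxxx)
  have dv: "(v has_real_derivative v' q) (at q)" if "q > 0" for q
  proof -
    have kq: "k q * q \<noteq> 0" using that k[of q] by simp
    have "((\<lambda>q. - (2 * \<nu> / (k q * q))) has_real_derivative
        - ((0 * (k q * q) - 2 * \<nu> * (- p q / 2 * q + 1 * k q)) / ((k q * q) * (k q * q)))) (at q)"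
      by (rule DERIV_minus[OF DERIV_divide[OF DERIV_const DERIV_mult[OF k' DERIV_ident] kq]])
    also have "- ((0 * (k q * q) - 2 * \<nu> * (- p q / 2 * q + 1 * k q)) / ((k q * q) * (k q * q))) = v' q"
      by (simp add: v'_def power2_eq_square)
    finally show ?thesis by (simp only: v_def[abs_def])
  qed
  define al where "al = wedge_angle \<theta>"
  define A where "A = wedge_angle_grad \<theta>'"
  define c where "c x = - (\<nu> / (sin (\<nu> * al x))\<^sup>2) *\<^sub>R A x" for x
  define C where "C x = cot (\<nu> * al x)" for x
  \<comment> \<open>The angle is below 2 * pi * a and \<nu> = 1 / (2 * a), so \<nu>\<alpha> stays in
    (0, pi), where the sine is positive and the cotangent is finite.\<close>
  have W: "0 < (norm x)\<^sup>2" "0 < norm x" "sin (\<nu> * al x) > 0" if "x \<in> ?W" for x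
  proof -
    note x = curved_wedge_angle[OF a(2) that]
    show "0 < norm x" "0 < (norm x)\<^sup>2" using x by auto
    have "\<nu> * al x < \<nu> * (2 * pi * a)" using x a by (intro mult_strict_left_mono) (auto simp: al_def \<nu>_def)
    also have "\<dots> = pi" using a by (simp add: \<nu>_def)
    finally show "sin (\<nu> * al x) > 0" using x a by (intro sin_gt_zero) (auto simp: al_def \<nu>_def)
  qed
  have dal: "(al has_derivative (\<lambda>h. A x \<bullet> h)) (at x)" if "x \<in> ?W" for x
    unfolding al_def A_def by (rule has_derivative_wedge_angle[OF \<theta> a(2) that])
  have dC: "(C has_derivative (\<lambda>h. c x \<bullet> h)) (at x)" if "x \<in> ?W" for x
  proof -
    have "(cot has_derivative (*) (- inverse ((sin (\<nu> * al x))\<^sup>2))) (at (\<nu> * al x))"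
      using DERIV_cot[of "\<nu> * al x"] W(3)[OF that] by (simp add: has_field_derivative_def)
    from has_derivative_compose[OF has_derivative_mult_right[OF dal[OF that]] this]
    show ?thesis unfolding C_def[abs_def]
      by (rule has_derivative_eq_rhs) (simp add: c_def fun_eq_iff divide_inverse)
  qed
  have alc [continuous_intros]: "continuous_on ?W al"
    by (intro continuous_at_imp_continuous_on ballI has_derivative_continuous[OF dal])
  have Ac [continuous_intros]: "continuous_on ?W A"
  proof -
    have "continuous_on ?W (\<lambda>x. \<theta>' (norm x))"
      by (rule continuous_on_compose2[OF \<theta>'_cont]) (use W in \<open>auto intro!: continuous_intros\<close>)
    then show ?thesis
      unfolding A_def wedge_angle_grad_def using W by (force intro!: continuous_intros)
  qed
  have Cc [continuous_intros]: "continuous_on ?W C"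
    by (intro continuous_at_imp_continuous_on ballI has_derivative_continuous[OF dC])
  have cc [continuous_intros]: "continuous_on ?W c"
    unfolding c_def using W(3) by (force intro!: continuous_intros)
  have k0: "k q \<noteq> 0" for q using k[of q] by simp
  have uc [continuous_intros]: "continuous_on ?W (\<lambda>x. u ((norm x)\<^sup>2))" "continuous_on ?W (\<lambda>x. u' ((norm x)\<^sup>2))"
      "continuous_on ?W (\<lambda>x. v ((norm x)\<^sup>2))" "continuous_on ?W (\<lambda>x. v' ((norm x)\<^sup>2))"
    using W T k0 unfolding u_def u'_def v_def v'_def p_def k_def
    by (force intro!: continuous_intros)+
  define Y where "Y x = (u ((norm x)\<^sup>2) * fst x - v ((norm x)\<^sup>2) * C x * snd x, u ((norm x)\<^sup>2) * snd x + v ((norm x)\<^sup>2) * C x * fst x)" for x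
  define AX where "AX x = (2 * u' ((norm x)\<^sup>2) * fst x - 2 * v' ((norm x)\<^sup>2) * C x * snd x) *\<^sub>R x
      - (v ((norm x)\<^sup>2) * snd x) *\<^sub>R c x + (u ((norm x)\<^sup>2), - v ((norm x)\<^sup>2) * C x)" for x
  define AY where "AY x = (2 * u' ((norm x)\<^sup>2) * snd x + 2 * v' ((norm x)\<^sup>2) * C x * fst x) *\<^sub>R x
      + (v ((norm x)\<^sup>2) * fst x) *\<^sub>R c x + (v ((norm x)\<^sup>2) * C x, u ((norm x)\<^sup>2))" for x
  \<comment> \<open>The negative of the logarithmic gradient from the overview: the three parts come
    from log k, \<nu> log r and log (sin (\<nu>\<alpha>)), the last along circles only.\<close>
  define F where "F x = (p ((norm x)\<^sup>2) / k ((norm x)\<^sup>2) - \<nu> / (norm x)\<^sup>2) *\<^sub>R x - (\<nu> / (norm x)\<^sup>2 * C x) *\<^sub>R (- snd x, fst x)" for x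
  show ?thesis
  proof (rule test_pair_weighted_form_nonneg[OF tp, where Y=Y and F=F and AX=AX and AY=AY])
    fix x assume x: "x \<in> ?W"
    show "((\<lambda>x. fst (Y x)) has_derivative (\<bullet>) (AX x)) (at x)"
      using radial_rotational_field_deriv(1)[OF du dv dC, OF W(1) W(1), OF x x x] by (simp add: Y_def AX_def)
    show "((\<lambda>x. snd (Y x)) has_derivative (\<bullet>) (AY x)) (at x)"
      using radial_rotational_field_deriv(2)[OF du dv dC, OF W(1) W(1), OF x x x] by (simp add: Y_def AY_def)
    define q where "q = (norm x)\<^sup>2"
    have q: "q > 0" "fst x * fst x + snd x * snd x = q" using W(1)[OF x]
      by (simp_all add: q_def norm_prod_def power2_eq_square)
    show "Y x = (2 * weight \<nu> \<epsilon> T x) *\<^sub>R F x - weight_grad \<nu> \<epsilon> T x"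
      unfolding weight_def weight_grad_def K_def[symmetric] k_def[symmetric] q_def[symmetric] p_def[symmetric]
      unfolding Y_def F_def q_def[symmetric] u_def v_def using k[of q] q(1)
      by (intro prod_eqI) (simp_all add: power2_eq_square field_simps)
    define s where "s = sin (\<nu> * al x)"
    have s: "s > 0" using W(3)[OF x] by (simp add: s_def)
    have "fst (AX x) + snd (AY x) = 2 * u q + 2 * u' q * (fst x * fst x + snd x * snd x) + v q * (fst x * snd (c x) - snd x * fst (c x))"
      unfolding AX_def AY_def q_def[symmetric] by (simp add: algebra_simps)
    also have "fst x * snd (c x) - snd x * fst (c x) = - (\<nu> / s\<^sup>2) * (fst x * snd (A x) - snd x * fst (A x))"
      unfolding c_def s_def[symmetric] by (simp add: algebra_simps)
    \<comment> \<open>The derivative of the angle along the circle through x. The radial part of the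
      gradient, which carries \<theta>', cancels here; this is where the twist leaves the
      computation.\<close>
    also have "fst x * snd (A x) - snd x * fst (A x) = (fst x * fst x + snd x * snd x) / q"
      unfolding A_def wedge_angle_grad_def q_def[symmetric] by (simp add: algebra_simps add_divide_distrib)
    also have "\<dots> = 1" using q by simp
    also have "2 * u q + 2 * u' q * (fst x * fst x + snd x * snd x) + v q * (- (\<nu> / s\<^sup>2) * 1)
        = 2 * u q + 2 * q * u' q + 2 * \<nu>\<^sup>2 / (k q * q * s\<^sup>2)"
      unfolding q(2) v_def by (simp add: power2_eq_square)
    also have "\<dots> = 2 * (1 / k q) * ((p q / k q - \<nu> / q)\<^sup>2 * q + (\<nu> / q * (cos (\<nu> * al x) / s))\<^sup>2 * q)
        + 2 * p q * ((1 + \<nu>) - q / (4 * T)) / (k q)\<^sup>2"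
      unfolding u_def u'_def
      by (rule weight_divergence_identity) (use k q T s in \<open>auto simp: s_def\<close>)
    also have "(p q / k q - \<nu> / q)\<^sup>2 * q + (\<nu> / q * (cos (\<nu> * al x) / s))\<^sup>2 * q = (norm (F x))\<^sup>2"
    proof -
      have "C x = cos (\<nu> * al x) / s" by (simp add: C_def cot_def s_def)
      moreover have "(norm (\<alpha> *\<^sub>R x - \<beta> *\<^sub>R (- snd x, fst x)))\<^sup>2 = (\<alpha>\<^sup>2 + \<beta>\<^sup>2) * (fst x * fst x + snd x * snd x)" for \<alpha> \<beta>
        unfolding power2_norm_eq_inner by (simp add: inner_prod_def power2_eq_square algebra_simps)
      ultimately show ?thesis unfolding F_def q_def[symmetric] q(2) by (simp only: distrib_right)
    qed
    also have "2 * p q * ((1 + \<nu>) - q / (4 * T)) / (k q)\<^sup>2 = weight_dt \<nu> \<epsilon> T x"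
    proof -
      have eq: "2 * (K q / (2 * T)) * ((1 + \<nu>) - q / (4 * T)) = K q * ((1 + \<nu>) / T - q / (4 * T\<^sup>2))"
        using T by (simp add: field_simps power2_eq_square)
      show ?thesis
        unfolding weight_dt_def K_def[symmetric] q_def[symmetric] k_def[symmetric] p_def eq ..
    qed
    finally show "2 * weight \<nu> \<epsilon> T x * (norm (F x))\<^sup>2 + weight_dt \<nu> \<epsilon> T x \<le> fst (AX x) + snd (AY x)"
      unfolding weight_def K_def[symmetric] k_def[symmetric] q_def[symmetric] by simp
  next
    show "continuous_on ?W AX" "continuous_on ?W AY"
      unfolding AX_def AY_def by (intro continuous_intros)+
    have k0': "\<epsilon> + K q \<noteq> 0" for q using k0 by (simp add: k_def)
    show "0 \<le> weight \<nu> \<epsilon> T x" for x using k[of "(norm x)\<^sup>2"] by (simp add: weight_def K_def k_def)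
    show "continuous_on UNIV (weight \<nu> \<epsilon> T)" "continuous_on UNIV (weight_grad \<nu> \<epsilon> T)" "continuous_on UNIV (weight_dt \<nu> \<epsilon> T)"
      unfolding weight_def[abs_def] weight_grad_def[abs_def] weight_dt_def[abs_def] K_def[symmetric] using k0' T
      by (auto intro!: continuous_intros)
  qed
qed

section \<open>The space of functions vanishing on the boundary\<close>

text \<open>Square integrability of u and V, which the definition of \<open>H01\<close> does not
  state, follows from a single approximating test pair at finite distance. From here on only real
  norms are used.\<close>

lemma H01_iff:
  "H01 \<Omega> u V \<longleftrightarrow> square_int lborel u \<and> square_int lborel V \<and>
    (\<exists>\<phi> G. (\<forall>n. test_pair \<Omega> (\<phi> n) (G n)) \<and> (\<lambda>n. L2norm lborel (\<lambda>x. \<phi> n x - u x)) \<longlonglongrightarrow> 0 \<and>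
       (\<lambda>n. L2norm lborel (\<lambda>x. G n x - V x)) \<longlonglongrightarrow> 0)" (is "_ \<longleftrightarrow> ?R")
proof
  assume H: "H01 \<Omega> u V"
  then have [measurable]: "u \<in> borel_measurable lborel" "V \<in> borel_measurable lborel" by (auto simp: H01_def)
  obtain \<phi> G where tp: "\<And>n. test_pair \<Omega> (\<phi> n) (G n)"
    and l1: "(\<lambda>n. \<integral>\<^sup>+x. ennreal ((norm (\<phi> n x - u x))\<^sup>2) \<partial>lborel) \<longlonglongrightarrow> 0"
    and l2: "(\<lambda>n. \<integral>\<^sup>+x. ennreal ((norm (G n x - V x))\<^sup>2) \<partial>lborel) \<longlonglongrightarrow> 0"
    using H unfolding H01_def by auto
  note sq = test_pair_square_int[OF tp]
  have m: "(\<lambda>x. \<phi> n x - u x) \<in> borel_measurable lborel" "(\<lambda>x. G n x - V x) \<in> borel_measurable lborel" for n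
    using square_int_measurable[OF sq(1)[of n]] square_int_measurable[OF sq(2)[of n]] by (measurable, measurable)
  note L1 = L2norm_tendsto_0I[OF l1 always_eventually[OF allI[OF m(1)]]]
    and L2 = L2norm_tendsto_0I[OF l2 always_eventually[OF allI[OF m(2)]]]
  \<comment> \<open>One index with finite distance suffices: u is \<phi> n minus the difference
    \<phi> n - u.\<close>
  obtain n where "square_int lborel (\<lambda>x. \<phi> n x - u x)"
    using eventually_happens'[OF _ L1(1)] by auto
  from square_int_diff[OF sq(1)[of n] this] have "square_int lborel u" by simp
  moreover obtain n where "square_int lborel (\<lambda>x. G n x - V x)"
    using eventually_happens'[OF _ L2(1)] by auto
  from square_int_diff[OF sq(2)[of n] this] have "square_int lborel V" by simp
  ultimately show ?R using tp L1(2) L2(2) by blast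
next
  assume R: ?R
  then obtain \<phi> G where sq: "square_int lborel u" "square_int lborel V" and tp: "\<And>n. test_pair \<Omega> (\<phi> n) (G n)"
    and l: "(\<lambda>n. L2norm lborel (\<lambda>x. \<phi> n x - u x)) \<longlonglongrightarrow> 0" "(\<lambda>n. L2norm lborel (\<lambda>x. G n x - V x)) \<longlonglongrightarrow> 0"
    by blast
  have e: "(\<integral>\<^sup>+x. ennreal ((\<phi> n x - u x)\<^sup>2) \<partial>lborel) = ennreal ((L2norm lborel (\<lambda>x. \<phi> n x - u x))\<^sup>2)"
    "(\<integral>\<^sup>+x. ennreal ((norm (G n x - V x))\<^sup>2) \<partial>lborel) = ennreal ((L2norm lborel (\<lambda>x. G n x - V x))\<^sup>2)" for n
    using nn_integral_eq_L2norm[OF square_int_diff[OF test_pair_square_int(1)[OF tp] sq(1)], of n]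
      nn_integral_eq_L2norm[OF square_int_diff[OF test_pair_square_int(2)[OF tp] sq(2)], of n] by simp_all
  have "(\<lambda>n. ennreal ((L2norm lborel (\<lambda>x. \<phi> n x - u x))\<^sup>2)) \<longlonglongrightarrow> ennreal (0\<^sup>2)"
    "(\<lambda>n. ennreal ((L2norm lborel (\<lambda>x. G n x - V x))\<^sup>2)) \<longlonglongrightarrow> ennreal (0\<^sup>2)"
    by (intro tendsto_ennrealI tendsto_power l)+
  then show "H01 \<Omega> u V"
    unfolding H01_def e[symmetric] using sq tp by (auto simp: square_int_def intro!: exI[of _ \<phi>] exI[of _ G])
qed

lemma H01_square_int: "H01 \<Omega> u V \<Longrightarrow> square_int lborel u" "H01 \<Omega> u V \<Longrightarrow> square_int lborel V"
  by (simp_all add: H01_iff)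

lemma H01_zero: "H01 \<Omega> (\<lambda>x. 0) (\<lambda>x. 0)"
proof -
  have "test_pair \<Omega> (\<lambda>_. 0) (\<lambda>_. 0)"
    by (auto simp: test_pair_def intro!: has_derivative_eq_rhs[OF has_derivative_const])
  then show ?thesis
    unfolding H01_iff by (auto simp: square_int_def L2norm_def intro!: exI[of _ "\<lambda>_ _. 0"])
qed

lemma H01_add:
  assumes "H01 \<Omega> u V" "H01 \<Omega> u' V'"
  shows "H01 \<Omega> (\<lambda>x. u x + u' x) (\<lambda>x. V x + V' x)"
proof -
  from assms(1) obtain \<phi> G where 1: "square_int lborel u" "square_int lborel V" "\<And>n. test_pair \<Omega> (\<phi> n) (G n)"
    "(\<lambda>n. L2norm lborel (\<lambda>x. \<phi> n x - u x)) \<longlonglongrightarrow> 0" "(\<lambda>n. L2norm lborel (\<lambda>x. G n x - V x)) \<longlonglongrightarrow> 0"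
    unfolding H01_iff by blast
  from assms(2) obtain \<psi> H where 2: "square_int lborel u'" "square_int lborel V'" "\<And>n. test_pair \<Omega> (\<psi> n) (H n)"
    "(\<lambda>n. L2norm lborel (\<lambda>x. \<psi> n x - u' x)) \<longlonglongrightarrow> 0" "(\<lambda>n. L2norm lborel (\<lambda>x. H n x - V' x)) \<longlonglongrightarrow> 0"
    unfolding H01_iff by blast
  note s1 = test_pair_square_int[OF 1(3)] and s2 = test_pair_square_int[OF 2(3)]
  have lim: "(\<lambda>n. L2norm lborel (\<lambda>x. (f n x + f' n x) - (g x + g' x))) \<longlonglongrightarrow> 0"
    if "(\<lambda>n. L2norm lborel (\<lambda>x. f n x - g x)) \<longlonglongrightarrow> 0" "(\<lambda>n. L2norm lborel (\<lambda>x. f' n x - g' x)) \<longlonglongrightarrow> 0"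
      "\<And>n. square_int lborel (f n)" "\<And>n. square_int lborel (f' n)" "square_int lborel g" "square_int lborel g'"
    for f f' :: "nat \<Rightarrow> real \<times> real \<Rightarrow> 'z::euclidean_space" and g g'
  proof (rule Lim_null_comparison)
    show "(\<lambda>n. L2norm lborel (\<lambda>x. f n x - g x) + L2norm lborel (\<lambda>x. f' n x - g' x)) \<longlonglongrightarrow> 0"
      using tendsto_add[OF that(1,2)] by simp
    have "L2norm lborel (\<lambda>x. (f n x + f' n x) - (g x + g' x)) \<le> L2norm lborel (\<lambda>x. f n x - g x) + L2norm lborel (\<lambda>x. f' n x - g' x)" for n
      using L2norm_triangle[OF square_int_diff[OF that(3,5)] square_int_diff[OF that(4,6)], of n n]
      by (simp add: algebra_simps)
    then show "\<forall>\<^sub>F n in sequentially. norm (L2norm lborel (\<lambda>x. (f n x + f' n x) - (g x + g' x))) \<le> L2norm lborel (\<lambda>x. f n x - g x) + L2norm lborel (\<lambda>x. f' n x - g' x)"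
      by simp
  qed
  show ?thesis
    unfolding H01_iff
    by (intro conjI exI[of _ "\<lambda>n x. \<phi> n x + \<psi> n x"] exI[of _ "\<lambda>n x. G n x + H n x"] allI square_int_add
        test_pair_add lim 1 2 s1 s2)
qed

text \<open>Used for sums of a solution at several times: the finite double sums of the energy
  kernel are the weighted form evaluated at such sums.\<close>

lemma H01_sum:
  assumes "\<And>i. i < (n::nat) \<Longrightarrow> H01 \<Omega> (u i) (V i)"
  shows "H01 \<Omega> (\<lambda>x. \<Sum>i<n. u i x) (\<lambda>x. \<Sum>i<n. V i x)"
  using assms by (induction n) (auto simp: H01_zero intro!: H01_add)

section \<open>Multiplication by bounded weights\<close>

lemma square_int_bounded_mult:
  fixes f :: "'a \<Rightarrow> 'b::euclidean_space" and b :: "'a \<Rightarrow> real"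
  assumes "square_int M f" "b \<in> borel_measurable M" "\<And>x. \<bar>b x\<bar> \<le> C"
  shows "square_int M (\<lambda>x. b x *\<^sub>R f x)" "L2norm M (\<lambda>x. b x *\<^sub>R f x) \<le> C * L2norm M f"
proof -
  have m: "(\<lambda>x. b x *\<^sub>R f x) \<in> borel_measurable M" using assms by measurable
  have b: "norm (b x *\<^sub>R f x) \<le> C * norm (f x)" for x
    using assms(3) by (simp add: mult_right_mono)
  have "0 \<le> C" using assms(3)[of undefined] by linarith
  then show "square_int M (\<lambda>x. b x *\<^sub>R f x)" "L2norm M (\<lambda>x. b x *\<^sub>R f x) \<le> C * L2norm M f"
    using square_int_dominated[OF assms(1) m b] L2norm_dominated[OF assms(1) m b] by auto
qed

lemma square_int_bounded_vec:
  fixes f :: "'a \<Rightarrow> real" and b :: "'a \<Rightarrow> 'b::euclidean_space"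
  assumes "square_int M f" "b \<in> borel_measurable M" "\<And>x. norm (b x) \<le> C"
  shows "square_int M (\<lambda>x. f x *\<^sub>R b x)" "L2norm M (\<lambda>x. f x *\<^sub>R b x) \<le> C * L2norm M f"
proof -
  have m: "(\<lambda>x. f x *\<^sub>R b x) \<in> borel_measurable M" using assms by measurable
  have b: "norm (f x *\<^sub>R b x) \<le> C * norm (f x)" for x
    using mult_right_mono[OF assms(3)[of x], of "\<bar>f x\<bar>"] by (simp add: mult.commute)
  have "0 \<le> C" using norm_ge_zero[of "b undefined"] assms(3)[of undefined] by linarith
  then show "square_int M (\<lambda>x. f x *\<^sub>R b x)" "L2norm M (\<lambda>x. f x *\<^sub>R b x) \<le> C * L2norm M f"
    using square_int_dominated[OF assms(1) m b] L2norm_dominated[OF assms(1) m b] by auto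
qed

text \<open>A common bound for the weight and its gradient is what makes multiplication by
  \<open>m\<close> continuous in the norm of function and gradient together, hence compatible with
  the limits defining \<open>H01\<close>.\<close>

locale bounded_weight =
  fixes m :: "real \<times> real \<Rightarrow> real" and dm :: "real \<times> real \<Rightarrow> real \<times> real" and C :: real
  assumes deriv: "\<And>x. (m has_derivative (\<lambda>h. dm x \<bullet> h)) (at x)"
    and dm_cont: "continuous_on UNIV dm"
    and m_bound: "\<And>x. \<bar>m x\<bar> \<le> C" and dm_bound: "\<And>x. norm (dm x) \<le> C"
begin

lemma m_measurable [measurable]: "m \<in> borel_measurable borel"
  by (intro borel_measurable_continuous_onI continuous_at_imp_continuous_on ballI has_derivative_continuous[OF deriv])

lemma dm_measurable [measurable]: "dm \<in> borel_measurable borel"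
  by (intro borel_measurable_continuous_onI dm_cont)

lemma C_nonneg: "0 \<le> C"
  using m_bound[of 0] by linarith

lemma square_int_weighted:
  assumes "square_int lborel u" "square_int lborel V"
  shows "square_int lborel (\<lambda>x. m x * u x)" "square_int lborel (\<lambda>x. m x *\<^sub>R V x + u x *\<^sub>R dm x)"
    "L2norm lborel (\<lambda>x. m x * u x) \<le> C * L2norm lborel u"
    "L2norm lborel (\<lambda>x. m x *\<^sub>R V x + u x *\<^sub>R dm x) \<le> C * (L2norm lborel V + L2norm lborel u)"
proof -
  note 1 = square_int_bounded_mult[of lborel _ m C, OF _ _ m_bound] and 2 = square_int_bounded_vec[of lborel _ dm C, OF _ _ dm_bound]
  show "square_int lborel (\<lambda>x. m x * u x)" "L2norm lborel (\<lambda>x. m x * u x) \<le> C * L2norm lborel u"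
    using 1[OF assms(1)] by auto
  have s: "square_int lborel (\<lambda>x. m x *\<^sub>R V x)" "square_int lborel (\<lambda>x. u x *\<^sub>R dm x)"
    using 1[OF assms(2)] 2[OF assms(1)] by auto
  show "square_int lborel (\<lambda>x. m x *\<^sub>R V x + u x *\<^sub>R dm x)"
    by (rule square_int_add[OF s])
  have "L2norm lborel (\<lambda>x. m x *\<^sub>R V x + u x *\<^sub>R dm x) \<le> C * L2norm lborel V + C * L2norm lborel u"
    using L2norm_triangle[OF s] 1(2)[OF assms(2)] 2(2)[OF assms(1)] by simp
  then show "L2norm lborel (\<lambda>x. m x *\<^sub>R V x + u x *\<^sub>R dm x) \<le> C * (L2norm lborel V + L2norm lborel u)"
    by (simp add: distrib_left)
qed

lemma weighted_tendsto:
  assumes "\<And>n. square_int lborel (\<phi> n)" "\<And>n. square_int lborel (G n)" "square_int lborel u" "square_int lborel V"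
    and l: "(\<lambda>n. L2norm lborel (\<lambda>x. \<phi> n x - u x)) \<longlonglongrightarrow> 0" "(\<lambda>n. L2norm lborel (\<lambda>x. G n x - V x)) \<longlonglongrightarrow> 0"
  shows "(\<lambda>n. L2norm lborel (\<lambda>x. m x * \<phi> n x - m x * u x)) \<longlonglongrightarrow> 0"
    "(\<lambda>n. L2norm lborel (\<lambda>x. m x *\<^sub>R G n x + \<phi> n x *\<^sub>R dm x - (m x *\<^sub>R V x + u x *\<^sub>R dm x))) \<longlonglongrightarrow> 0"
proof -
  note d = square_int_weighted(3,4)[OF square_int_diff[OF assms(1,3)] square_int_diff[OF assms(2,4)]]
  have e: "m x *\<^sub>R G n x + \<phi> n x *\<^sub>R dm x - (m x *\<^sub>R V x + u x *\<^sub>R dm x) = m x *\<^sub>R (G n x - V x) + (\<phi> n x - u x) *\<^sub>R dm x" for n x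
    by (simp add: algebra_simps)
  show "(\<lambda>n. L2norm lborel (\<lambda>x. m x * \<phi> n x - m x * u x)) \<longlonglongrightarrow> 0"
  proof (rule Lim_null_comparison)
    show "(\<lambda>n. C * L2norm lborel (\<lambda>x. \<phi> n x - u x)) \<longlonglongrightarrow> 0" using tendsto_mult_left[OF l(1)] by simp
  qed (use d(1) in \<open>simp add: right_diff_distrib\<close>)
  show "(\<lambda>n. L2norm lborel (\<lambda>x. m x *\<^sub>R G n x + \<phi> n x *\<^sub>R dm x - (m x *\<^sub>R V x + u x *\<^sub>R dm x))) \<longlonglongrightarrow> 0"
    unfolding e
  proof (rule Lim_null_comparison)
    show "(\<lambda>n. C * (L2norm lborel (\<lambda>x. G n x - V x) + L2norm lborel (\<lambda>x. \<phi> n x - u x))) \<longlonglongrightarrow> 0"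
      using tendsto_mult_left[OF tendsto_add[OF l(2) l(1)]] by simp
    show "\<forall>\<^sub>F n in sequentially. norm (L2norm lborel (\<lambda>x. m x *\<^sub>R (G n x - V x) + (\<phi> n x - u x) *\<^sub>R dm x))
        \<le> C * (L2norm lborel (\<lambda>x. G n x - V x) + L2norm lborel (\<lambda>x. \<phi> n x - u x))"
      using d(2) by simp
  qed
qed

lemma H01_weighted:
  assumes "H01 \<Omega> u V"
  shows "H01 \<Omega> (\<lambda>x. m x * u x) (\<lambda>x. m x *\<^sub>R V x + u x *\<^sub>R dm x)"
proof -
  from assms obtain \<phi> G where 1: "square_int lborel u" "square_int lborel V" and tp: "\<And>n. test_pair \<Omega> (\<phi> n) (G n)"
    and l: "(\<lambda>n. L2norm lborel (\<lambda>x. \<phi> n x - u x)) \<longlonglongrightarrow> 0" "(\<lambda>n. L2norm lborel (\<lambda>x. G n x - V x)) \<longlonglongrightarrow> 0"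
    unfolding H01_iff by blast
  show ?thesis
    unfolding H01_iff
    using square_int_weighted(1,2)[OF 1] weighted_tendsto[OF test_pair_square_int[OF tp] 1 l]
      test_pair_mult[OF tp deriv dm_cont]
    by (intro conjI exI[of _ "\<lambda>n x. m x * \<phi> n x"] exI[of _ "\<lambda>n x. m x *\<^sub>R G n x + \<phi> n x *\<^sub>R dm x"] allI) auto
qed

text \<open>All coefficients of the quadratic form are bounded, so it is continuous under
  convergence of functions and gradients, and nonnegativity passes from test pairs to their
  limits.\<close>

lemma weighted_form_nonneg_H01:
  assumes mt [measurable]: "mt \<in> borel_measurable borel" and mt_bound: "\<And>x. \<bar>mt x\<bar> \<le> C'"
    and tp_form: "\<And>\<phi> G. test_pair \<Omega> \<phi> G \<Longrightarrow>
      0 \<le> (\<integral>x. 2 * (G x \<bullet> (m x *\<^sub>R G x + \<phi> x *\<^sub>R dm x)) - mt x * (\<phi> x)\<^sup>2 \<partial>lborel)"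
    and H: "H01 \<Omega> u V"
  shows "0 \<le> 2 * L2inner lborel V (\<lambda>x. m x *\<^sub>R V x + u x *\<^sub>R dm x) - L2inner lborel u (\<lambda>x. mt x * u x)"
proof -
  from H obtain \<phi> G where 1: "square_int lborel u" "square_int lborel V" and tp: "\<And>n. test_pair \<Omega> (\<phi> n) (G n)"
    and l: "(\<lambda>n. L2norm lborel (\<lambda>x. \<phi> n x - u x)) \<longlonglongrightarrow> 0" "(\<lambda>n. L2norm lborel (\<lambda>x. G n x - V x)) \<longlonglongrightarrow> 0"
    unfolding H01_iff by blast
  note sq = test_pair_square_int[OF tp]
  have mts: "square_int lborel (\<lambda>x. mt x * v x)" "L2norm lborel (\<lambda>x. mt x * v x) \<le> C' * L2norm lborel v"
    if "square_int lborel v" for v :: "real \<times> real \<Rightarrow> real"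
    using square_int_bounded_mult[OF that, of mt C'] mt_bound by auto
  have ml: "(\<lambda>n. L2norm lborel (\<lambda>x. mt x * \<phi> n x - mt x * u x)) \<longlonglongrightarrow> 0"
  proof (rule Lim_null_comparison)
    show "(\<lambda>n. C' * L2norm lborel (\<lambda>x. \<phi> n x - u x)) \<longlonglongrightarrow> 0" using tendsto_mult_left[OF l(1)] by simp
  qed (use mts(2)[OF square_int_diff[OF sq(1) 1(1)]] in \<open>simp add: right_diff_distrib\<close>)
  have "(\<lambda>n. 2 * L2inner lborel (G n) (\<lambda>x. m x *\<^sub>R G n x + \<phi> n x *\<^sub>R dm x) - L2inner lborel (\<phi> n) (\<lambda>x. mt x * \<phi> n x))
    \<longlonglongrightarrow> 2 * L2inner lborel V (\<lambda>x. m x *\<^sub>R V x + u x *\<^sub>R dm x) - L2inner lborel u (\<lambda>x. mt x * u x)"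
    by (intro tendsto_intros L2inner_tendsto always_eventually allI sq 1 l ml mts
        square_int_weighted weighted_tendsto)
  then show ?thesis
  proof (rule LIMSEQ_le_const)
    have "0 \<le> 2 * L2inner lborel (G n) (\<lambda>x. m x *\<^sub>R G n x + \<phi> n x *\<^sub>R dm x) - L2inner lborel (\<phi> n) (\<lambda>x. mt x * \<phi> n x)" for n
    proof -
      have "integrable lborel (\<lambda>x. G n x \<bullet> (m x *\<^sub>R G n x + \<phi> n x *\<^sub>R dm x))"
        by (intro square_int_inner square_int_weighted sq)
      moreover have "integrable lborel (\<lambda>x. \<phi> n x * (mt x * \<phi> n x))"
        by (intro square_int_mult_integrable mts sq)
      ultimately show ?thesis
        using tp_form[OF tp[of n]]
        by (simp add: L2inner_def power2_eq_square mult_ac)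
    qed
    then show "\<exists>N. \<forall>n\<ge>N. 0 \<le> 2 * L2inner lborel (G n) (\<lambda>x. m x *\<^sub>R G n x + \<phi> n x *\<^sub>R dm x) - L2inner lborel (\<phi> n) (\<lambda>x. mt x * \<phi> n x)"
      by blast
  qed
qed

end

section \<open>Bounds and Taylor expansion of the regularised weight\<close>

lemma exp_neg_bounds:
  fixes y :: real
  assumes "0 \<le> y"
  shows "exp (-y) \<le> 1" "y * exp (-y) \<le> 1" "y\<^sup>2 * exp (-y) \<le> 2"
proof -
  have e: "1 + y + y\<^sup>2 / 2 \<le> exp y" using exp_lower_Taylor_quadratic[OF assms] .
  have y: "1 + y \<le> exp y" by (rule exp_ge_add_one_self)
  show "exp (-y) \<le> 1" using assms by simp
  have "y \<le> exp y" using y by linarith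
  then show "y * exp (-y) \<le> 1" by (simp add: exp_minus divide_simps)
  show "y\<^sup>2 * exp (-y) \<le> 2" using e assms by (simp add: exp_minus divide_simps)
qed

text \<open>The mean value inequality twice: \<open>G\<close> is Lipschitz with constant c, so
  \<open>F\<close> minus its tangent has derivative at most c * \<bar>t - s\<bar>. The factor one
  half of the sharp remainder is given away.\<close>

lemma quadratic_remainder_bound:
  fixes F G :: "real \<Rightarrow> real"
  assumes "\<And>t. t \<in> {b..} \<Longrightarrow> (F has_real_derivative G t) (at t)"
    and "\<And>t. t \<in> {b..} \<Longrightarrow> (G has_real_derivative H t) (at t)"
    and "\<And>t. t \<in> {b..} \<Longrightarrow> \<bar>H t\<bar> \<le> c" and st: "b \<le> s" "b \<le> t"
  shows "\<bar>F t - F s - (t - s) * G s\<bar> \<le> c * (t - s)\<^sup>2"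
proof -
  have G: "\<bar>G r - G s\<bar> \<le> c * \<bar>r - s\<bar>" if "r \<in> {b..}" for r
    using field_differentiable_bound[of "{b..}" G H c r s] assms(2,3) that st
    by (auto intro: has_field_derivative_at_within)
  have "norm ((\<lambda>r. F r - (r - s) * G s) t - (\<lambda>r. F r - (r - s) * G s) s) \<le> (c * \<bar>t - s\<bar>) * norm (t - s)"
  proof (rule field_differentiable_bound[of "closed_segment s t"])
    fix r assume r: "r \<in> closed_segment s t"
    then have rb: "r \<in> {b..}" using st by (auto simp: closed_segment_eq_real_ivl split: if_splits)
    have "((\<lambda>r. F r - (r - s) * G s) has_real_derivative (G r - G s)) (at r)"
      by (auto intro!: derivative_eq_intros assms(1)[OF rb])
    then show "((\<lambda>r. F r - (r - s) * G s) has_field_derivative (G r - G s)) (at r within closed_segment s t)"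
      by (rule has_field_derivative_at_within)
    have "c \<ge> 0" using assms(3)[OF rb] by linarith
    have "\<bar>G r - G s\<bar> \<le> c * \<bar>r - s\<bar>" by (rule G[OF rb])
    also have "\<dots> \<le> c * \<bar>t - s\<bar>"
      using r \<open>c \<ge> 0\<close> by (intro mult_left_mono) (auto simp: closed_segment_eq_real_ivl split: if_splits)
    finally show "norm (G r - G s) \<le> c * \<bar>t - s\<bar>" by simp
  qed auto
  moreover have "F t - (t - s) * G s - (F s - (s - s) * G s) = F t - F s - (t - s) * G s" by simp
  moreover have sq: "(t - s)\<^sup>2 = \<bar>t - s\<bar> * \<bar>t - s\<bar>" by (simp add: power2_eq_square)
  ultimately show ?thesis unfolding sq by (simp only: mult.assoc real_norm_def)
qed

lemma gauss_kernel_pos: "0 < T \<Longrightarrow> 0 < gauss_kernel \<nu> T q"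
  by (simp add: gauss_kernel_def)

lemma gauss_kernel_le:
  assumes "1 \<le> T" "0 \<le> \<nu>"
  shows "gauss_kernel \<nu> T q \<le> exp (- (q / (4 * T)))"
proof -
  have "T powr (- 1 - \<nu>) \<le> T powr 0" using assms by (intro powr_mono) auto
  then show ?thesis using assms by (simp add: gauss_kernel_def)
qed

lemma weight_bounds:
  assumes "0 < \<epsilon>" "1 \<le> T" "0 \<le> \<nu>"
  shows "0 \<le> weight \<nu> \<epsilon> T x" "\<bar>weight \<nu> \<epsilon> T x\<bar> \<le> 1 / \<epsilon>"
    "norm (weight_grad \<nu> \<epsilon> T x) \<le> 3 / \<epsilon>\<^sup>2" "\<bar>weight_dt \<nu> \<epsilon> T x\<bar> \<le> (2 + \<nu>) / \<epsilon>\<^sup>2"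
proof -
  define q where "q = (norm x)\<^sup>2"
  define K where "K = gauss_kernel \<nu> T q"
  \<comment> \<open>The Gaussian exponent. Since T is at least 1, K is at most exp (-y), which
    absorbs the polynomial growth in y, while the denominator is estimated below by \<epsilon>
    alone.\<close>
  define y where "y = q / (4 * T)"
  have y: "0 \<le> y" using assms by (simp add: y_def q_def)
  have K: "0 < K" "K \<le> exp (-y)" using gauss_kernel_pos[of T \<nu> q] gauss_kernel_le[OF assms(2,3), of q] assms
    by (auto simp: K_def y_def)
  note e = exp_neg_bounds[OF y]
  have k: "\<epsilon> \<le> \<epsilon> + K" using K by simp
  have k2: "\<epsilon>\<^sup>2 \<le> (\<epsilon> + K)\<^sup>2" using k assms by (intro power_mono) auto
  show "0 \<le> weight \<nu> \<epsilon> T x" "\<bar>weight \<nu> \<epsilon> T x\<bar> \<le> 1 / \<epsilon>"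
    unfolding weight_def q_def[symmetric] K_def[symmetric] using K assms by (auto intro!: divide_left_mono)
  have frac: "\<bar>a / (\<epsilon> + K)\<^sup>2\<bar> \<le> b / \<epsilon>\<^sup>2" if "\<bar>a\<bar> \<le> b" for a b
    using that k2 assms K by (auto simp: abs_divide intro!: frac_le)
  \<comment> \<open>The linear growth of the gradient becomes at most 1 + 2 * y; multiplied by exp
    (-y) this is at most 3, the constant in the claim.\<close>
  have "norm x / (2 * T) \<le> (1 + q) / (2 * T)"
  proof (rule divide_right_mono)
    show "norm x \<le> 1 + q" using zero_le_power2[of "norm x - 1/2"] by (simp add: q_def power2_eq_square algebra_simps)
  qed (use assms in auto)
  also have "\<dots> = 1 / (2 * T) + 2 * y" using assms by (simp add: y_def field_simps)
  also have "1 / (2 * T) \<le> 1" using assms by simp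
  finally have "K * (norm x / (2 * T)) \<le> exp (-y) * (1 + 2 * y)"
    using K assms by (intro mult_mono) auto
  also have "exp (-y) * (1 + 2 * y) = exp (-y) + 2 * (y * exp (-y))" by (simp add: algebra_simps)
  also have "\<dots> \<le> 3" using e by linarith
  finally have "\<bar>K * (norm x / (2 * T))\<bar> \<le> 3" using K assms by simp
  from frac[OF this] show "norm (weight_grad \<nu> \<epsilon> T x) \<le> 3 / \<epsilon>\<^sup>2"
    unfolding weight_grad_def q_def[symmetric] K_def[symmetric] using assms K
    by (simp add: abs_mult abs_divide mult_ac)
  have "\<bar>(1 + \<nu>) / T - q / (4 * T\<^sup>2)\<bar> = \<bar>((1 + \<nu>) - y) / T\<bar>"
    using assms by (simp add: y_def power2_eq_square diff_divide_distrib)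
  also have "\<dots> \<le> \<bar>(1 + \<nu>) - y\<bar>" using assms by (simp add: abs_divide divide_le_eq mult_le_cancel_left1 )
  also have "\<dots> \<le> (1 + \<nu>) + y" using y assms by auto
  finally have "K * \<bar>(1 + \<nu>) / T - q / (4 * T\<^sup>2)\<bar> \<le> exp (-y) * ((1 + \<nu>) + y)"
    using K assms by (intro mult_mono) auto
  also have "\<dots> \<le> 2 + \<nu>" using e(2) mult_left_mono[OF e(1), of "1 + \<nu>"] assms by (simp add: algebra_simps)
  finally have "\<bar>K * ((1 + \<nu>) / T - q / (4 * T\<^sup>2))\<bar> \<le> 2 + \<nu>" using K by (simp add: abs_mult)
  from frac[OF this] show "\<bar>weight_dt \<nu> \<epsilon> T x\<bar> \<le> (2 + \<nu>) / \<epsilon>\<^sup>2"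
    unfolding weight_dt_def q_def[symmetric] K_def[symmetric] .
qed

lemma weight_has_derivative:
  assumes "0 < \<epsilon>" "0 < T"
  shows "(weight \<nu> \<epsilon> T has_derivative (\<lambda>h. weight_grad \<nu> \<epsilon> T x \<bullet> h)) (at x)"
proof -
  define q where "q = (norm x)\<^sup>2"
  have dq: "((\<lambda>x :: real \<times> real. (norm x)\<^sup>2) has_derivative (\<lambda>h. 2 * (x \<bullet> h))) (at x)"
    unfolding power2_norm_eq_inner
    by (rule has_derivative_eq_rhs[OF has_derivative_inner[OF has_derivative_ident has_derivative_ident]])
       (simp add: fun_eq_iff inner_commute)
  have "((\<lambda>q. 1 / (\<epsilon> + gauss_kernel \<nu> T q)) has_real_derivative
      gauss_kernel \<nu> T q / (4 * T) / (\<epsilon> + gauss_kernel \<nu> T q)\<^sup>2) (at q)"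
    using less_imp_neq[OF add_pos_pos[OF assms(1) gauss_kernel_pos[OF assms(2), of \<nu> q]]] assms unfolding gauss_kernel_def
    by (auto intro!: derivative_eq_intros simp: power2_eq_square)
  then have d: "((\<lambda>q. 1 / (\<epsilon> + gauss_kernel \<nu> T q)) has_derivative
      (*) (gauss_kernel \<nu> T q / (4 * T) / (\<epsilon> + gauss_kernel \<nu> T q)\<^sup>2)) (at ((norm x)\<^sup>2))"
    by (simp add: has_field_derivative_def q_def)
  show ?thesis
    unfolding weight_def[abs_def] weight_grad_def
    by (rule has_derivative_eq_rhs[OF has_derivative_compose[OF dq d]]) (simp add: fun_eq_iff q_def mult_ac)
qed

lemma weight_continuous:
  assumes "0 < \<epsilon>" "0 < T"
  shows "continuous_on A (weight_grad \<nu> \<epsilon> T)" "continuous_on A (weight_dt \<nu> \<epsilon> T)"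
proof -
  have "\<epsilon> + gauss_kernel \<nu> T q \<noteq> 0" for q using gauss_kernel_pos[OF assms(2), of \<nu> q] assms(1) by linarith
  then show "continuous_on A (weight_grad \<nu> \<epsilon> T)" "continuous_on A (weight_dt \<nu> \<epsilon> T)"
    using assms unfolding weight_grad_def[abs_def] weight_dt_def[abs_def] gauss_kernel_def
    by (auto intro!: continuous_intros)
qed

text \<open>The second time derivative of the weight is bounded uniformly in x and in times from 1
  on, because powers of the squared norm are always multiplied by the Gaussian. Uniformity in x
  makes the remainder an L2 estimate after multiplication with the solution.\<close>

lemma weight_taylor:
  assumes "0 < \<epsilon>" "0 \<le> \<nu>"
  shows "\<exists>c\<ge>0. \<forall>S\<ge>1. \<forall>T\<ge>1. \<forall>x. \<bar>weight \<nu> \<epsilon> T x - weight \<nu> \<epsilon> S x - (T - S) * weight_dt \<nu> \<epsilon> S x\<bar> \<le> c * (T - S)\<^sup>2"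
proof -
  \<comment> \<open>\<open>c2\<close> bounds \<kappa> times \<gamma> below: expanding the square of
    (1 + \<nu>) + y and estimating exp (-y), y * exp (-y) and y^2 * exp (-y) by 1, 1 and 2 gives
    this sum.\<close>
  define c2 where "c2 = (1 + \<nu>)\<^sup>2 + 3 * (1 + \<nu>) + 4"
  define c where "c = c2 / \<epsilon>\<^sup>2 + 2 * (2 + \<nu>)\<^sup>2 / \<epsilon> ^ 3"
  have c2: "0 \<le> c2" using assms by (simp add: c2_def)
  have "0 \<le> c" using assms c2 by (simp add: c_def)
  moreover have "\<bar>weight \<nu> \<epsilon> T x - weight \<nu> \<epsilon> S x - (T - S) * weight_dt \<nu> \<epsilon> S x\<bar> \<le> c * (T - S)\<^sup>2"
    if "1 \<le> S" "1 \<le> T" for S T x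
  proof -
    define q where "q = (norm x)\<^sup>2"
    have q: "0 \<le> q" by (simp add: q_def)
    define \<kappa> where "\<kappa> t = gauss_kernel \<nu> t q" for t
    define \<beta> where "\<beta> t = (1 + \<nu>) / t - q / (4 * t\<^sup>2)" for t
    \<comment> \<open>\<beta> is minus the logarithmic time derivative of \<kappa>, and \<gamma> is
      \<beta> squared minus the derivative of \<beta>, so that \<kappa> times \<gamma> is the second
      derivative of \<kappa>.\<close>
    define \<gamma> where "\<gamma> t = (\<beta> t)\<^sup>2 + (1 + \<nu>) / t\<^sup>2 - q / (2 * t ^ 3)" for t
    have \<kappa>pos: "0 < \<kappa> t" if "1 \<le> t" for t using that by (simp add: \<kappa>_def gauss_kernel_pos)
    have d\<kappa>: "(\<kappa> has_real_derivative - (\<kappa> t * \<beta> t)) (at t)" if "1 \<le> t" for t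
    proof -
      have p: "((\<lambda>t. t powr (- 1 - \<nu>)) has_real_derivative (- 1 - \<nu>) * t powr (- 1 - \<nu> - 1)) (at t)"
        by (rule has_real_derivative_powr) (use that in simp)
      have e: "((\<lambda>t. exp (- (q / (4 * t)))) has_real_derivative exp (- (q / (4 * t))) * (q / (4 * t\<^sup>2))) (at t)"
        using that by (auto intro!: derivative_eq_intros simp: power2_eq_square field_simps)
      have "t powr (- 1 - \<nu> - 1) = t powr (- 1 - \<nu>) / t"
        by (subst powr_diff) (use that in simp)
      then show ?thesis
        unfolding \<kappa>_def gauss_kernel_def \<beta>_def
        by (intro DERIV_cong[OF DERIV_mult[OF p e]]) (simp add: algebra_simps add_divide_distrib diff_divide_distrib)
    qed
    have d\<beta>: "(\<beta> has_real_derivative - ((1 + \<nu>) / t\<^sup>2 - q / (2 * t ^ 3))) (at t)" if "1 \<le> t" for t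
      unfolding \<beta>_def using that
      by (auto intro!: derivative_eq_intros simp: power2_eq_square power3_eq_cube field_simps)
    define F G H where "F t = 1 / (\<epsilon> + \<kappa> t)" and "G t = \<kappa> t * \<beta> t / (\<epsilon> + \<kappa> t)\<^sup>2"
      and "H t = - (\<kappa> t * \<gamma> t) / (\<epsilon> + \<kappa> t)\<^sup>2 + 2 * (\<kappa> t * \<beta> t)\<^sup>2 / (\<epsilon> + \<kappa> t) ^ 3" for t
    have dF: "(F has_real_derivative G t) (at t)" if "1 \<le> t" for t
      unfolding F_def G_def using \<kappa>pos[OF that] assms
      by (auto intro!: derivative_eq_intros d\<kappa>[OF that] simp: power2_eq_square)
    have dG: "(G has_real_derivative H t) (at t)" if "1 \<le> t" for t
    proof -
      define k where "k = \<epsilon> + \<kappa> t"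
      have k: "k > 0" using \<kappa>pos[OF that] assms by (simp add: k_def)
      have n: "((\<lambda>t. \<kappa> t * \<beta> t) has_real_derivative - (\<kappa> t * \<gamma> t)) (at t)"
        by (rule DERIV_cong[OF DERIV_mult[OF d\<kappa>[OF that] d\<beta>[OF that]]]) (simp add: \<gamma>_def power2_eq_square algebra_simps)
      have d: "((\<lambda>t. (\<epsilon> + \<kappa> t)\<^sup>2) has_real_derivative 2 * k * (- (\<kappa> t * \<beta> t))) (at t)"
        by (auto intro!: derivative_eq_intros d\<kappa>[OF that] simp: k_def)
      have "((\<lambda>t. \<kappa> t * \<beta> t / (\<epsilon> + \<kappa> t)\<^sup>2) has_real_derivative
          (- (\<kappa> t * \<gamma> t) * (\<epsilon> + \<kappa> t)\<^sup>2 - \<kappa> t * \<beta> t * (2 * k * (- (\<kappa> t * \<beta> t)))) / ((\<epsilon> + \<kappa> t)\<^sup>2 * (\<epsilon> + \<kappa> t)\<^sup>2)) (at t)"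
        by (rule DERIV_divide[OF n d]) (use k in \<open>simp add: k_def\<close>)
      also have "(- (\<kappa> t * \<gamma> t) * (\<epsilon> + \<kappa> t)\<^sup>2 - \<kappa> t * \<beta> t * (2 * k * (- (\<kappa> t * \<beta> t)))) / ((\<epsilon> + \<kappa> t)\<^sup>2 * (\<epsilon> + \<kappa> t)\<^sup>2) = H t"
        unfolding H_def k_def[symmetric] using k by (simp add: divide_simps power2_eq_square power3_eq_cube, simp add: algebra_simps)
      finally show ?thesis unfolding G_def .
    qed
    have bH: "\<bar>H t\<bar> \<le> c" if t: "1 \<le> t" for t
    proof -
      define y where "y = q / (4 * t)"
      have y: "0 \<le> y" using q t by (simp add: y_def)
      note e = exp_neg_bounds[OF y]
      have \<kappa>: "0 < \<kappa> t" "\<kappa> t \<le> exp (-y)" using \<kappa>pos[OF t] gauss_kernel_le[OF t assms(2), of q] by (auto simp: \<kappa>_def y_def)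
      have \<beta>: "\<bar>\<beta> t\<bar> \<le> (1 + \<nu>) + y"
      proof -
        have "\<beta> t = ((1 + \<nu>) - y) / t" using t by (simp add: \<beta>_def y_def power2_eq_square diff_divide_distrib)
        also have "\<bar>\<dots>\<bar> \<le> \<bar>(1 + \<nu>) - y\<bar>" using t by (simp add: abs_divide divide_le_eq mult_le_cancel_left1)
        also have "\<dots> \<le> (1 + \<nu>) + y" using y assms by auto
        finally show ?thesis .
      qed
      have \<gamma>: "\<bar>\<gamma> t\<bar> \<le> ((1 + \<nu>) + y)\<^sup>2 + (1 + \<nu>) + 2 * y"
      proof -
        have lin: "\<bar>A + B - D\<bar> \<le> A' + B' + D'" if "0 \<le> A" "A \<le> A'" "0 \<le> B" "B \<le> B'" "0 \<le> D" "D \<le> D'" for A A' B B' D D' :: real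
          using that by auto
        have b1: "(\<beta> t)\<^sup>2 \<le> ((1 + \<nu>) + y)\<^sup>2" using \<beta> y assms by (intro abs_le_square_iff[THEN iffD1]) auto
        have "(1 + \<nu>) / t\<^sup>2 \<le> (1 + \<nu>) / 1" using t assms by (intro divide_left_mono) auto
        then have b2: "(1 + \<nu>) / t\<^sup>2 \<le> 1 + \<nu>" by simp
        have b3: "0 \<le> (1 + \<nu>) / t\<^sup>2" using assms by simp
        have b4: "q / (2 * t ^ 3) \<le> 2 * y"
        proof -
          have "q / (2 * t ^ 3) = 2 * y / t\<^sup>2" using t by (simp add: y_def power2_eq_square power3_eq_cube)
          also have "\<dots> \<le> 2 * y / 1" using t y by (intro divide_left_mono) auto
          finally show ?thesis by simp
        qed
        have b5: "0 \<le> q / (2 * t ^ 3)" using q t by simp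
        show ?thesis unfolding \<gamma>_def by (rule lin[OF zero_le_power2 b1 b3 b2 b5 b4])
      qed
      have "\<bar>\<kappa> t * \<beta> t\<bar> = \<kappa> t * \<bar>\<beta> t\<bar>" using \<kappa> by (simp add: abs_mult)
      also have "\<dots> \<le> exp (-y) * ((1 + \<nu>) + y)" using \<kappa> \<beta> by (intro mult_mono) auto
      also have "\<dots> \<le> 2 + \<nu>" using e(2) mult_left_mono[OF e(1), of "1 + \<nu>"] assms by (simp add: algebra_simps)
      finally have kb: "\<bar>\<kappa> t * \<beta> t\<bar> \<le> 2 + \<nu>" .
      have "\<bar>\<kappa> t * \<gamma> t\<bar> = \<kappa> t * \<bar>\<gamma> t\<bar>" using \<kappa> by (simp add: abs_mult)
      also have "\<dots> \<le> exp (-y) * (((1 + \<nu>) + y)\<^sup>2 + (1 + \<nu>) + 2 * y)" using \<kappa> \<gamma> by (intro mult_mono) auto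
      also have "\<dots> = ((1 + \<nu>)\<^sup>2 + (1 + \<nu>)) * exp (-y) + (2 * (1 + \<nu>) + 2) * (y * exp (-y)) + y\<^sup>2 * exp (-y)"
        by (simp add: power2_eq_square algebra_simps)
      also have "\<dots> \<le> ((1 + \<nu>)\<^sup>2 + (1 + \<nu>)) * 1 + (2 * (1 + \<nu>) + 2) * 1 + 2"
        using assms by (intro add_mono mult_left_mono e) auto
      also have "\<dots> = c2" by (simp add: c2_def)
      finally have kg: "\<bar>\<kappa> t * \<gamma> t\<bar> \<le> c2" .
      have "\<bar>\<kappa> t * \<gamma> t\<bar> / (\<epsilon> + \<kappa> t)\<^sup>2 \<le> c2 / \<epsilon>\<^sup>2"
        by (rule frac_le) (use kg \<kappa> assms in \<open>auto intro!: power_mono\<close>)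
      moreover have "2 * (\<kappa> t * \<beta> t)\<^sup>2 / (\<epsilon> + \<kappa> t) ^ 3 \<le> 2 * (2 + \<nu>)\<^sup>2 / \<epsilon> ^ 3"
      proof (rule frac_le)
        show "2 * (\<kappa> t * \<beta> t)\<^sup>2 \<le> 2 * (2 + \<nu>)\<^sup>2"
          using kb assms by (auto intro!: abs_le_square_iff[THEN iffD1])
      qed (use \<kappa> assms in \<open>auto intro!: power_mono\<close>)
      moreover have "\<bar>H t\<bar> \<le> \<bar>\<kappa> t * \<gamma> t\<bar> / (\<epsilon> + \<kappa> t)\<^sup>2 + 2 * (\<kappa> t * \<beta> t)\<^sup>2 / (\<epsilon> + \<kappa> t) ^ 3"
      proof -
        have "\<bar>2 * (\<kappa> t * \<beta> t)\<^sup>2 / (\<epsilon> + \<kappa> t) ^ 3\<bar> = 2 * (\<kappa> t * \<beta> t)\<^sup>2 / (\<epsilon> + \<kappa> t) ^ 3"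
          using \<kappa> assms by (intro abs_of_nonneg) auto
        moreover have "\<bar>- (\<kappa> t * \<gamma> t) / (\<epsilon> + \<kappa> t)\<^sup>2\<bar> = \<bar>\<kappa> t * \<gamma> t\<bar> / (\<epsilon> + \<kappa> t)\<^sup>2"
          by (simp add: abs_divide)
        ultimately show ?thesis unfolding H_def using abs_triangle_ineq by metis
      qed
      ultimately show ?thesis unfolding c_def by linarith
    qed
    have "\<bar>F T - F S - (T - S) * G S\<bar> \<le> c * (T - S)\<^sup>2"
      by (rule quadratic_remainder_bound[where b=1 and H=H]) (use dF dG bH that in auto)
    then show ?thesis
      by (simp add: F_def G_def \<kappa>_def \<beta>_def weight_def weight_dt_def q_def)
  qed
  ultimately show ?thesis by blast
qed

lemma bounded_weight_weight:
  assumes "0 < \<epsilon>" "1 \<le> T" "0 \<le> \<nu>"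
  shows "bounded_weight (weight \<nu> \<epsilon> T) (weight_grad \<nu> \<epsilon> T) (1 / \<epsilon> + 3 / \<epsilon>\<^sup>2)"
proof
  show "\<bar>weight \<nu> \<epsilon> T x\<bar> \<le> 1 / \<epsilon> + 3 / \<epsilon>\<^sup>2" for x
    using weight_bounds(2)[OF assms, of x] assms by (simp add: add_increasing2)
  show "norm (weight_grad \<nu> \<epsilon> T x) \<le> 1 / \<epsilon> + 3 / \<epsilon>\<^sup>2" for x
    using weight_bounds(3)[OF assms, of x] assms by (simp add: add_increasing)
qed (use assms weight_has_derivative weight_continuous in auto)

section \<open>Energy monotonicity for weak solutions\<close>

locale heat_solution =
  fixes \<Omega> :: "(real \<times> real) set" and u0 U W
  assumes sol: "dirichlet_heat_solution \<Omega> u0 U W" and init: "L2_on \<Omega> u0"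
begin

lemma U_0: "U 0 = u0"
  using sol by (simp add: dirichlet_heat_solution_def)

lemma UW_H01: "0 < t \<Longrightarrow> H01 \<Omega> (U t) (W t)"
  using sol by (simp add: dirichlet_heat_solution_def)

lemma U_square_int: "0 \<le> t \<Longrightarrow> square_int lborel (U t)"
proof (cases "t = 0")
  case True
  have "square_int lborel u0"
    using init by (subst square_int_iff_nn_integral) (auto simp: L2_on_def)
  then show ?thesis by (simp add: True U_0)
next
  case False
  assume "0 \<le> t"
  with False show ?thesis using H01_square_int(1)[OF UW_H01, of t] by simp
qed

lemma W_square_int: "0 < t \<Longrightarrow> square_int lborel (W t)"
  using H01_square_int(2)[OF UW_H01] .

lemma W_measurable: "(\<lambda>q. W (fst q) (snd q)) \<in> borel_measurable (lborel \<Otimes>\<^sub>M lborel)"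
  using sol by (simp add: dirichlet_heat_solution_def case_prod_unfold)

lemma W_measurable1 [measurable]: "(\<lambda>x. W t x) \<in> borel_measurable lborel"
  using measurable_compose[OF _ W_measurable, of "\<lambda>x. (t, x)" lborel] by simp

lemma U_tendsto:
  assumes "0 \<le> t0"
  shows "((\<lambda>t. L2norm lborel (\<lambda>x. U t x - U t0 x)) \<longlongrightarrow> 0) (at t0 within {0..})"
proof (rule L2norm_tendsto_0I(2))
  show "((\<lambda>t. \<integral>\<^sup>+x. ennreal ((norm (U t x - U t0 x))\<^sup>2) \<partial>lborel) \<longlongrightarrow> 0) (at t0 within {0..})"
    using sol assms by (simp add: dirichlet_heat_solution_def)
  have "\<forall>\<^sub>F t in at t0 within {0..}. t \<in> {0..}" by (simp add: eventually_at_filter)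
  then show "\<forall>\<^sub>F t in at t0 within {0..}. (\<lambda>x. U t x - U t0 x) \<in> borel_measurable lborel"
    by eventually_elim (use square_int_measurable[OF square_int_diff[OF U_square_int U_square_int[OF assms]]] in auto)
qed

lemma U_tendsto_compose:
  assumes "((\<lambda>n. \<tau> n) \<longlongrightarrow> t0) F" "\<forall>\<^sub>F n in F. 0 \<le> \<tau> n" "0 \<le> t0"
  shows "((\<lambda>n. L2norm lborel (\<lambda>x. U (\<tau> n) x - U t0 x)) \<longlongrightarrow> 0) F"
proof -
  have z: "L2norm lborel (\<lambda>x. U t0 x - U t0 x) = 0" by (simp add: L2norm_def)
  have "continuous (at t0 within {0..}) (\<lambda>t. L2norm lborel (\<lambda>x. U t x - U t0 x))"
    unfolding continuous_within z by (rule U_tendsto[OF assms(3)])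
  from continuous_within_tendsto_compose[OF this, of \<tau> F] assms(1,2) show ?thesis
    unfolding z by simp
qed

lemma W_norm_measurable [measurable]: "(\<lambda>t. L2norm lborel (W t)) \<in> borel_measurable borel"
proof -
  have "(\<lambda>t. \<integral>x. (norm (W t x))\<^sup>2 \<partial>lborel) \<in> borel_measurable lborel"
    by (rule lborel.borel_measurable_lebesgue_integral) (use W_measurable in \<open>simp add: case_prod_unfold\<close>)
  then show ?thesis unfolding L2norm_def by simp
qed

lemma W_norm_square_integrable: "set_integrable lborel {0<..b} (\<lambda>t. (L2norm lborel (W t))\<^sup>2)"
proof (cases "0 < b")
  case True
  have "(\<integral>\<^sup>+t. ennreal (norm (indicator {0<..b} t *\<^sub>R (L2norm lborel (W t))\<^sup>2)) \<partial>lborel)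
      = (\<integral>\<^sup>+t. indicator {0<..b} t * (\<integral>\<^sup>+x. ennreal ((norm (W t x))\<^sup>2) \<partial>lborel) \<partial>lborel)"
  proof (rule nn_integral_cong)
    fix t
    show "ennreal (norm (indicator {0<..b} t *\<^sub>R (L2norm lborel (W t))\<^sup>2)) = indicator {0<..b} t * (\<integral>\<^sup>+x. ennreal ((norm (W t x))\<^sup>2) \<partial>lborel)"
      using nn_integral_eq_L2norm[OF W_square_int, of t] by (cases "t \<in> {0<..b}") auto
  qed
  also have "\<dots> < \<infinity>" using sol True by (simp add: dirichlet_heat_solution_def)
  finally show ?thesis
    unfolding set_integrable_def by (intro integrableI_bounded) auto
qed (auto simp: set_integrable_def)

lemma W_norm_integrable: "set_integrable lborel {0<..b} (\<lambda>t. L2norm lborel (W t))"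
  unfolding set_integrable_def
proof (rule Bochner_Integration.integrable_bound)
  have "integrable lborel (\<lambda>t. indicator {0<..b} t *\<^sub>R (1::real))"
    by (cases "0 \<le> b") (auto simp: integrable_indicator_iff)
  then show "integrable lborel (\<lambda>t. indicator {0<..b} t *\<^sub>R (1::real) + indicator {0<..b} t *\<^sub>R (L2norm lborel (W t))\<^sup>2)"
    using W_norm_square_integrable[of b] unfolding set_integrable_def by (rule Bochner_Integration.integrable_add)
  have "w \<le> 1 + w\<^sup>2" for w :: real
    using zero_le_power2[of "w - 1/2"] by (auto simp: power2_eq_square algebra_simps)
  then show "AE t in lborel. norm (indicator {0<..b} t *\<^sub>R L2norm lborel (W t)) \<le>
      norm (indicator {0<..b} t *\<^sub>R (1::real) + indicator {0<..b} t *\<^sub>R (L2norm lborel (W t))\<^sup>2)"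
    by (auto simp: indicator_def intro!: AE_I2)
qed auto

lemma W_pairing:
  assumes V: "square_int lborel V"
  shows "(\<lambda>t. L2inner lborel (W t) V) \<in> borel_measurable borel"
    "set_integrable lborel {0<..b} (\<lambda>t. L2inner lborel (W t) V)"
proof -
  note [measurable] = square_int_measurable[OF V] W_measurable
  have "(\<lambda>t. \<integral>x. W t x \<bullet> V x \<partial>lborel) \<in> borel_measurable lborel"
    by (rule lborel.borel_measurable_lebesgue_integral) (simp add: case_prod_unfold)
  then show m: "(\<lambda>t. L2inner lborel (W t) V) \<in> borel_measurable borel"
    unfolding L2inner_def by simp
  have "integrable lborel (\<lambda>t. (indicator {0<..b} t *\<^sub>R L2norm lborel (W t)) * L2norm lborel V)"
    using W_norm_integrable[of b] unfolding set_integrable_def by (rule integrable_mult_left)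
  then show "set_integrable lborel {0<..b} (\<lambda>t. L2inner lborel (W t) V)"
    unfolding set_integrable_def
  proof (rule Bochner_Integration.integrable_bound)
    show "AE t in lborel. norm (indicator {0<..b} t *\<^sub>R L2inner lborel (W t) V) \<le>
        norm ((indicator {0<..b} t *\<^sub>R L2norm lborel (W t)) * L2norm lborel V)"
      using L2_Cauchy_Schwarz[OF W_square_int V] by (auto simp: indicator_def abs_mult)
  qed (use m in auto)
qed

text \<open>The difference of the weak formulation at the two times b and a.\<close>

lemma weak_form_test_pair:
  assumes tp: "test_pair \<Omega> \<phi> G" and ab: "0 < a" "a \<le> b"
  shows "L2inner lborel (U b) \<phi> - L2inner lborel (U a) \<phi> = - (LBINT t:{a..b}. L2inner lborel (W t) G)"
proof -
  let ?h = "\<lambda>t. L2inner lborel (W t) G"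
  note h = W_pairing[OF test_pair_square_int(2)[OF tp]]
  have w: "L2inner lborel (U t) \<phi> - L2inner lborel u0 \<phi> = - (LBINT s:{0..t}. ?h s)" if "0 < t" for t
    using sol tp that by (simp add: dirichlet_heat_solution_def L2inner_def)
  have bm: "set_borel_measurable lborel A ?h" if "A \<in> sets borel" for A
    using h(1) that by (simp add: set_borel_measurable_def)
  \<comment> \<open>The value of W at time 0 is not controlled, so the integrability facts concern
    half-open intervals; the missing end point is a null set.\<close>
  have closed: "(LBINT s:{c..t}. ?h s) = (LBINT s:{c<..t}. ?h s)" for c t
  proof (rule set_integral_cong_set)
    show "AE s in lborel. s \<in> {c<..t} \<longleftrightarrow> s \<in> {c..t}"
      using AE_lborel_singleton[of c] by eventually_elim auto
  qed (auto intro: bm)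
  have "{0<..b} = {0<..a} \<union> {a<..b}" using ab by auto
  then have "(LBINT s:{0<..b}. ?h s) = (LBINT s:{0<..a}. ?h s) + (LBINT s:{a<..b}. ?h s)"
    using set_integral_Un[of "{0<..a}" "{a<..b}" lborel ?h] set_integrable_subset[OF h(2)[of b], of "{0<..a}"]
      set_integrable_subset[OF h(2)[of b], of "{a<..b}"] ab by auto
  then show ?thesis
    using w[of a] w[of b] ab by (simp add: closed)
qed

text \<open>The energy argument tests the equation at one time with the weighted solution at another
  time, which lies only in \<open>H01\<close>. The extension passes to the limit in the test
  function, using that the norm of W is integrable over {a..b}.\<close>

lemma weak_form_H01:
  assumes H: "H01 \<Omega> \<eta> V" and ab: "0 < a" "a \<le> b"
  shows "L2inner lborel (U b) \<eta> - L2inner lborel (U a) \<eta> = - (LBINT t:{a..b}. L2inner lborel (W t) V)"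
proof -
  from H obtain \<phi> G where 1: "square_int lborel \<eta>" "square_int lborel V" and tp: "\<And>n. test_pair \<Omega> (\<phi> n) (G n)"
    and l: "(\<lambda>n. L2norm lborel (\<lambda>x. \<phi> n x - \<eta> x)) \<longlonglongrightarrow> 0" "(\<lambda>n. L2norm lborel (\<lambda>x. G n x - V x)) \<longlonglongrightarrow> 0"
    unfolding H01_iff by blast
  note sq = test_pair_square_int[OF tp]
  have sub: "{a..b} \<subseteq> {0<..b}" using ab by auto
  have z: "(\<lambda>n. L2norm lborel (\<lambda>x. U t x - U t x)) \<longlonglongrightarrow> 0" for t by (simp add: L2norm_def)
  have L: "(\<lambda>n. L2inner lborel (U b) (\<phi> n) - L2inner lborel (U a) (\<phi> n)) \<longlonglongrightarrow> L2inner lborel (U b) \<eta> - L2inner lborel (U a) \<eta>"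
    using ab by (intro tendsto_intros L2inner_tendsto always_eventually allI sq 1 l z U_square_int) auto
  have si: "set_integrable lborel {a..b} (\<lambda>t. L2inner lborel (W t) F)" if "square_int lborel F" for F
    by (rule set_integrable_subset[OF W_pairing(2)[OF that] _ sub]) simp
  have ni: "set_integrable lborel {a..b} (\<lambda>t. L2norm lborel (W t))"
    by (rule set_integrable_subset[OF W_norm_integrable _ sub]) simp
  have "(\<lambda>n. (LBINT t:{a..b}. L2inner lborel (W t) (G n)) - (LBINT t:{a..b}. L2inner lborel (W t) V)) \<longlonglongrightarrow> 0"
  proof (rule Lim_null_comparison)
    show "(\<lambda>n. L2norm lborel (\<lambda>x. G n x - V x) * (LBINT t:{a..b}. L2norm lborel (W t))) \<longlonglongrightarrow> 0"
      using tendsto_mult_right[OF l(2)] by simp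
    have "norm ((LBINT t:{a..b}. L2inner lborel (W t) (G n)) - (LBINT t:{a..b}. L2inner lborel (W t) V))
        \<le> L2norm lborel (\<lambda>x. G n x - V x) * (LBINT t:{a..b}. L2norm lborel (W t))" for n
    proof -
      note d = square_int_diff[OF sq(2)[of n] 1(2)]
      have "(LBINT t:{a..b}. L2inner lborel (W t) (G n)) - (LBINT t:{a..b}. L2inner lborel (W t) V)
          = (LBINT t:{a..b}. L2inner lborel (W t) (G n) - L2inner lborel (W t) V)"
        using set_integral_diff(2)[OF si[OF sq(2)] si[OF 1(2)]] by simp
      also have "\<dots> = (LBINT t:{a..b}. L2inner lborel (W t) (\<lambda>x. G n x - V x))"
        by (rule set_lebesgue_integral_cong) (use ab sq 1 in \<open>auto intro!: L2inner_diff_right[symmetric] W_square_int\<close>)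
      also have "norm \<dots> \<le> (LBINT t:{a..b}. norm (L2inner lborel (W t) (\<lambda>x. G n x - V x)))"
        by (rule set_integral_norm_bound[OF si[OF d]])
      also have "\<dots> \<le> (LBINT t:{a..b}. L2norm lborel (\<lambda>x. G n x - V x) * L2norm lborel (W t))"
      proof (rule set_integral_mono)
        fix t assume "t \<in> {a..b}"
        then have "0 < t" using ab by simp
        then show "norm (L2inner lborel (W t) (\<lambda>x. G n x - V x)) \<le> L2norm lborel (\<lambda>x. G n x - V x) * L2norm lborel (W t)"
          using L2_Cauchy_Schwarz[OF W_square_int d, of t] by (simp add: mult.commute)
      qed (use ni si[OF d] in \<open>auto intro: set_integrable_abs\<close>)
      finally show ?thesis by simp
    qed
    then show "\<forall>\<^sub>F n in sequentially. norm ((LBINT t:{a..b}. L2inner lborel (W t) (G n)) - (LBINT t:{a..b}. L2inner lborel (W t) V))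
        \<le> L2norm lborel (\<lambda>x. G n x - V x) * (LBINT t:{a..b}. L2norm lborel (W t))" by simp
  qed
  then have "(\<lambda>n. - (LBINT t:{a..b}. L2inner lborel (W t) (G n))) \<longlonglongrightarrow> - (LBINT t:{a..b}. L2inner lborel (W t) V)"
    by (intro tendsto_minus) (rule LIM_zero_cancel)
  then show ?thesis
    using L LIMSEQ_unique unfolding weak_form_test_pair[OF tp ab] by blast
qed

lemma U_form_continuous:
  assumes b [measurable]: "b \<in> borel_measurable borel" and bb: "\<And>x. \<bar>b x\<bar> \<le> C"
  shows "continuous_on ({0<..} \<times> {0<..}) (\<lambda>(s, t). L2inner lborel (U s) (\<lambda>x. b x * U t x))"
  unfolding continuous_on_def case_prod_unfold
proof safe
  fix s t :: real assume st: "0 < s" "0 < t"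
  let ?F = "at (s, t) within ({0<..} \<times> {0<..})"
  have ev: "\<forall>\<^sub>F p in ?F. 0 \<le> fst p \<and> 0 \<le> snd p" by (auto simp: eventually_at_filter intro!: always_eventually)
  have sb: "square_int lborel (\<lambda>x. b x * u x)" "L2norm lborel (\<lambda>x. b x * u x) \<le> C * L2norm lborel u"
    if "square_int lborel u" for u :: "real \<times> real \<Rightarrow> real"
    using square_int_bounded_mult[OF that, of b C] bb by auto
  have l1: "((\<lambda>p. L2norm lborel (\<lambda>x. U (fst p) x - U s x)) \<longlongrightarrow> 0) ?F"
    by (rule U_tendsto_compose) (use st ev in \<open>auto intro!: tendsto_eq_intros elim: eventually_mono\<close>)
  have l2: "((\<lambda>p. L2norm lborel (\<lambda>x. U (snd p) x - U t x)) \<longlongrightarrow> 0) ?F"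
    by (rule U_tendsto_compose) (use st ev in \<open>auto intro!: tendsto_eq_intros elim: eventually_mono\<close>)
  have l3: "((\<lambda>p. L2norm lborel (\<lambda>x. b x * U (snd p) x - b x * U t x)) \<longlongrightarrow> 0) ?F"
  proof (rule Lim_null_comparison)
    show "((\<lambda>p. C * L2norm lborel (\<lambda>x. U (snd p) x - U t x)) \<longlongrightarrow> 0) ?F" using tendsto_mult_left[OF l2] by simp
    show "\<forall>\<^sub>F p in ?F. norm (L2norm lborel (\<lambda>x. b x * U (snd p) x - b x * U t x)) \<le> C * L2norm lborel (\<lambda>x. U (snd p) x - U t x)"
      using ev
    proof eventually_elim
      case (elim p)
      show ?case using sb(2)[OF square_int_diff[OF U_square_int U_square_int], of "snd p" t] elim st
        by (simp add: right_diff_distrib)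
    qed
  qed
  show "((\<lambda>p. L2inner lborel (U (fst p)) (\<lambda>x. b x * U (snd p) x)) \<longlongrightarrow>
      L2inner lborel (U (fst (s, t))) (\<lambda>x. b x * U (snd (s, t)) x)) ?F"
    using st ev l1 l3
    by (intro L2inner_tendsto) (auto elim!: eventually_mono intro!: sb U_square_int)
qed

lemma U_norm_continuous: "continuous_on {0..} (\<lambda>t. L2norm lborel (U t))"
  unfolding continuous_on_def
proof
  fix t :: real assume t: "t \<in> {0..}"
  have "((\<lambda>s. L2norm lborel (U s) - L2norm lborel (U t)) \<longlongrightarrow> 0) (at t within {0..})"
  proof (rule Lim_null_comparison)
    show "((\<lambda>s. L2norm lborel (\<lambda>x. U s x - U t x)) \<longlongrightarrow> 0) (at t within {0..})" using U_tendsto t by simp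
    have "\<forall>\<^sub>F s in at t within {0..}. s \<in> {0..}" by (simp add: eventually_at_filter)
    then show "\<forall>\<^sub>F s in at t within {0..}. norm (L2norm lborel (U s) - L2norm lborel (U t)) \<le> L2norm lborel (\<lambda>x. U s x - U t x)"
      by eventually_elim (use L2norm_triangle_diff[OF U_square_int U_square_int] t in auto)
  qed
  then show "((\<lambda>t. L2norm lborel (U t)) \<longlongrightarrow> L2norm lborel (U t)) (at t within {0..})"
    by (rule LIM_zero_cancel)
qed

end

section \<open>Monotonicity of the weighted energy from the weak formulation\<close>

context heat_solution
begin

text \<open>Instance of \<open>energy_monotone\<close>, followed by the limit to time 0. By
  bilinearity the finite double sums of its kernel are the form in \<open>form\<close> evaluated at
  a sum of solutions at different times, hence nonnegative after extension to
  \<open>H01\<close>.\<close>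

lemma weighted_energy_le_init:
  fixes m mt :: "real \<Rightarrow> real \<times> real \<Rightarrow> real" and dm :: "real \<Rightarrow> real \<times> real \<Rightarrow> real \<times> real"
  assumes bw: "\<And>s. 0 \<le> s \<Longrightarrow> bounded_weight (m s) (dm s) C"
    and mt: "\<And>s. 0 \<le> s \<Longrightarrow> mt s \<in> borel_measurable borel" "\<And>s x. 0 \<le> s \<Longrightarrow> \<bar>mt s x\<bar> \<le> C"
    and taylor: "\<And>s s' x. 0 \<le> s \<Longrightarrow> 0 \<le> s' \<Longrightarrow> \<bar>m s' x - m s x - (s' - s) * mt s x\<bar> \<le> c * (s' - s)\<^sup>2"
    and form: "\<And>s \<phi> G. 0 \<le> s \<Longrightarrow> test_pair \<Omega> \<phi> G \<Longrightarrow>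
      0 \<le> (\<integral>x. 2 * (G x \<bullet> (m s x *\<^sub>R G x + \<phi> x *\<^sub>R dm s x)) - mt s x * (\<phi> x)\<^sup>2 \<partial>lborel)"
    and t: "0 \<le> t"
  shows "L2inner lborel (U t) (\<lambda>x. m t x * U t x) \<le> L2inner lborel (U 0) (\<lambda>x. m 0 x * U 0 x)"
proof -
  have C: "0 \<le> C" using bounded_weight.C_nonneg[OF bw] by blast
  have c: "0 \<le> c" using taylor[of 0 1 undefined] by simp
  have mm [measurable]: "m s \<in> borel_measurable borel" "dm s \<in> borel_measurable borel" if "0 \<le> s" for s
    using bounded_weight.m_measurable[OF bw[OF that]] bounded_weight.dm_measurable[OF bw[OF that]] by auto
  define f where "f s x y = L2inner lborel (U x) (\<lambda>z. m s z * U y z)" for s x y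
  define g where "g s x y = L2inner lborel (U x) (\<lambda>z. mt s z * U y z)" for s x y
  define D where "D s y z = m s z *\<^sub>R W y z + U y z *\<^sub>R dm s z" for s y z
  \<comment> \<open>The value 0 at nonpositive times makes \<open>B\<close> measurable on the whole
    plane, since nothing is known about U and W there.\<close>
  define B where "B s x y = (if 0 < x \<and> 0 < y then L2inner lborel (W x) (D s y) else 0)" for s x y
  \<comment> \<open>The sum of both norms is needed because the gradient \<open>D s y\<close> of the
    weighted solution involves W and U; it is square integrable in time away from 0.\<close>
  define w where "w x = indicator {0<..} x *\<^sub>R L2norm lborel (U x) + indicator {0<..} x *\<^sub>R L2norm lborel (W x)" for x
  \<comment> \<open>The Taylor constant c is split as sqrt c * sqrt c, so that the remainder takes
    the product form demanded by \<open>energy_monotone\<close>.\<close>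
  define N where "N x = sqrt c * L2norm lborel (U x)" for x
  have wU: "L2norm lborel (U x) \<le> w x" "L2norm lborel (W x) \<le> w x" if "0 < x" for x using that by (auto simp: w_def)
  have w0: "0 \<le> w x" for x by (simp add: w_def)
  have sqU: "square_int lborel (U x)" if "0 < x" for x using U_square_int that by simp
  have sqm: "square_int lborel (\<lambda>z. m s z * U y z)" "L2norm lborel (\<lambda>z. m s z * U y z) \<le> C * L2norm lborel (U y)" if "0 \<le> s" "0 \<le> y" for s y
    using square_int_bounded_mult[OF U_square_int[OF that(2)], of "m s" C] mm(1)[OF that(1)] bounded_weight.m_bound[OF bw[OF that(1)]] by auto
  have sqmt: "square_int lborel (\<lambda>z. mt s z * U y z)" "L2norm lborel (\<lambda>z. mt s z * U y z) \<le> C * L2norm lborel (U y)" if "0 \<le> s" "0 \<le> y" for s y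
    using square_int_bounded_mult[OF U_square_int[OF that(2)], of "mt s" C] mt[OF that(1)] by auto
  have sqD: "square_int lborel (D s y)" "L2norm lborel (D s y) \<le> C * (L2norm lborel (W y) + L2norm lborel (U y))"
    and HD: "H01 \<Omega> (\<lambda>z. m s z * U y z) (D s y)" if "0 \<le> s" "0 < y" for s y
    using bounded_weight.square_int_weighted(2,4)[OF bw[OF that(1)] sqU W_square_int, OF that(2) that(2)]
      bounded_weight.H01_weighted[OF bw[OF that(1)] UW_H01[OF that(2)]]
    unfolding D_def by auto
  have mono: "f r r r \<le> f s s s" if "0 < s" "s \<le> r" for r s
  proof (rule energy_monotone[where f=f and B=B and g=g and w=w and N=N and C=C])
    show "continuous_on ({0<..} \<times> {0<..}) (\<lambda>(x, y). f s x y)" if "0 < s" for s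
      unfolding f_def by (rule U_form_continuous[of _ C]) (use that bounded_weight.m_bound[OF bw] in auto)
    show "continuous_on ({0<..} \<times> {0<..}) (\<lambda>(x, y). g s x y)" if "0 < s" for s
      unfolding g_def by (rule U_form_continuous[of _ C]) (use that mt in auto)
    show "f s x y = f s y x" "g s x y = g s y x" for s x y
      by (simp_all add: f_def g_def L2inner_def mult_ac)
    show "continuous_on {0<..} N"
      unfolding N_def by (intro continuous_intros continuous_on_subset[OF U_norm_continuous]) auto
    show "\<bar>f s' x y - f s x y - (s' - s) * g s x y\<bar> \<le> (s' - s)\<^sup>2 * (N x * N y)"
      if "0 < s" "0 < s'" "0 < x" "0 < y" for s s' x y
    proof -
      let ?r = "\<lambda>z. m s' z - m s z - (s' - s) * mt s z"
      have r: "square_int lborel (\<lambda>z. ?r z * U y z)" "L2norm lborel (\<lambda>z. ?r z * U y z) \<le> (c * (s' - s)\<^sup>2) * L2norm lborel (U y)"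
        using square_int_bounded_mult[OF sqU[OF that(4)], of ?r "c * (s' - s)\<^sup>2"] taylor[of s s'] that mm[of s] mm[of s'] mt[of s] by auto
      have "f s' x y - f s x y - (s' - s) * g s x y = L2inner lborel (U x) (\<lambda>z. ?r z * U y z)"
      proof -
        have "U x z * (?r z * U y z) = U x z * (m s' z * U y z) - U x z * (m s z * U y z) - (s' - s) * (U x z * (mt s z * U y z))" for z
          by (simp add: algebra_simps)
        then show ?thesis
          using square_int_mult_integrable[OF sqU[OF that(3)] sqm(1)[of s y]] square_int_mult_integrable[OF sqU[OF that(3)] sqm(1)[of s' y]]
            square_int_mult_integrable[OF sqU[OF that(3)] sqmt(1)[of s y]] that
          unfolding f_def g_def L2inner_def inner_real_def by simp
      qed
      also have "\<bar>\<dots>\<bar> \<le> L2norm lborel (U x) * L2norm lborel (\<lambda>z. ?r z * U y z)"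
        by (rule L2_Cauchy_Schwarz[OF sqU[OF that(3)] r(1)])
      also have "\<dots> \<le> L2norm lborel (U x) * ((c * (s' - s)\<^sup>2) * L2norm lborel (U y))"
        by (rule mult_left_mono[OF r(2)]) simp
      also have "\<dots> = (s' - s)\<^sup>2 * ((sqrt c * sqrt c) * (L2norm lborel (U x) * L2norm lborel (U y)))"
        using c by simp
      also have "\<dots> = (s' - s)\<^sup>2 * (N x * N y)" unfolding N_def by (simp only: mult_ac)
      finally show ?thesis .
    qed
    show "f s b y - f s a y = - (LBINT x:{a..b}. B s x y)" if "0 < s" "0 < a" "a \<le> b" "0 < y" for s a b y
    proof -
      have "(LBINT x:{a..b}. B s x y) = (LBINT x:{a..b}. L2inner lborel (W x) (D s y))"
        by (rule set_lebesgue_integral_cong) (use that in \<open>auto simp: B_def\<close>)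
      then show ?thesis
        using weak_form_H01[OF HD that(2,3), of s y] that by (simp add: f_def)
    qed
    show "\<bar>B s x y\<bar> \<le> C * (w x * w y)" if "0 < s" "0 < x" "0 < y" for s x y
    proof -
      have "\<bar>B s x y\<bar> \<le> L2norm lborel (W x) * L2norm lborel (D s y)"
        using L2_Cauchy_Schwarz[OF W_square_int[OF that(2)] sqD(1)[of s y]] that by (simp add: B_def)
      also have "\<dots> \<le> w x * (C * w y)"
      proof (rule mult_mono)
        show "L2norm lborel (D s y) \<le> C * w y" using sqD(2)[of s y] that by (simp add: w_def add.commute)
      qed (use wU that w0 in auto)
      finally show ?thesis by (simp add: mult_ac)
    qed
    show "\<bar>g s x y\<bar> \<le> C * (w x * w y)" if "0 < s" "0 < x" "0 < y" for s x y
    proof -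
      have "\<bar>g s x y\<bar> \<le> L2norm lborel (U x) * L2norm lborel (\<lambda>z. mt s z * U y z)"
        using L2_Cauchy_Schwarz[OF sqU[OF that(2)] sqmt(1)[of s y]] that by (simp add: g_def)
      also have "\<dots> \<le> w x * (C * w y)"
      proof (rule mult_mono)
        show "L2norm lborel (\<lambda>z. mt s z * U y z) \<le> C * w y"
          using order_trans[OF sqmt(2)[of s y] mult_left_mono[OF wU(1) C]] that by simp
      qed (use wU that w0 in auto)
      finally show ?thesis by (simp add: mult_ac)
    qed
    show wm: "w \<in> borel_measurable borel"
    proof -
      have "(\<lambda>x. indicator {0<..} x *\<^sub>R L2norm lborel (U x)) \<in> borel_measurable borel"
        by (rule borel_measurable_continuous_on_indicator) (auto intro: continuous_on_subset[OF U_norm_continuous])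
      then show ?thesis unfolding w_def[abs_def] by simp
    qed
    show "set_integrable lborel {a..b} (\<lambda>x. (w x)\<^sup>2)" if "0 < a" for a b
    proof -
      have "set_integrable lborel {a..b} (\<lambda>x. (L2norm lborel (U x))\<^sup>2)"
        by (rule borel_integrable_atLeastAtMost') (use that in \<open>auto intro!: continuous_intros continuous_on_subset[OF U_norm_continuous]\<close>)
      moreover have "set_integrable lborel {a..b} (\<lambda>x. (L2norm lborel (W x))\<^sup>2)"
        by (rule set_integrable_subset[OF W_norm_square_integrable[of b]]) (use that in auto)
      ultimately have "integrable lborel (\<lambda>x. 2 * (indicator {a..b} x *\<^sub>R (L2norm lborel (U x))\<^sup>2) + 2 * (indicator {a..b} x *\<^sub>R (L2norm lborel (W x))\<^sup>2))"
        unfolding set_integrable_def by (intro Bochner_Integration.integrable_add integrable_mult_right)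
      then show ?thesis
        unfolding set_integrable_def
      proof (rule Bochner_Integration.integrable_bound)
        have "(p + q)\<^sup>2 \<le> 2 * p\<^sup>2 + 2 * q\<^sup>2" for p q :: real
          using sum_squares_bound[of p q] by (simp add: power2_sum)
        then show "AE x in lborel. norm (indicator {a..b} x *\<^sub>R (w x)\<^sup>2) \<le>
            norm (2 * (indicator {a..b} x *\<^sub>R (L2norm lborel (U x))\<^sup>2) + 2 * (indicator {a..b} x *\<^sub>R (L2norm lborel (W x))\<^sup>2))"
          using that by (intro AE_I2) (auto simp: indicator_def w_def)
      qed (use wm in auto)
    qed
    show "0 \<le> (\<Sum>i<n. \<Sum>j<n. 2 * B s (x i) (x j) - g s (x i) (x j))"
      if "0 < s" and x: "\<And>i. i < n \<Longrightarrow> 0 < x i" for s n and x :: "nat \<Rightarrow> real"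
    proof -
      \<comment> \<open>Evaluating the nonnegative form at this single function and expanding both
        slots gives the double sum of \<open>2 * B - g\<close>.\<close>
      define u where "u z = (\<Sum>i<n. U (x i) z)" for z
      define V where "V z = (\<Sum>i<n. W (x i) z)" for z
      have H: "H01 \<Omega> u V" unfolding u_def[abs_def] V_def[abs_def] by (rule H01_sum) (use UW_H01 x in auto)
      have "0 \<le> 2 * L2inner lborel V (\<lambda>z. m s z *\<^sub>R V z + u z *\<^sub>R dm s z) - L2inner lborel u (\<lambda>z. mt s z * u z)"
        by (rule bounded_weight.weighted_form_nonneg_H01[OF bw mt(1) mt(2) form H]) (use that in auto)
      also have "(\<lambda>z. m s z *\<^sub>R V z + u z *\<^sub>R dm s z) = (\<lambda>z. \<Sum>j<n. D s (x j) z)"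
        by (simp add: fun_eq_iff V_def u_def D_def sum.distrib scaleR_sum_right scaleR_sum_left)
      also have "(\<lambda>z. mt s z * u z) = (\<lambda>z. \<Sum>j<n. mt s z * U (x j) z)"
        by (simp add: fun_eq_iff u_def sum_distrib_left)
      also have "L2inner lborel V (\<lambda>z. \<Sum>j<n. D s (x j) z) = (\<Sum>i<n. \<Sum>j<n. B s (x i) (x j))"
        unfolding V_def[abs_def] using that
        by (subst L2inner_sum_sum) (auto intro!: W_square_int sqD sum.cong simp: B_def)
      also have "L2inner lborel u (\<lambda>z. \<Sum>j<n. mt s z * U (x j) z) = (\<Sum>i<n. \<Sum>j<n. g s (x i) (x j))"
        unfolding u_def[abs_def] using that
        by (subst L2inner_sum_sum) (auto intro!: sqU sqmt sum.cong simp: g_def less_imp_le)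
      finally show ?thesis by (simp add: sum_subtractf sum_distrib_left)
    qed
    show "(\<lambda>(x, y). B s x y) \<in> borel_measurable (lborel \<Otimes>\<^sub>M lborel)" if s: "0 < s" for s
    proof -
      note [measurable] = mm[OF less_imp_le[OF s]]
      define P where "P x y = (\<integral>z. m s z * (W x z \<bullet> W y z) \<partial>lborel)" for x y
      \<comment> \<open>The maximum with 0 keeps U at nonnegative times, where it is square
        integrable and continuous in L2. Together with \<open>P\<close> this splits \<open>B\<close>
        according to the two summands of \<open>D\<close>.\<close>
      define H where "H x y = L2inner lborel (\<lambda>z. W x z \<bullet> dm s z) (U (max 0 y))" for x y
      have Hm: "(\<lambda>x. H x y) \<in> borel_measurable borel" for y
      proof -
        note [measurable] = square_int_measurable[OF U_square_int, of "max 0 y"] W_measurable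
        have "(\<lambda>x. \<integral>z. (W x z \<bullet> dm s z) * U (max 0 y) z \<partial>lborel) \<in> borel_measurable lborel"
          by (rule lborel.borel_measurable_lebesgue_integral) (simp add: case_prod_unfold)
        then show ?thesis by (simp add: H_def L2inner_def)
      qed
      have Pm: "(\<lambda>p. P (fst p) (snd p)) \<in> borel_measurable (lborel \<Otimes>\<^sub>M lborel)"
      proof -
        have "(\<lambda>q :: (real \<times> real) \<times> (real \<times> real). (fst (fst q), snd q)) \<in> measurable ((lborel \<Otimes>\<^sub>M lborel) \<Otimes>\<^sub>M lborel) (lborel \<Otimes>\<^sub>M lborel)"
          by measurable
        from measurable_compose[OF this W_measurable]
        have 1: "(\<lambda>q :: (real \<times> real) \<times> (real \<times> real). W (fst (fst q)) (snd q)) \<in> borel_measurable ((lborel \<Otimes>\<^sub>M lborel) \<Otimes>\<^sub>M lborel)"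
          by simp
        have "(\<lambda>q :: (real \<times> real) \<times> (real \<times> real). (snd (fst q), snd q)) \<in> measurable ((lborel \<Otimes>\<^sub>M lborel) \<Otimes>\<^sub>M lborel) (lborel \<Otimes>\<^sub>M lborel)"
          by measurable
        from measurable_compose[OF this W_measurable]
        have 2: "(\<lambda>q :: (real \<times> real) \<times> (real \<times> real). W (snd (fst q)) (snd q)) \<in> borel_measurable ((lborel \<Otimes>\<^sub>M lborel) \<Otimes>\<^sub>M lborel)"
          by simp
        note [measurable] = 1 2
        show ?thesis
          unfolding P_def
          by (rule lborel.borel_measurable_lebesgue_integral) (simp add: case_prod_unfold)
      qed
      \<comment> \<open>\<open>U\<close> is not assumed jointly measurable, so time is discretised in the second argument,
        where \<open>H\<close> is continuous\<close>
      define Hn where "Hn n p = (if 0 < fst p \<and> 0 < snd p then H (fst p) (real_of_int \<lceil>real (Suc n) * snd p\<rceil> / real (Suc n)) else 0)"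
        for n :: nat and p :: "real \<times> real"
      have Hnm: "Hn n \<in> borel_measurable (lborel \<Otimes>\<^sub>M lborel)" for n
      proof -
        have 1: "(\<lambda>p. H (fst p) (real_of_int i / real (Suc n))) \<in> borel_measurable (lborel \<Otimes>\<^sub>M lborel)" for i
          by (rule measurable_compose[OF _ Hm]) simp
        have 2: "(\<lambda>p. \<lceil>real (Suc n) * snd p\<rceil>) \<in> measurable (lborel \<Otimes>\<^sub>M lborel) (count_space UNIV)"
          by measurable
        from measurable_compose_countable[where f="\<lambda>i p. H (fst p) (real_of_int i / real (Suc n))", OF 1 2]
        have [measurable]: "(\<lambda>p. H (fst p) (real_of_int \<lceil>real (Suc n) * snd p\<rceil> / real (Suc n))) \<in> borel_measurable (lborel \<Otimes>\<^sub>M lborel)" .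
        show ?thesis unfolding Hn_def[abs_def] by measurable
      qed
      define Hl where "Hl p = (if 0 < fst p \<and> 0 < snd p then H (fst p) (snd p) else 0)" for p
      have Hl: "Hl \<in> borel_measurable (lborel \<Otimes>\<^sub>M lborel)"
      proof (rule borel_measurable_LIMSEQ_metric[OF Hnm])
        fix p :: "real \<times> real"
        show "(\<lambda>n. Hn n p) \<longlonglongrightarrow> Hl p"
        proof (cases "0 < fst p \<and> 0 < snd p")
          case True
          have sW: "square_int lborel (\<lambda>z. W (fst p) z \<bullet> dm s z)"
          proof (rule square_int_dominated[OF W_square_int])
            show "norm (W (fst p) z \<bullet> dm s z) \<le> C * norm (W (fst p) z)" for z
              using Cauchy_Schwarz_ineq2[of "W (fst p) z" "dm s z"]
                mult_left_mono[OF bounded_weight.dm_bound[OF bw[OF less_imp_le[OF s]], of z], of "norm (W (fst p) z)"]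
              by (simp add: mult.commute)
          qed (use True in auto)
          have lim: "(\<lambda>n. real_of_int \<lceil>real (Suc n) * snd p\<rceil> / real (Suc n)) \<longlonglongrightarrow> snd p"
          proof (rule tendsto_sandwich[OF _ _ tendsto_const])
            show "\<forall>\<^sub>F n in sequentially. snd p \<le> real_of_int \<lceil>real (Suc n) * snd p\<rceil> / real (Suc n)"
            proof (intro always_eventually allI)
              fix n
              have "real (Suc n) * snd p \<le> real_of_int \<lceil>real (Suc n) * snd p\<rceil>" by (rule le_of_int_ceiling)
              then show "snd p \<le> real_of_int \<lceil>real (Suc n) * snd p\<rceil> / real (Suc n)"
                by (simp add: pos_le_divide_eq mult.commute del: of_nat_Suc)
            qed
            show "\<forall>\<^sub>F n in sequentially. real_of_int \<lceil>real (Suc n) * snd p\<rceil> / real (Suc n) \<le> snd p + inverse (real (Suc n))"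
            proof (intro always_eventually allI)
              fix n
              have "real_of_int \<lceil>real (Suc n) * snd p\<rceil> \<le> real (Suc n) * snd p + 1" by (rule of_int_ceiling_le_add_one)
              then have "real_of_int \<lceil>real (Suc n) * snd p\<rceil> / real (Suc n) \<le> (real (Suc n) * snd p + 1) / real (Suc n)"
                by (rule divide_right_mono) simp
              also have "\<dots> = snd p + inverse (real (Suc n))" by (simp add: add_divide_distrib inverse_eq_divide del: of_nat_Suc)
              finally show "real_of_int \<lceil>real (Suc n) * snd p\<rceil> / real (Suc n) \<le> snd p + inverse (real (Suc n))" .
            qed
            show "(\<lambda>n. snd p + inverse (real (Suc n))) \<longlonglongrightarrow> snd p"
              using tendsto_add[OF tendsto_const[of "snd p"] LIMSEQ_inverse_real_of_nat] by simp
          qed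
          have z: "(\<lambda>n. L2norm lborel (\<lambda>z. W (fst p) z \<bullet> dm s z - W (fst p) z \<bullet> dm s z)) \<longlonglongrightarrow> 0" by (simp add: L2norm_def)
          have lim': "(\<lambda>n. max 0 (real_of_int \<lceil>real (Suc n) * snd p\<rceil> / real (Suc n))) \<longlonglongrightarrow> max 0 (snd p)"
            by (intro tendsto_max tendsto_const lim)
          have "(\<lambda>n. H (fst p) (real_of_int \<lceil>real (Suc n) * snd p\<rceil> / real (Suc n))) \<longlonglongrightarrow> H (fst p) (snd p)"
            unfolding H_def
            by (rule L2inner_tendsto[OF always_eventually sW always_eventually U_square_int z U_tendsto_compose[OF lim']])
               (auto intro: sW U_square_int)
          then show ?thesis using True by (simp add: Hn_def Hl_def)
        qed (auto simp: Hn_def Hl_def)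
      qed
      have Bs: "B s x y = (if 0 < x \<and> 0 < y then P x y else 0) + Hl (x, y)" for x y
      proof (cases "0 < x \<and> 0 < y")
        case True
        have sq: "square_int lborel (\<lambda>z. m s z *\<^sub>R W y z)" "square_int lborel (\<lambda>z. U y z *\<^sub>R dm s z)"
          using True s square_int_bounded_mult(1)[OF W_square_int[of y], of "m s" C] bounded_weight.m_bound[OF bw[of s]]
            square_int_bounded_vec(1)[OF sqU[of y], of "dm s" C] bounded_weight.dm_bound[OF bw[of s]]
          by auto
        have i: "integrable lborel (\<lambda>z. W x z \<bullet> (m s z *\<^sub>R W y z))" "integrable lborel (\<lambda>z. W x z \<bullet> (U y z *\<^sub>R dm s z))"
          using True square_int_inner[OF W_square_int sq(1), of x] square_int_inner[OF W_square_int sq(2), of x] by auto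
        then show ?thesis
          using True
          by (simp add: B_def D_def Hl_def H_def P_def L2inner_def inner_add_right max_def mult_ac)
      qed (auto simp: B_def Hl_def)
      note [measurable] = Pm Hl
      have "(\<lambda>p. (if 0 < fst p \<and> 0 < snd p then P (fst p) (snd p) else 0) + Hl p) \<in> borel_measurable (lborel \<Otimes>\<^sub>M lborel)"
        by measurable
      then show ?thesis by (simp add: Bs case_prod_unfold)
    qed
  qed (use that C w0 in auto)
  \<comment> \<open>So far only positive times are compared, because the solution need not lie in
    \<open>H01\<close> at time 0. The initial energy is reached by L2 continuity of U and by
    continuity of the weight in time.\<close>
  show ?thesis
  proof (cases "t = 0")
    case False
    with t have t: "0 < t" by simp
    have ev: "\<forall>\<^sub>F s in at_right 0. 0 < s \<and> s < t" using eventually_at_right_real[OF t] by (auto elim: eventually_mono)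
    have id: "((\<lambda>s::real. s) \<longlongrightarrow> 0) (at_right 0)" by (rule tendsto_ident_at)
    have l1: "((\<lambda>s. L2norm lborel (\<lambda>x. U s x - U 0 x)) \<longlongrightarrow> 0) (at_right 0)"
      by (rule U_tendsto_compose[OF id]) (use ev in \<open>auto elim: eventually_mono\<close>)
    have l2: "((\<lambda>s. L2norm lborel (\<lambda>x. m s x * U s x - m 0 x * U 0 x)) \<longlongrightarrow> 0) (at_right 0)"
    proof (rule Lim_null_comparison)
      show "((\<lambda>s. C * L2norm lborel (\<lambda>x. U s x - U 0 x) + (s * C + c * s\<^sup>2) * L2norm lborel (U 0)) \<longlongrightarrow> 0) (at_right 0)"
        by (auto intro!: tendsto_eq_intros l1 id)
      show "\<forall>\<^sub>F s in at_right 0. norm (L2norm lborel (\<lambda>x. m s x * U s x - m 0 x * U 0 x))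
          \<le> C * L2norm lborel (\<lambda>x. U s x - U 0 x) + (s * C + c * s\<^sup>2) * L2norm lborel (U 0)"
        using ev
      proof eventually_elim
        case (elim s)
        have s: "0 \<le> s" using elim by simp
        note d = square_int_diff[OF U_square_int[OF s] U_square_int[of 0]]
        \<comment> \<open>The Taylor estimate at time 0 makes the convergence of the weights uniform
          in x.\<close>
        have "\<bar>m s x - m 0 x\<bar> \<le> s * C + c * s\<^sup>2" for x
        proof -
          have "\<bar>s * mt 0 x\<bar> \<le> s * C" using mt(2)[of 0 x] s by (simp add: abs_mult mult_left_mono)
          then show ?thesis using taylor[of 0 s x] s by (simp add: abs_le_iff)
        qed
        then have 2: "square_int lborel (\<lambda>x. (m s x - m 0 x) * U 0 x)"
          "L2norm lborel (\<lambda>x. (m s x - m 0 x) * U 0 x) \<le> (s * C + c * s\<^sup>2) * L2norm lborel (U 0)"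
          using square_int_bounded_mult[OF U_square_int[of 0], of "\<lambda>x. m s x - m 0 x"] mm(1)[OF s] mm(1)[of 0] by auto
        have 1: "square_int lborel (\<lambda>x. m s x * (U s x - U 0 x))"
          "L2norm lborel (\<lambda>x. m s x * (U s x - U 0 x)) \<le> C * L2norm lborel (\<lambda>x. U s x - U 0 x)"
          using square_int_bounded_mult[OF d, of "m s" C] mm(1)[OF s] bounded_weight.m_bound[OF bw[OF s]] by auto
        have "(\<lambda>x. m s x * U s x - m 0 x * U 0 x) = (\<lambda>x. m s x * (U s x - U 0 x) + (m s x - m 0 x) * U 0 x)"
          by (simp add: algebra_simps)
        then show ?case using L2norm_triangle[OF 1(1) 2(1)] 1(2) 2(2) by simp
      qed
    qed
    have "((\<lambda>s. f s s s) \<longlongrightarrow> f 0 0 0) (at_right 0)"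
      unfolding f_def using ev
      by (intro L2inner_tendsto l1 l2) (auto elim!: eventually_mono intro!: U_square_int sqm)
    moreover have "\<forall>\<^sub>F s in at_right 0. f t t t \<le> f s s s"
      using ev by eventually_elim (use mono in auto)
    ultimately have "f t t t \<le> f 0 0 0"
      by (rule tendsto_lowerbound) simp
    then show ?thesis by (simp add: f_def)
  qed simp
qed

end

section \<open>The decay estimate on the curved wedge\<close>

lemma wedge_heat_bound:
  assumes a: "0 < a" "a \<le> 1" and \<theta>: "\<And>r. 0 < r \<Longrightarrow> (\<theta> has_real_derivative \<theta>' r) (at r)"
    and \<theta>'_cont: "continuous_on {0<..} \<theta>'"
    and sol: "heat_solution (curved_wedge \<theta> a) u0 U W" and t: "0 \<le> t" and \<epsilon>: "0 < \<epsilon>"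
  shows "(\<integral>\<^sup>+x. ennreal ((U t x)\<^sup>2) \<partial>lborel) \<le> ennreal (\<epsilon> + (1 + t) powr (- 1 - 1 / (2 * a))) *
      (\<integral>\<^sup>+x. ennreal ((u0 x)\<^sup>2 * exp ((norm x)\<^sup>2 / 4)) \<partial>lborel)"
proof -
  interpret heat_solution "curved_wedge \<theta> a" u0 U W by fact
  define \<nu> where "\<nu> = 1 / (2 * a)"
  have \<nu>: "0 \<le> \<nu>" using a by (simp add: \<nu>_def)
  define m where "m s = weight \<nu> \<epsilon> (1 + s)" for s
  define p where "p = \<epsilon> + (1 + t) powr (- 1 - \<nu>)"
  have p: "0 < p" using \<epsilon> by (simp add: p_def add_pos_nonneg)
  obtain c where c: "\<And>S T x. 1 \<le> S \<Longrightarrow> 1 \<le> T \<Longrightarrow>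
      \<bar>weight \<nu> \<epsilon> T x - weight \<nu> \<epsilon> S x - (T - S) * weight_dt \<nu> \<epsilon> S x\<bar> \<le> c * (T - S)\<^sup>2"
    using weight_taylor[OF \<epsilon> \<nu>] by blast
  \<comment> \<open>One constant that dominates the weight and its gradient as well as the time
    derivative of the weight.\<close>
  define C where "C = 1 / \<epsilon> + 3 / \<epsilon>\<^sup>2 + (2 + \<nu>) / \<epsilon>\<^sup>2"
  have C: "1 / \<epsilon> + 3 / \<epsilon>\<^sup>2 \<le> C" "(2 + \<nu>) / \<epsilon>\<^sup>2 \<le> C" using \<epsilon> \<nu> by (simp_all add: C_def)
  have bw: "bounded_weight (m s) (weight_grad \<nu> \<epsilon> (1 + s)) C" if "0 \<le> s" for s
  proof -
    interpret b: bounded_weight "m s" "weight_grad \<nu> \<epsilon> (1 + s)" "1 / \<epsilon> + 3 / \<epsilon>\<^sup>2"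
      unfolding m_def by (rule bounded_weight_weight[OF \<epsilon> _ \<nu>]) (use that in simp)
    show ?thesis
      by unfold_locales (use b.deriv b.dm_cont order_trans[OF b.m_bound C(1)] order_trans[OF b.dm_bound C(1)] in auto)
  qed
  have en: "L2inner lborel (U t) (\<lambda>x. m t x * U t x) \<le> L2inner lborel (U 0) (\<lambda>x. m 0 x * U 0 x)"
  proof (rule weighted_energy_le_init[OF bw])
    show "weight_dt \<nu> \<epsilon> (1 + s) \<in> borel_measurable borel" if "0 \<le> s" for s
      by (rule borel_measurable_continuous_onI, rule weight_continuous(2)) (use that \<epsilon> in auto)
    show "\<bar>weight_dt \<nu> \<epsilon> (1 + s) x\<bar> \<le> C" if "0 \<le> s" for s x
      using order_trans[OF weight_bounds(4)[OF \<epsilon> _ \<nu>] C(2)] that by simp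
    show "\<bar>m s' x - m s x - (s' - s) * weight_dt \<nu> \<epsilon> (1 + s) x\<bar> \<le> c * (s' - s)\<^sup>2" if "0 \<le> s" "0 \<le> s'" for s s' x
      using c[of "1 + s" "1 + s'" x] that by (simp add: m_def)
    show "0 \<le> (\<integral>x. 2 * (G x \<bullet> (m s x *\<^sub>R G x + \<phi> x *\<^sub>R weight_grad \<nu> \<epsilon> (1 + s) x)) - weight_dt \<nu> \<epsilon> (1 + s) x * (\<phi> x)\<^sup>2 \<partial>lborel)"
      if "0 \<le> s" "test_pair (curved_wedge \<theta> a) \<phi> G" for s \<phi> G
      unfolding m_def \<nu>_def by (rule wedge_weighted_form_nonneg[OF a \<theta> \<theta>'_cont \<epsilon> _ that(2)]) (use that in auto)
  qed (use t in auto)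
  have nn: "ennreal (L2inner lborel (U s) (\<lambda>x. m s x * U s x)) = (\<integral>\<^sup>+x. ennreal (m s x * (U s x)\<^sup>2) \<partial>lborel)" if s: "0 \<le> s" for s
  proof -
    have "integrable lborel (\<lambda>x. U s x * (m s x * U s x))"
      \<comment> \<open>Only the function part of the multiplication lemma is used here; the zero
        field is a placeholder for the gradient it expects.\<close>
      by (intro square_int_mult_integrable U_square_int bounded_weight.square_int_weighted(1)[OF bw[OF s] U_square_int, of s "\<lambda>_. 0"])
         (use s in \<open>auto simp: square_int_def\<close>)
    moreover have "0 \<le> U s x * (m s x * U s x)" for x
    proof -
      have "0 \<le> m s x" unfolding m_def by (rule weight_bounds(1)[OF \<epsilon> _ \<nu>]) (use s in simp)
      then have "0 \<le> m s x * (U s x * U s x)" by simp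
      then show ?thesis by (simp only: mult.left_commute)
    qed
    ultimately have "(\<integral>\<^sup>+x. ennreal (U s x * (m s x * U s x)) \<partial>lborel) = ennreal (\<integral>x. U s x * (m s x * U s x) \<partial>lborel)"
      by (intro nn_integral_eq_integral AE_I2)
    then show ?thesis by (simp add: L2inner_def power2_eq_square mult_ac)
  qed
  have "ennreal (1 / p) * (\<integral>\<^sup>+x. ennreal ((U t x)\<^sup>2) \<partial>lborel) = (\<integral>\<^sup>+x. ennreal (1 / p * (U t x)\<^sup>2) \<partial>lborel)"
  proof -
    have "ennreal (1 / p * (U t x)\<^sup>2) = ennreal (1 / p) * ennreal ((U t x)\<^sup>2)" for x
      by (rule ennreal_mult) (use p in simp_all)
    then show ?thesis
      using nn_integral_cmult[of "\<lambda>x. ennreal ((U t x)\<^sup>2)" lborel "ennreal (1 / p)"] square_int_measurable[OF U_square_int[OF t]]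
      by (simp only:) simp
  qed
  also have "\<dots> \<le> (\<integral>\<^sup>+x. ennreal (m t x * (U t x)\<^sup>2) \<partial>lborel)"
  proof (intro nn_integral_mono ennreal_leI mult_right_mono)
    fix x :: "real \<times> real"
    have "gauss_kernel \<nu> (1 + t) ((norm x)\<^sup>2) \<le> (1 + t) powr (- 1 - \<nu>)"
      using t by (simp add: gauss_kernel_def mult_left_le)
    moreover have "0 < gauss_kernel \<nu> (1 + t) ((norm x)\<^sup>2)" using t by (intro gauss_kernel_pos) simp
    ultimately show "1 / p \<le> m t x"
      unfolding m_def weight_def p_def using \<epsilon> by (intro divide_left_mono) auto
  qed simp
  also have "\<dots> = ennreal (L2inner lborel (U t) (\<lambda>x. m t x * U t x))" by (rule nn[OF t, symmetric])
  also have "\<dots> \<le> ennreal (L2inner lborel (U 0) (\<lambda>x. m 0 x * U 0 x))" by (rule ennreal_leI[OF en])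
  also have "\<dots> = (\<integral>\<^sup>+x. ennreal (m 0 x * (U 0 x)\<^sup>2) \<partial>lborel)" by (rule nn) simp
  also have "\<dots> \<le> (\<integral>\<^sup>+x. ennreal ((u0 x)\<^sup>2 * exp ((norm x)\<^sup>2 / 4)) \<partial>lborel)"
  proof (intro nn_integral_mono ennreal_leI)
    fix x :: "real \<times> real"
    \<comment> \<open>At time 0 the parameter T is 1: the power factor is 1, and the Gaussian is
      exactly the inverse of the weight of the initial norm. Dropping \<epsilon> from the
      denominator only enlarges the right side.\<close>
    have "m 0 x \<le> 1 / exp (- ((norm x)\<^sup>2 / 4))"
      unfolding m_def weight_def gauss_kernel_def using \<epsilon> by (intro divide_left_mono) (auto intro!: add_pos_pos mult_pos_pos)
    also have "\<dots> = exp ((norm x)\<^sup>2 / 4)"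
      using exp_minus[of "- ((norm x)\<^sup>2 / 4)"] by (simp add: inverse_eq_divide)
    finally have "m 0 x \<le> exp ((norm x)\<^sup>2 / 4)" .
    then have "(u0 x)\<^sup>2 * m 0 x \<le> (u0 x)\<^sup>2 * exp ((norm x)\<^sup>2 / 4)"
      by (rule mult_left_mono) simp
    then show "m 0 x * (U 0 x)\<^sup>2 \<le> (u0 x)\<^sup>2 * exp ((norm x)\<^sup>2 / 4)"
      by (simp add: U_0 mult.commute)
  qed
  finally have "ennreal p * (ennreal (1 / p) * (\<integral>\<^sup>+x. ennreal ((U t x)\<^sup>2) \<partial>lborel))
      \<le> ennreal p * (\<integral>\<^sup>+x. ennreal ((u0 x)\<^sup>2 * exp ((norm x)\<^sup>2 / 4)) \<partial>lborel)"
    by (rule mult_left_mono) simp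
  moreover have "ennreal p * ennreal (1 / p) = 1" using p by (simp flip: ennreal_mult)
  ultimately show ?thesis unfolding p_def \<nu>_def by (simp add: mult.assoc[symmetric])
qed

theorem theorem2p5:
  fixes a :: real and \<theta> \<theta>' :: "real \<Rightarrow> real"
  assumes "0 < a" and "a \<le> 1"
    and "\<forall>r>0. (\<theta> has_real_derivative \<theta>' r) (at r)"
    and "continuous_on {0<..} \<theta>'"
    and "\<exists>M. \<forall>r>0. \<bar>r * \<theta>' r\<bar> \<le> M"
    and "\<exists>R>0. \<forall>r\<ge>R. \<theta>' r = 0"
  shows "Gamma_decay \<theta> a \<ge> ereal (1/2 + 1/(4*a))"
proof -
  define \<gamma> where "\<gamma> = 1/2 + 1/(4*a)"
  have "heat_decay_bound (curved_wedge \<theta> a) 1 \<gamma>"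
    unfolding heat_decay_bound_def
  proof (intro allI impI, elim conjE)
    fix t u0 U W
    assume t: "0 \<le> (t::real)" and u0: "L2_on (curved_wedge \<theta> a) u0" and sol: "dirichlet_heat_solution (curved_wedge \<theta> a) u0 U W"
    define I where "I = (\<integral>\<^sup>+x. ennreal ((u0 x)\<^sup>2 * exp ((norm x)\<^sup>2 / 4)) \<partial>lborel)"
    define E where "E = (\<integral>\<^sup>+x. ennreal ((U t x)\<^sup>2) \<partial>lborel)"
    define p where "p = (1 + t) powr (- 1 - 1 / (2 * a))"
    have p: "0 < p" using t by (simp add: p_def)
    \<comment> \<open>The energy estimate concerns squared norms, so twice the rate must equal 1 +
      \<nu> with \<nu> = 1 / (2 * a).\<close>
    have "(1 + t) powr - \<gamma> * (1 + t) powr - \<gamma> = (1 + t) powr (- \<gamma> + - \<gamma>)" by (rule powr_add[symmetric])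
    also have "- \<gamma> + - \<gamma> = - 1 - 1 / (2 * a)" using assms(1) by (simp add: \<gamma>_def field_simps)
    finally have sq: "(1 * (1 + t) powr - \<gamma>)\<^sup>2 = p" by (simp add: p_def power2_eq_square)
    have bound: "E \<le> ennreal (\<epsilon> + p) * I" if "0 < \<epsilon>" for \<epsilon>
      unfolding E_def I_def p_def
      by (rule wedge_heat_bound[OF assms(1,2) _ assms(4) _ t that])
         (use assms(3) sol u0 in \<open>auto intro: heat_solution.intro\<close>)
    have "E \<le> ennreal p * I"
    \<comment> \<open>The bound holds for every positive \<epsilon>, and a limit is taken when the
      weighted initial norm is finite. If it is infinite, the right side is infinite because p is
      positive.\<close>
    proof (cases I)
      case (real i)
      have "((\<lambda>\<epsilon>. ennreal ((\<epsilon> + p) * i)) \<longlongrightarrow> ennreal ((0 + p) * i)) (at_right 0)"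
        by (intro tendsto_intros)
      moreover have "\<forall>\<^sub>F \<epsilon> in at_right 0. E \<le> ennreal ((\<epsilon> + p) * i)"
        unfolding eventually_at_right_field
        using bound p real by (intro exI[of _ 1]) (auto simp: ennreal_mult)
      ultimately have "E \<le> ennreal ((0 + p) * i)"
        by (rule tendsto_lowerbound) simp
      then show ?thesis using real p by (simp add: ennreal_mult)
    next
      case top
      then show ?thesis using p by (simp add: ennreal_mult_top)
    qed
    then show "(\<integral>\<^sup>+x. ennreal ((U t x)\<^sup>2) \<partial>lborel) \<le> ennreal ((1 * (1 + t) powr - \<gamma>)\<^sup>2) *
        (\<integral>\<^sup>+x. ennreal ((u0 x)\<^sup>2 * exp ((norm x)\<^sup>2 / 4)) \<partial>lborel)"
      unfolding sq E_def I_def .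
  qed
  then have "\<exists>C>0. heat_decay_bound (curved_wedge \<theta> a) C \<gamma>"
    by (intro exI[of _ 1]) simp
  then show ?thesis
    unfolding Gamma_decay_def \<gamma>_def by (intro Sup_upper) blast
qed

end
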